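(* Let $\sigma$ be a complete intersection cone of dimension $n>1$. Then the number of extreme rays of $\sigma$ is at most $2n-2$, and it equals $2n-2$ if and only if $\sigma$ is a general bipyramidal cone.
   Context: For finite $A\subset\mathbb{Z}^N$ with $\mathbb{N}A\cap(-\mathbb{N}A)=\{\mathbf0\}$, the toric ideal $I_A$ is the kernel of $K[x_1,\dots,x_m]\to K[t_1^{\pm1},\dots,t_N^{\pm1}]$, $x_i\mapsto\mathbf{t}^{\mathbf{a}_i}$; it is a complete intersection if its minimal number of generators equals its height. A cone $\sigma$ is a complete intersection cone if $\sigma=\mathrm{pos}_{\mathbb{Q}}(A)$ (nonnegative rational combinations) for such an $A$ with $I_A$ a complete intersection. The dimension of a cone is the dimension of its rational linear span. Extreme rays are the one-dimensional faces, where a face of $\sigma$ is $\sigma\cap\{\mathbf{x}:\mathbf{c}\cdot\mathbf{x}=0\}$ with $\mathbf{c}\cdot\mathbf{x}\ge0$ on $\sigma$. For strongly convex rational polyhedral cones $\sigma_1,\sigma_2$ with some $\mathbf{a}\in\sigma_1\cap\sigma_2$ such that $\mathrm{span}_{\mathbb{Q}}(\sigma_1)\cap\mathrm{span}_{\mathbb{Q}}(\sigma_2)=\mathbb{Q}\mathbf{a}$, the direct sum $\sigma_1\oplus\sigma_2=\mathrm{pos}_{\mathbb{Q}}(\sigma_1\cup\sigma_2)$ is of internal type if $\mathbf{a}$ lies on no extreme ray of $\sigma_1$ nor of $\sigma_2$. A 2-simplex cone is $\mathrm{pos}_{\mathbb{Q}}(\mathbf{r}_1,\mathbf{r}_2)$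 with $\mathbf{r}_1,\mathbf{r}_2$ linearly independent. General bipyramidal cones are the elements of the smallest class of cones containing all 2-simplex cones and closed under direct sums of internal type. *)

theory Defs
  imports "HOL-Analysis.Analysis" "HOL-Library.Poly_Mapping" "HOL-Library.Extended_Nat"
begin

text \<open>Monomials in the variables x_a (a a lattice point) are finitely supported
  exponent maps; polynomials are finitely supported coefficient maps on monomials.
  The ring K[x_a : a in A] is the subring of polynomials only involving variables in A.\<close>

type_synonym ('k, 'n) lpoly = "((int ^ 'n) \<Rightarrow>\<^sub>0 nat) \<Rightarrow>\<^sub>0 'k"

definition poly_ring :: "'k itself \<Rightarrow> (int ^ 'n) set \<Rightarrow> ('k::field, 'n) lpoly set" where
  "poly_ring K A = {p. \<forall>e \<in> Poly_Mapping.keys p. Poly_Mapping.keys e \<subseteq> A}"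

text \<open>Exponent of the Laurent monomial t^(sum e_a a) that the monomial x^e maps to.\<close>
definition lat_deg :: "((int ^ 'n) \<Rightarrow>\<^sub>0 nat) \<Rightarrow> int ^ 'n" where
  "lat_deg e = (\<Sum>a\<in>Poly_Mapping.keys e. of_int (int (Poly_Mapping.lookup e a)) *s a)"

text \<open>The homomorphism x_a |-> t^a into the Laurent polynomial ring K[t^(+-1)] = K[Z^N],
  the latter represented as finitely supported maps Z^N -> K; we record the coefficient
  of t^u of the image of p.\<close>
definition toric_image_coeff :: "('k::field, 'n) lpoly \<Rightarrow> int ^ 'n \<Rightarrow> 'k" where
  "toric_image_coeff p u = (\<Sum>e\<in>{e\<in>Poly_Mapping.keys p. lat_deg e = u}. Poly_Mapping.lookup p e)"

definition toric_ideal :: "'k itself \<Rightarrow> (int ^ 'n) set \<Rightarrow> ('k::field, 'n) lpoly set" where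
  "toric_ideal K A = {p \<in> poly_ring K A. \<forall>u. toric_image_coeff p u = 0}"

definition ideal_in :: "'a::comm_ring_1 set \<Rightarrow> 'a set \<Rightarrow> bool" where
  "ideal_in R I \<longleftrightarrow> I \<subseteq> R \<and> 0 \<in> I \<and> (\<forall>x\<in>I. \<forall>y\<in>I. x + y \<in> I)
     \<and> (\<forall>r\<in>R. \<forall>x\<in>I. r * x \<in> I)"

definition generated_ideal_in :: "'a::comm_ring_1 set \<Rightarrow> 'a set \<Rightarrow> 'a set" where
  "generated_ideal_in R G = {(\<Sum>g\<in>G. h g * g) | h. \<forall>g\<in>G. h g \<in> R}"

definition min_num_gens :: "'a::comm_ring_1 set \<Rightarrow> 'a set \<Rightarrow> nat" where
  "min_num_gens R I = (LEAST n. \<exists>G. finite G \<and> card G = n \<and> G \<subseteq> R \<and> generated_ideal_in R G = I)"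

definition prime_ideal_in :: "'a::comm_ring_1 set \<Rightarrow> 'a set \<Rightarrow> bool" where
  "prime_ideal_in R P \<longleftrightarrow> ideal_in R P \<and> P \<noteq> R \<and>
     (\<forall>x\<in>R. \<forall>y\<in>R. x * y \<in> P \<longrightarrow> x \<in> P \<or> y \<in> P)"

definition prime_height :: "'a::comm_ring_1 set \<Rightarrow> 'a set \<Rightarrow> enat" where
  "prime_height R P = (SUP n\<in>{n. \<exists>c. (\<forall>i\<le>n. prime_ideal_in R (c i)) \<and>
        (\<forall>i<n. c i \<subset> c (Suc i)) \<and> c n = P}. enat n)"

definition ideal_height :: "'a::comm_ring_1 set \<Rightarrow> 'a set \<Rightarrow> enat" where
  "ideal_height R I = (INF P\<in>{P. prime_ideal_in R P \<and> I \<subseteq> P}. prime_height R P)"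

definition complete_intersection_ideal :: "'a::comm_ring_1 set \<Rightarrow> 'a set \<Rightarrow> bool" where
  "complete_intersection_ideal R I \<longleftrightarrow> enat (min_num_gens R I) = ideal_height R I"

definition rat_of_lat :: "int ^ 'n \<Rightarrow> rat ^ 'n" where
  "rat_of_lat a = (\<chi> i. of_int (a $ i))"

definition pos_cone :: "(rat ^ 'n) set \<Rightarrow> (rat ^ 'n) set" where
  "pos_cone S = {(\<Sum>v\<in>F. c v *s v) | F c. finite F \<and> F \<subseteq> S \<and> (\<forall>v\<in>F. c v \<ge> 0)}"

definition nat_monoid :: "(int ^ 'n) set \<Rightarrow> (int ^ 'n) set" where
  "nat_monoid A = {(\<Sum>a\<in>A. of_int (int (c a)) *s a) | c. True}"

definition ci_cone :: "'k::field itself \<Rightarrow> (rat ^ 'n) set \<Rightarrow> bool" where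
  "ci_cone K \<sigma> \<longleftrightarrow> (\<exists>A. finite A \<and> nat_monoid A \<inter> uminus ` nat_monoid A = {0}
       \<and> \<sigma> = pos_cone (rat_of_lat ` A)
       \<and> complete_intersection_ideal (poly_ring K A) (toric_ideal K A))"

definition qdot :: "rat ^ 'n \<Rightarrow> rat ^ 'n \<Rightarrow> rat" where
  "qdot c x = (\<Sum>i\<in>UNIV. c $ i * x $ i)"

definition cone_dim :: "(rat ^ 'n) set \<Rightarrow> nat" where
  "cone_dim \<sigma> = vec.dim \<sigma>"

definition faces :: "(rat ^ 'n) set \<Rightarrow> (rat ^ 'n) set set" where
  "faces \<sigma> = {\<sigma> \<inter> {x. qdot c x = 0} | c. \<forall>x\<in>\<sigma>. qdot c x \<ge> 0}"

definition extreme_rays :: "(rat ^ 'n) set \<Rightarrow> (rat ^ 'n) set set" where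
  "extreme_rays \<sigma> = {\<tau> \<in> faces \<sigma>. cone_dim \<tau> = 1}"

definition rational_polyhedral_cone :: "(rat ^ 'n) set \<Rightarrow> bool" where
  "rational_polyhedral_cone \<sigma> \<longleftrightarrow> (\<exists>S. finite S \<and> \<sigma> = pos_cone S)"

definition strongly_convex :: "(rat ^ 'n) set \<Rightarrow> bool" where
  "strongly_convex \<sigma> \<longleftrightarrow> \<sigma> \<inter> uminus ` \<sigma> = {0}"

definition internal_direct_sum :: "(rat ^ 'n) set \<Rightarrow> (rat ^ 'n) set \<Rightarrow> (rat ^ 'n) set \<Rightarrow> bool" where
  "internal_direct_sum \<sigma>1 \<sigma>2 \<sigma> \<longleftrightarrow>
     rational_polyhedral_cone \<sigma>1 \<and> strongly_convex \<sigma>1 \<and>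
     rational_polyhedral_cone \<sigma>2 \<and> strongly_convex \<sigma>2 \<and>
     (\<exists>a\<in>\<sigma>1 \<inter> \<sigma>2. vec.span \<sigma>1 \<inter> vec.span \<sigma>2 = {t *s a | t. True}
        \<and> (\<forall>\<rho>\<in>extreme_rays \<sigma>1. a \<notin> \<rho>) \<and> (\<forall>\<rho>\<in>extreme_rays \<sigma>2. a \<notin> \<rho>)) \<and>
     \<sigma> = pos_cone (\<sigma>1 \<union> \<sigma>2)"

inductive_set general_bipyramidal :: "(rat ^ 'n) set set" where
  simplex2: "vec.independent {r1, r2} \<Longrightarrow> r1 \<noteq> r2 \<Longrightarrow> pos_cone {r1, r2} \<in> general_bipyramidal"
| dsum: "\<sigma>1 \<in> general_bipyramidal \<Longrightarrow> \<sigma>2 \<in> general_bipyramidal \<Longrightarrow>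
         internal_direct_sum \<sigma>1 \<sigma>2 \<sigma> \<Longrightarrow> \<sigma> \<in> general_bipyramidal"

end

theory Submission
  imports Defs
begin

text \<open>
  Let \<open>A\<close> be a configuration of \<open>m\<close> nonzero points of rank \<open>d\<close> whose toric ideal is a complete intersection.
  Comparing the number of generators with the dimension of \<open>I / (\<mm> \<cdot> I)\<close> shows that \<open>I\<close> is generated by \<open>m - d\<close>
  binomials. They are dominating: fewer than \<open>card C\<close> of them have variables from a nonempty set \<open>C\<close> in both
  monomials, since otherwise \<open>C\<close> could be enlarged to the complement of a face of full dimension.
  View a binomial as a complete bipartite graph of its own colour between the supports of its two monomials.
  Domination says that no cycle has pairwise distinct colours, and this forces a partition \<open>A = A\<^sub>1 \<union> A\<^sub>2\<close> such that
  at most one binomial crosses it, with its two monomials on different sides. The cone is then the sum of two cones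
  whose spans meet at most in a line, and the bound on extreme rays and its equality case follow by induction on \<open>m\<close>.
\<close>

section \<open>Dominating systems of rows\<close>

text \<open>The obstacle is that the hypothesis only compares two numbers: the generators it
  supplies are arbitrary polynomials, and the height is a supremum over chains of primes. The height
  is bounded above by a growth count: every strict inclusion of primes multiplies by
  \<open>t\<close> the size of an independent family whose exponents stay linear in
  \<open>t\<close>, and such families have at most polynomial size of degree \<open>card A\<close>.
  Pointedness admits the lattice point 0 in \<open>A\<close>. Its variable minus 1 then lies in the
  ideal and costs exactly one generator, so the count survives when 0 is discarded. The number 2n -
  2 comes from additivity. With a crossing relation the parts satisfy n1 + n2 = n + 1, whence (2 n1
  - 2) + (2 n2 - 2) = 2n - 2; without one, n1 + n2 = n and the count falls short unless both parts
  are rays. A part of dimension one has more than 2 - 2 extreme rays, so it is treated apart: a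
  crossing relation puts it inside the other part.\<close>

definition row_edge :: "('i \<Rightarrow> 'a set) \<Rightarrow> ('i \<Rightarrow> 'a set) \<Rightarrow> 'i \<Rightarrow> 'a \<Rightarrow> 'a \<Rightarrow> bool" where
  "row_edge P N i x y \<longleftrightarrow> x \<in> P i \<and> y \<in> N i \<or> x \<in> N i \<and> y \<in> P i"

text \<open>Only the colours are recorded: a walk is rainbow when this list is
  \<open>distinct\<close>, whatever vertices it repeats.\<close>

inductive row_walk :: "('i \<Rightarrow> 'a set) \<Rightarrow> ('i \<Rightarrow> 'a set) \<Rightarrow> 'a \<Rightarrow> 'i list \<Rightarrow> 'a \<Rightarrow> bool" for P N where
  Nil: "row_walk P N x [] x"
| Cons: "row_edge P N i x y \<Longrightarrow> row_walk P N y cs z \<Longrightarrow> row_walk P N x (i # cs) z"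

inductive_simps row_walk_Nil [simp]: "row_walk P N x [] y"
inductive_simps row_walk_Cons: "row_walk P N x (i # cs) y"

lemma row_walk_append:
  "row_walk P N x (cs @ ds) z \<longleftrightarrow> (\<exists>y. row_walk P N x cs y \<and> row_walk P N y ds z)"
  by (induction cs arbitrary: x) (auto simp: row_walk_Cons)

lemma row_edge_sym: "row_edge P N i x y \<longleftrightarrow> row_edge P N i y x"
  by (auto simp: row_edge_def)

lemma row_walk_rev: "row_walk P N x cs y \<Longrightarrow> row_walk P N y (rev cs) x"
  by (induction rule: row_walk.induct)
     (auto simp: row_walk_append row_walk_Cons row_edge_sym)

lemma row_walk_in_middle:
  assumes "row_walk P N x cs y" "c \<in> set cs"
  obtains cs1 u v cs2 where "cs = cs1 @ c # cs2" "row_walk P N x cs1 u" "row_edge P N c u v"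
    "row_walk P N v cs2 y"
proof -
  obtain cs1 cs2 where "cs = cs1 @ c # cs2" using assms(2) by (meson split_list)
  with assms(1) show thesis using that by (auto simp: row_walk_append row_walk_Cons)
qed

definition straddling :: "'i set \<Rightarrow> ('i \<Rightarrow> 'a set) \<Rightarrow> ('i \<Rightarrow> 'a set) \<Rightarrow> 'a set \<Rightarrow> 'i set" where
  "straddling I P N C = {i \<in> I. P i \<inter> C \<noteq> {} \<and> N i \<inter> C \<noteq> {}}"

text \<open>Read row \<open>i\<close> as a sign vector with positive support \<open>P i\<close> and
  negative support \<open>N i\<close>. Then \<open>dom\<close> forbids square submatrices all of
  whose rows have both signs; with nonempty sides this is a mixed dominating matrix.\<close>

locale dominating =
  fixes A :: "'a set" and I :: "'i set" and P N :: "'i \<Rightarrow> 'a set"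
  assumes finite_A: "finite A" and finite_I: "finite I"
    and P_sub: "i \<in> I \<Longrightarrow> P i \<subseteq> A" and N_sub: "i \<in> I \<Longrightarrow> N i \<subseteq> A"
    and P_ne: "i \<in> I \<Longrightarrow> P i \<noteq> {}" and N_ne: "i \<in> I \<Longrightarrow> N i \<noteq> {}"
    and dom: "C \<subseteq> A \<Longrightarrow> C \<noteq> {} \<Longrightarrow> card (straddling I P N C) < card C"
begin

lemma finite_straddling [simp]: "finite (straddling I P N C)"
  using finite_I by (auto simp: straddling_def)

lemma straddling_all: "straddling I P N A = I"
proof -
  have "P i \<inter> A \<noteq> {} \<and> N i \<inter> A \<noteq> {}" if "i \<in> I" for i
    using P_sub[OF that] N_sub[OF that] P_ne[OF that] N_ne[OF that] by (simp add: Int_absorb2)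
  then show ?thesis by (auto simp: straddling_def)
qed

lemma sides_disjoint: "i \<in> I \<Longrightarrow> P i \<inter> N i = {}"
proof (rule ccontr)
  assume i: "i \<in> I" and "P i \<inter> N i \<noteq> {}"
  then obtain x where x: "x \<in> P i" "x \<in> N i" by auto
  then have "i \<in> straddling I P N {x}" using i by (auto simp: straddling_def)
  then have "card (straddling I P N {x}) \<noteq> 0" by auto
  moreover have "card (straddling I P N {x}) < 1" using dom[of "{x}"] P_sub[OF i] x by auto
  ultimately show False by simp
qed

text \<open>A closed walk of length k with distinct colours visits at most k points, and each of its
  k colours has both sides represented among them; these points violate \<open>dom\<close>.\<close>

lemma no_rainbow_closed:
  assumes "row_walk P N x cs x" "distinct cs" "set cs \<subseteq> I"
  shows "cs = []"
proof (rule ccontr)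
  assume ne: "cs \<noteq> []"
  \<comment> \<open>The induction runs over open walks, so \<open>C\<close> collects the starting
    points of the edges and the end \<open>y\<close> is adjoined separately. On a closed walk
    \<open>y\<close> is already in \<open>C\<close>, which saves the decisive point.\<close>
  have ex: "\<exists>C. finite C \<and> C \<subseteq> A \<and> x \<in> C \<and> card C \<le> length cs
      \<and> (\<forall>i\<in>set cs. P i \<inter> insert y C \<noteq> {} \<and> N i \<inter> insert y C \<noteq> {})"
    if "row_walk P N x cs y" "set cs \<subseteq> I" "cs \<noteq> []" for x y cs
    using that
  proof (induction rule: row_walk.induct)
    case (Cons i x w cs z)
    have x: "x \<in> A" using Cons.hyps(1) Cons.prems P_sub N_sub by (auto simp: row_edge_def)
    show ?case
    proof (cases "cs = []")
      case True
      then have "w = z" using Cons.hyps(2) by simp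
      then show ?thesis using Cons.hyps(1) True x
        by (intro exI[of _ "{x}"]) (simp add: row_edge_def, blast)
    next
      case False
      then obtain C where C: "finite C" "C \<subseteq> A" "w \<in> C" "card C \<le> length cs"
        "\<forall>i\<in>set cs. P i \<inter> insert z C \<noteq> {} \<and> N i \<inter> insert z C \<noteq> {}"
        using Cons by auto
      have "card (insert x C) \<le> length (i # cs)" using C(1,4) card_insert_le_m1[of "length (i#cs)" C x]
        by auto
      moreover have "P i \<inter> insert z (insert x C) \<noteq> {} \<and> N i \<inter> insert z (insert x C) \<noteq> {}"
        using Cons.hyps(1) C(3) by (auto simp: row_edge_def)
      ultimately show ?thesis using C x
        by (intro exI[of _ "insert x C"]) auto
    qed
  qed simp
  obtain C where C: "finite C" "C \<subseteq> A" "x \<in> C" "card C \<le> length cs"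
    "\<forall>i\<in>set cs. P i \<inter> C \<noteq> {} \<and> N i \<inter> C \<noteq> {}"
    using ex[OF assms(1,3) ne] by (auto simp: insert_absorb)
  have "set cs \<subseteq> straddling I P N C" using C(5) assms(3) by (auto simp: straddling_def)
  then have "length cs \<le> card (straddling I P N C)"
    using card_mono[OF finite_straddling] distinct_card[OF assms(2)] by metis
  then show False using dom[of C] C by auto
qed

text \<open>Choosing one edge per straddling row gives a graph on a tight set \<open>C\<close> with \<open>card C - 1\<close>
  edges; a disconnection would violate domination on one of the two parts.\<close>

lemma tight_rainbow_walk:
  assumes C: "C \<subseteq> A" "z \<in> C" "b \<in> C" and tight: "card C \<le> card (straddling I P N C) + 1"
  obtains cs where "row_walk P N z cs b" "distinct cs" "set cs \<subseteq> I"
proof -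
  let ?S = "straddling I P N C"
  define p where "p i = (SOME x. x \<in> P i \<inter> C)" for i
  define n where "n i = (SOME x. x \<in> N i \<inter> C)" for i
  have p: "p i \<in> P i \<inter> C" if "i \<in> ?S" for i
    using that unfolding p_def straddling_def by - (rule someI_ex, auto)
  have n: "n i \<in> N i \<inter> C" if "i \<in> ?S" for i
    using that unfolding n_def straddling_def by - (rule someI_ex, auto)
  let ?W = "row_walk (\<lambda>i. {p i}) (\<lambda>i. {n i})"
  \<comment> \<open>Component of \<open>z\<close> in the chosen graph, in which row \<open>i\<close>
    has the single edge from \<open>p i\<close> to \<open>n i\<close>; the walks are required to be
    rainbow.\<close>
  define X where "X = {y \<in> C. \<exists>cs. ?W z cs y \<and> distinct cs \<and> set cs \<subseteq> ?S}"
  have closed: "y \<in> X" if "x \<in> X" "i \<in> ?S" "row_edge (\<lambda>i. {p i}) (\<lambda>i. {n i}) i x y" for x y i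
  proof -
    obtain cs where cs: "?W z cs x" "distinct cs" "set cs \<subseteq> ?S" using \<open>x \<in> X\<close> by (auto simp: X_def)
    have "y \<in> C" using p[OF that(2)] n[OF that(2)] that(3) by (auto simp: row_edge_def)
    show ?thesis
    proof (cases "i \<in> set cs")
      case False
      have "?W z (cs @ [i]) y" using cs that by (auto simp: row_walk_append row_walk_Cons)
      moreover have "distinct (cs @ [i])" "set (cs @ [i]) \<subseteq> ?S" using False cs that by auto
      ultimately show ?thesis using \<open>y \<in> C\<close> unfolding X_def by blast
    next
      \<comment> \<open>A colour already on the walk has only one edge, so \<open>y\<close> is an
        end of that edge and a prefix of the walk reaches it.\<close>
      case True
      then obtain cs1 u v cs2 where s: "cs = cs1 @ i # cs2" "?W z cs1 u"
        "row_edge (\<lambda>i. {p i}) (\<lambda>i. {n i}) i u v" "?W v cs2 x"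
        by (rule row_walk_in_middle[OF cs(1)])
      have "?W z (cs1 @ [i]) v" using s by (auto simp: row_walk_append row_walk_Cons)
      moreover have "y = u \<or> y = v" using s(3) that(3) by (auto simp: row_edge_def)
      moreover have "distinct (cs1 @ [i])" "set (cs1 @ [i]) \<subseteq> ?S" "distinct cs1" "set cs1 \<subseteq> ?S"
        using s cs by auto
      ultimately show ?thesis using s(2) \<open>y \<in> C\<close> unfolding X_def by blast
    qed
  qed
  have "?W z [] z" by simp
  then have "z \<in> X" using C(2) unfolding X_def by fastforce
  have "b \<in> X"
  proof (rule ccontr)
    assume "b \<notin> X"
    let ?Y = "C - X"
    have "?S \<subseteq> straddling I P N X \<union> straddling I P N ?Y"
    proof
      fix i assume i: "i \<in> ?S"
      have "p i \<in> X \<longleftrightarrow> n i \<in> X"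
        using closed[OF _ i, of "p i" "n i"] closed[OF _ i, of "n i" "p i"] by (simp add: row_edge_def) blast
      then show "i \<in> straddling I P N X \<union> straddling I P N ?Y"
        using p[OF i] n[OF i] i by (auto simp: straddling_def)
    qed
    then have "card ?S \<le> card (straddling I P N X \<union> straddling I P N ?Y)"
      by (intro card_mono) auto
    also have "\<dots> \<le> card (straddling I P N X) + card (straddling I P N ?Y)" by (rule card_Un_le)
    finally have 1: "card ?S \<le> card (straddling I P N X) + card (straddling I P N ?Y)" .
    have X: "X \<subseteq> C" by (auto simp: X_def)
    have "card (straddling I P N X) < card X" using dom[of X] X C \<open>z \<in> X\<close> by auto
    moreover have "card (straddling I P N ?Y) < card ?Y" using dom[of ?Y] X C \<open>b \<notin> X\<close> by auto
    moreover have "card X + card ?Y = card C"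
    proof -
      have fC: "finite C" using finite_subset[OF C(1) finite_A] .
      show ?thesis using card_Diff_subset[OF finite_subset[OF X fC] X] card_mono[OF fC X] by simp
    qed
    ultimately show False using 1 tight by linarith
  qed
  then obtain cs where cs: "?W z cs b" "distinct cs" "set cs \<subseteq> ?S" by (auto simp: X_def)
  have "row_walk P N x cs y" if "?W x cs y" "set cs \<subseteq> ?S" for x y
    using that
  proof (induction rule: row_walk.induct)
    case (Cons i x w cs z)
    then have "row_edge P N i x w" using p[of i] n[of i] by (auto simp: row_edge_def)
    moreover have "row_walk P N w cs z" using Cons by simp
    ultimately show ?case by (rule row_walk.Cons)
  qed simp
  then show thesis using that cs by (auto simp: straddling_def)
qed


text \<open>If every element were connected to \<open>z\<close> by a walk with distinct colours, then the relation
  ``from the far side of row \<open>l\<close> one reaches the side of \<open>z\<close> in row \<open>j\<close>'' would be a strict order without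
  maximal element on the rows containing \<open>z\<close>.\<close>

lemma exists_unconnected:
  assumes z: "z \<in> A" and two: "card A \<ge> 2"
    and nonsing: "\<And>i. i \<in> I \<Longrightarrow> P i \<noteq> {z} \<and> N i \<noteq> {z}"
  obtains b where "b \<in> A" "b \<noteq> z"
    "\<And>C. C \<subseteq> A \<Longrightarrow> z \<in> C \<Longrightarrow> b \<in> C \<Longrightarrow> card (straddling I P N C) + 1 < card C"
proof (rule ccontr)
  note obt = that
  assume nt: "\<not> thesis"
  have reach: "\<exists>cs. row_walk P N z cs b \<and> distinct cs \<and> set cs \<subseteq> I" if bA: "b \<in> A" "b \<noteq> z" for b
  proof -
    obtain C where "C \<subseteq> A" "z \<in> C" "b \<in> C" "card C \<le> card (straddling I P N C) + 1"
      using obt[OF bA] nt not_le by blast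
    then show ?thesis using tight_rainbow_walk[of C z b] by blast
  qed
  \<comment> \<open>\<open>S i\<close> is the side of \<open>z\<close> in row \<open>i\<close> and
    \<open>O' i\<close> the far side; in a row without \<open>z\<close> the choice is a mere
    default.\<close>
  define S where "S i = (if z \<in> P i then P i else N i)" for i
  define O' where "O' i = (if z \<in> P i then N i else P i)" for i
  have edge: "row_edge P N i x y \<longleftrightarrow> x \<in> S i \<and> y \<in> O' i \<or> x \<in> O' i \<and> y \<in> S i" for i x y
    by (auto simp: row_edge_def S_def O'_def)
  let ?W = "row_walk P N"
  define J where "J = {i \<in> I. z \<in> S i}"
  have JI: "j \<in> I" "z \<in> S j" if "j \<in> J" for j using that by (auto simp: J_def)
  have zO: "z \<notin> O' i" if "i \<in> I" for i using sides_disjoint[OF that] by (auto simp: O'_def)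
  \<comment> \<open>A rainbow walk from \<open>z\<close> avoiding \<open>j\<close> can only meet row
    \<open>j\<close> on the side of \<open>z\<close>: from the far side an edge of colour
    \<open>j\<close> would lead back to \<open>z\<close> and close a rainbow walk.\<close>
  have from_z: "x \<in> S j" if "j \<in> J" "?W z cs x" "distinct cs" "set cs \<subseteq> I" "j \<notin> set cs"
    "row_edge P N j x y" for j cs x y
  proof (rule ccontr)
    assume "x \<notin> S j"
    then have "x \<in> O' j" using that(6) by (auto simp: edge)
    then have "row_edge P N j x z" using JI(2)[OF that(1)] by (auto simp: edge)
    then have "?W z (cs @ [j]) z" using that(2) by (auto simp: row_walk_append row_walk_Cons)
    then show False using no_rainbow_closed[of z "cs @ [j]"] that JI(1) by auto
  qed
  define E where "E j l \<longleftrightarrow> (\<exists>n\<in>O' l. \<exists>p\<in>S j. \<exists>cs. ?W n cs p \<and> distinct cs \<and> set cs \<subseteq> I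
      \<and> j \<notin> set cs \<and> l \<notin> set cs)" for j l
  have irrefl: "\<not> E j j" if "j \<in> J" for j
  proof
    assume "E j j"
    then obtain n p cs where w: "n \<in> O' j" "p \<in> S j" "?W n cs p" "distinct cs" "set cs \<subseteq> I" "j \<notin> set cs"
      by (auto simp: E_def)
    then have "?W n (cs @ [j]) n" by (auto simp: row_walk_append row_walk_Cons edge)
    then show False using no_rainbow_closed[of n "cs @ [j]"] w JI(1)[OF that] by auto
  qed
  \<comment> \<open>The walk \<beta> from row \<open>h\<close> to row \<open>l\<close> and the walk
    \<alpha> from row \<open>l\<close> to row \<open>j\<close> are joined by an edge of colour
    \<open>l\<close>. The cases treat the ways in which the joined walk may repeat or use a
    forbidden colour.\<close>
  have trans: "E j h" if jlh: "j \<in> J" "l \<in> J" "h \<in> J" and "E j l" "E l h" for j l h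
  proof -
    obtain nl pj \<alpha> where a: "nl \<in> O' l" "pj \<in> S j" "?W nl \<alpha> pj" "distinct \<alpha>" "set \<alpha> \<subseteq> I"
      "j \<notin> set \<alpha>" "l \<notin> set \<alpha>" using \<open>E j l\<close> unfolding E_def by auto
    obtain nh pl \<beta> where b: "nh \<in> O' h" "pl \<in> S l" "?W nh \<beta> pl" "distinct \<beta>" "set \<beta> \<subseteq> I"
      "l \<notin> set \<beta>" "h \<notin> set \<beta>" using \<open>E l h\<close> unfolding E_def by auto
    have "j \<noteq> l" "l \<noteq> h" using irrefl jlh \<open>E j l\<close> \<open>E l h\<close> by auto
    have zl: "row_edge P N l z nl" and zh: "row_edge P N h z nh"
      using JI jlh a(1) b(1) by (auto simp: edge)
    consider "j \<in> set \<beta>" | "j \<notin> set \<beta>" "h \<in> set \<alpha>" | "j \<notin> set \<beta>" "h \<notin> set \<alpha>" "set \<alpha> \<inter> set \<beta> \<noteq> {}"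
      | "j \<notin> set \<beta>" "h \<notin> set \<alpha>" "set \<alpha> \<inter> set \<beta> = {}" by blast
    then show ?thesis
    proof cases
      case 1
      obtain b1 x y b2 where s: "\<beta> = b1 @ j # b2" "?W nh b1 x" "row_edge P N j x y" "?W y b2 pl"
        using row_walk_in_middle[OF b(3) 1] .
      have "?W z (h # b1) x" using zh s(2) by (auto simp: row_walk_Cons)
      moreover have "j \<notin> set (h # b1)" using 1 s b by auto
      ultimately have "x \<in> S j" using from_z[OF jlh(1), of "h # b1" x y] s(1,3) b jlh JI by auto
      then show ?thesis unfolding E_def using s b by (intro bexI[of _ nh] bexI[of _ x] exI[of _ b1]) auto
    next
      case 2
      obtain a1 x y a2 where s: "\<alpha> = a1 @ h # a2" "?W nl a1 x" "row_edge P N h x y" "?W y a2 pj"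
        using row_walk_in_middle[OF a(3) 2(2)] .
      have "?W z (l # a1) x" using zl s(2) by (auto simp: row_walk_Cons)
      moreover have "h \<notin> set (l # a1)" using s a \<open>l \<noteq> h\<close> by auto
      ultimately have "x \<in> S h" using from_z[OF jlh(3), of "l # a1" x y] s(1,3) a jlh JI by auto
      then have "y \<in> O' h" using s(3) sides_disjoint[OF JI(1)[OF jlh(3)]]
        by (auto simp: edge S_def O'_def split: if_splits)
      then show ?thesis unfolding E_def using s a 2 by (intro bexI[of _ y] bexI[of _ pj] exI[of _ a2]) auto
    next
      case 3
      \<comment> \<open>Taking the first colour of \<beta> that occurs on \<alpha> keeps
        \<open>b1\<close> disjoint from \<alpha>. As rows are complete bipartite graphs, colour
        \<open>c\<close> leads from \<open>x\<close> either to \<open>y'\<close>, which splices the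
        walks, or to \<open>x'\<close>, which closes a rainbow walk through
        \<open>z\<close>.\<close>
      obtain b1 c b2 where bs: "\<beta> = b1 @ c # b2" "c \<in> set \<alpha>" "\<forall>d\<in>set b1. d \<notin> set \<alpha>"
        using split_list_first_prop[of \<beta> "\<lambda>c. c \<in> set \<alpha>"] 3(3) by auto
      obtain x y where s: "?W nh b1 x" "row_edge P N c x y" "?W y b2 pl"
        using b(3) bs(1) by (auto simp: row_walk_append row_walk_Cons)
      obtain a1 x' y' a2 where t: "\<alpha> = a1 @ c # a2" "?W nl a1 x'" "row_edge P N c x' y'" "?W y' a2 pj"
        using row_walk_in_middle[OF a(3) bs(2)] .
      have "row_edge P N c x y' \<or> row_edge P N c x x'"
        using s(2) t(3) by (auto simp: row_edge_def)
      then show ?thesis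
      proof
        assume "row_edge P N c x y'"
        then have "?W nh (b1 @ c # a2) pj" using s t by (auto simp: row_walk_append row_walk_Cons)
        then show ?thesis unfolding E_def using a b bs t 3
          by (intro bexI[of _ nh] bexI[of _ pj] exI[of _ "b1 @ c # a2"]) auto
      next
        assume "row_edge P N c x x'"
        then have "?W z (h # b1 @ c # rev a1 @ [l]) z"
          using s t zh zl row_walk_rev[OF t(2)] row_edge_sym[of P N l z nl]
          by (auto simp: row_walk_append row_walk_Cons)
        moreover have "distinct (h # b1 @ c # rev a1 @ [l])" using a b bs t 3 \<open>l \<noteq> h\<close> by auto
        ultimately show ?thesis using no_rainbow_closed[of z "h # b1 @ c # rev a1 @ [l]"] a b bs t jlh JI by auto
      qed
    next
      case 4
      have "row_edge P N l pl nl" using a b by (auto simp: edge)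
      then have "?W nh (\<beta> @ l # \<alpha>) pj" using a b by (auto simp: row_walk_append row_walk_Cons)
      then show ?thesis unfolding E_def using a b 4 jlh JI \<open>j \<noteq> l\<close> \<open>l \<noteq> h\<close>
        by (intro bexI[of _ nh] bexI[of _ pj] exI[of _ "\<beta> @ l # \<alpha>"]) auto
    qed
  qed
  have first: "\<exists>l\<in>J. \<exists>n\<in>O' l. \<exists>ds. cs = l # ds \<and> ?W n ds b"
    if w: "?W z cs b" and sub: "set cs \<subseteq> I" and "b \<noteq> z" for cs b
  proof (cases cs)
    case (Cons l ds)
    then obtain n where n: "row_edge P N l z n" "?W n ds b" using w unfolding Cons row_walk_Cons by blast
    then have "z \<in> S l" "n \<in> O' l" using Cons sub zO[of l] by (auto simp: edge)
    then show ?thesis using Cons sub n by (auto simp: J_def)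
  qed (use w \<open>b \<noteq> z\<close> in auto)
  have succ: "\<exists>l\<in>J. E j l" if j: "j \<in> J" for j
  proof -
    \<comment> \<open>As no side equals \<open>{z}\<close>, there is a second point on the side of
      \<open>z\<close>; the first colour of a rainbow walk from \<open>z\<close> to it is the
      successor of \<open>j\<close>.\<close>
    have "S j \<noteq> {z}" using nonsing[OF JI(1)[OF j]] by (auto simp: S_def)
    then obtain p where p: "p \<in> S j" "p \<noteq> z" using JI(2)[OF j] by auto
    then have "p \<in> A" using JI[OF j] P_sub N_sub by (auto simp: S_def split: if_splits)
    then obtain cs where cs: "?W z cs p" "distinct cs" "set cs \<subseteq> I" using reach p by blast
    have jcs: "j \<notin> set cs"
    proof
      assume "j \<in> set cs"
      then obtain c1 x y c2 where s: "cs = c1 @ j # c2" "?W z c1 x" "row_edge P N j x y" "?W y c2 p"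
        by (rule row_walk_in_middle[OF cs(1)])
      have "x \<in> S j" using from_z[OF j s(2) _ _ _ s(3)] s(1) cs by auto
      then have "y \<in> O' j" using s(3) sides_disjoint[OF JI(1)[OF j]]
        by (auto simp: edge S_def O'_def split: if_splits)
      then have "E j j" unfolding E_def using s cs p by (intro bexI[of _ y] bexI[of _ p] exI[of _ c2]) auto
      then show False using irrefl j by auto
    qed
    obtain l n ds where l: "l \<in> J" "n \<in> O' l" "cs = l # ds" "?W n ds p" using first[OF cs(1,3) p(2)] by auto
    then have "E j l" unfolding E_def using cs p jcs by (intro bexI[of _ n] bexI[of _ p] exI[of _ ds]) auto
    then show ?thesis using l by auto
  qed
  have "card (A - {z}) \<noteq> 0" using two z finite_A by (simp add: card_Diff_singleton)
  then obtain b where b: "b \<in> A" "b \<noteq> z" by (metis Diff_iff card.empty equals0I singletonI)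
  then have "J \<noteq> {}" using reach[of b] first by blast
  moreover have "finite J" using finite_I by (auto simp: J_def)
  moreover have "asymp_on J E" by (rule asymp_onI) (use irrefl trans in blast)
  moreover have "transp_on J E" by (rule transp_onI) (use trans in blast)
  ultimately obtain m where "m \<in> J" "\<forall>x\<in>J. x \<noteq> m \<longrightarrow> \<not> E m x" using Finite_Set.bex_max_element[of J E] by blast
  then show False using succ irrefl by metis
qed

text \<open>Identifying \<open>b\<close> with \<open>z\<close> costs a set through both of them one
  point, and \<open>unconn\<close> provides exactly this slack; sets avoiding \<open>z\<close> and
  \<open>b\<close> are unaffected.\<close>

lemma merge:
  assumes zb: "z \<in> A" "b \<in> A" "z \<noteq> b" and I': "I' \<subseteq> I"
    and unconn: "\<And>C. C \<subseteq> A \<Longrightarrow> z \<in> C \<Longrightarrow> b \<in> C \<Longrightarrow> card (straddling I' P N C) + 1 < card C"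
  defines "q \<equiv> \<lambda>x. if x = b then z else x"
  shows "dominating (A - {b}) I' (\<lambda>i. q ` P i) (\<lambda>i. q ` N i)"
proof
  fix C assume C: "C \<subseteq> A - {b}" "C \<noteq> {}"
  have fin: "finite C" using C finite_A finite_subset by blast
  show "card (straddling I' (\<lambda>i. q ` P i) (\<lambda>i. q ` N i) C) < card C"
  proof (cases "z \<in> C")
    case True
    have "straddling I' (\<lambda>i. q ` P i) (\<lambda>i. q ` N i) C \<subseteq> straddling I' P N (insert b C)"
      using C by (auto simp: straddling_def q_def split: if_splits)
    then have "card (straddling I' (\<lambda>i. q ` P i) (\<lambda>i. q ` N i) C) \<le> card (straddling I' P N (insert b C))"
      using finite_subset[OF I' finite_I] by (intro card_mono) (auto simp: straddling_def)
    moreover have "card (straddling I' P N (insert b C)) + 1 < card (insert b C)"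
      using unconn[of "insert b C"] C True zb by auto
    ultimately show ?thesis using fin by (simp add: card_insert_if split: if_splits)
  next
    case False
    have "straddling I' (\<lambda>i. q ` P i) (\<lambda>i. q ` N i) C \<subseteq> straddling I P N C"
      using C I' False by (auto simp: straddling_def q_def split: if_splits)
    then have "card (straddling I' (\<lambda>i. q ` P i) (\<lambda>i. q ` N i) C) \<le> card (straddling I P N C)"
      by (intro card_mono) auto
    moreover have "C \<subseteq> A" using C by blast
    ultimately show ?thesis using dom[of C] C(2) by linarith
  qed
next
  show "finite I'" using I' finite_I by (rule finite_subset)
next
  fix i assume "i \<in> I'"
  then have "i \<in> I" using I' by auto
  note * = P_sub[OF this] N_sub[OF this] P_ne[OF this] N_ne[OF this]
  show "q ` P i \<subseteq> A - {b}" "q ` N i \<subseteq> A - {b}" using * zb by (auto simp: q_def)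
  show "q ` P i \<noteq> {}" "q ` N i \<noteq> {}" using * by auto
qed (use finite_A in auto)

end

section \<open>Splitting a dominating system along at most one crossing row\<close>

definition split_by :: "'i set \<Rightarrow> ('i \<Rightarrow> 'a set) \<Rightarrow> ('i \<Rightarrow> 'a set) \<Rightarrow> 'a set \<Rightarrow> 'a set \<Rightarrow> bool" where
  "split_by I P N A1 A2 \<longleftrightarrow>
    (\<forall>i\<in>I. P i \<union> N i \<subseteq> A1 \<or> P i \<union> N i \<subseteq> A2) \<or>
    (\<exists>i0\<in>I. P i0 \<subseteq> A1 \<and> N i0 \<subseteq> A2 \<and> (\<forall>i\<in>I - {i0}. P i \<union> N i \<subseteq> A1 \<or> P i \<union> N i \<subseteq> A2))"

text \<open>Two points \<open>z\<close> and \<open>b\<close> are identified, the smaller system is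
  split by induction, and the partition is pulled back. A suitable pair always exists. Either some
  \<open>z\<close> is never a full side, and \<open>exists_unconnected\<close> applies; or every
  point is a full side of some row, and since there are fewer rows than points, two points are the
  two sides of one row, which is set aside.\<close>

lemma dominating_split:
  assumes "dominating A I P N" "card A \<ge> 2"
  shows "\<exists>A1 A2. A1 \<noteq> {} \<and> A2 \<noteq> {} \<and> A1 \<inter> A2 = {} \<and> A1 \<union> A2 = A \<and> split_by I P N A1 A2"
  using assms
proof (induction "card A" arbitrary: A I P N rule: less_induct)
  case less
  interpret dominating A I P N by fact
  show ?case
  proof (cases "card A = 2")
    case True
    then obtain a b where ab: "A = {a, b}" "a \<noteq> b" by (meson card_2_iff)
    have sides: "P i = {a} \<and> N i = {b} \<or> P i = {b} \<and> N i = {a}" if "i \<in> I" for i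
    proof -
      have two: "X = {} \<or> X = {a} \<or> X = {b} \<or> X = {a, b}" if "X \<subseteq> A" for X using that ab by auto
      show ?thesis
        using two[OF P_sub[OF that]] two[OF N_sub[OF that]] P_ne[OF that] N_ne[OF that]
          sides_disjoint[OF that] by (elim disjE) simp_all
    qed
    have "card I < 2" using dom[of A] straddling_all ab by auto
    then consider "I = {}" | i where "I = {i}" using finite_I
      by (auto simp: less_2_cases_iff card_1_singleton_iff)
    then show ?thesis
    proof cases
      case 1
      then show ?thesis using ab by (intro exI[of _ "{a}"] exI[of _ "{b}"]) (auto simp: split_by_def)
    next
      case 2
      show ?thesis
      proof (cases "P i = {a}")
        case True
        then show ?thesis using ab 2 sides[of i]
          by (intro exI[of _ "{a}"] exI[of _ "{b}"]) (auto simp: split_by_def)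
      next
        case False
        then show ?thesis using ab 2 sides[of i]
          by (intro exI[of _ "{b}"] exI[of _ "{a}"]) (auto simp: split_by_def)
      qed
    qed
  next
    case False
    then have three: "card A \<ge> 3" using less.prems by simp
    have "\<exists>z b I'. z \<in> A \<and> b \<in> A \<and> z \<noteq> b \<and> I' \<subseteq> I \<and> (\<forall>i\<in>I - I'. P i \<union> N i \<subseteq> {z, b}) \<and>
        (\<forall>C. C \<subseteq> A \<longrightarrow> z \<in> C \<longrightarrow> b \<in> C \<longrightarrow> card (straddling I' P N C) + 1 < card C)"
    proof (cases "\<exists>z\<in>A. \<forall>i\<in>I. P i \<noteq> {z} \<and> N i \<noteq> {z}")
      case True
      then obtain z where z: "z \<in> A" "\<And>i. i \<in> I \<Longrightarrow> P i \<noteq> {z} \<and> N i \<noteq> {z}" by blast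
      obtain b where b: "b \<in> A" "b \<noteq> z"
        "\<And>C. C \<subseteq> A \<Longrightarrow> z \<in> C \<Longrightarrow> b \<in> C \<Longrightarrow> card (straddling I P N C) + 1 < card C"
        using exists_unconnected[OF z(1) less.prems(2) z(2)] by metis
      show ?thesis using z(1) b(1) b(2)[symmetric] b(3) by (intro exI[of _ z] exI[of _ b] exI[of _ I]) simp
    next
      case False
      then have "\<forall>z\<in>A. \<exists>i\<in>I. P i = {z} \<or> N i = {z}" by blast
      then obtain f where f: "\<And>z. z \<in> A \<Longrightarrow> f z \<in> I \<and> (P (f z) = {z} \<or> N (f z) = {z})" by metis
      have "A \<noteq> {}" using three by auto
      then have "card I < card A" using dom[of A] straddling_all by auto
      moreover have "f ` A \<subseteq> I" using f by auto
      ultimately have "\<not> inj_on f A" using card_inj_on_le[of f A I] finite_I by auto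
      then obtain z b where zb: "z \<in> A" "b \<in> A" "z \<noteq> b" "f z = f b" by (auto simp: inj_on_def)
      define i where "i = f z"
      have i: "i \<in> I" "P i = {z} \<and> N i = {b} \<or> P i = {b} \<and> N i = {z}"
        using f[OF zb(1)] f[OF zb(2)] zb by (auto simp: i_def)
      have un: "card (straddling (I - {i}) P N C) + 1 < card C" if "C \<subseteq> A" "z \<in> C" "b \<in> C" for C
      proof -
        \<comment> \<open>Row \<open>i\<close> straddles every set through \<open>z\<close> and
          \<open>b\<close>, so removing it creates the slack that \<open>merge\<close>
          demands.\<close>
        have "i \<in> straddling I P N C" using i that by (auto simp: straddling_def)
        moreover have "straddling (I - {i}) P N C = straddling I P N C - {i}" by (auto simp: straddling_def)
        ultimately have "card (straddling (I - {i}) P N C) + 1 = card (straddling I P N C)"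
          by (metis Suc_eq_plus1 card_Suc_Diff1 finite_straddling)
        then show ?thesis using dom[of C] that by auto
      qed
      have "P i \<union> N i \<subseteq> {z, b}" using i(2) by auto
      then show ?thesis using zb(1-3) i(1) un
        by (intro exI[of _ z] exI[of _ b] exI[of _ "I - {i}"]) (simp add: double_diff)
    qed
    then obtain z b I' where zb: "z \<in> A" "b \<in> A" "z \<noteq> b" and I': "I' \<subseteq> I"
      and rest: "\<forall>i\<in>I - I'. P i \<union> N i \<subseteq> {z, b}"
      and un: "\<And>C. C \<subseteq> A \<Longrightarrow> z \<in> C \<Longrightarrow> b \<in> C \<Longrightarrow> card (straddling I' P N C) + 1 < card C" by blast
    define q where "q x = (if x = b then z else x)" for x
    have "dominating (A - {b}) I' (\<lambda>i. q ` P i) (\<lambda>i. q ` N i)"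
      using merge[OF zb I' un] unfolding q_def .
    moreover have "card (A - {b}) < card A" "card (A - {b}) \<ge> 2"
      using three zb(2) finite_A by (simp_all add: card_Diff_singleton)
    ultimately obtain B1 B2 where B: "B1 \<noteq> {}" "B2 \<noteq> {}" "B1 \<inter> B2 = {}" "B1 \<union> B2 = A - {b}"
      "split_by I' (\<lambda>i. q ` P i) (\<lambda>i. q ` N i) B1 B2"
      using less.hyps[of "A - {b}" I' "\<lambda>i. q ` P i" "\<lambda>i. q ` N i"] by metis
    define A1 where "A1 = {x\<in>A. q x \<in> B1}"
    define A2 where "A2 = {x\<in>A. q x \<in> B2}"
    have qA: "q x \<in> B1 \<union> B2" if "x \<in> A" for x unfolding B(4) using that zb by (auto simp: q_def)
    have lift: "X \<subseteq> A1 \<longleftrightarrow> q ` X \<subseteq> B1" "X \<subseteq> A2 \<longleftrightarrow> q ` X \<subseteq> B2" if "X \<subseteq> A" for X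
      using that by (auto simp: A1_def A2_def)
    have PNI: "P i \<subseteq> A" "N i \<subseteq> A" if "i \<in> I" for i using that P_sub N_sub by auto
    have inI': "P i \<union> N i \<subseteq> A1 \<or> P i \<union> N i \<subseteq> A2 \<longleftrightarrow>
        q ` P i \<union> q ` N i \<subseteq> B1 \<or> q ` P i \<union> q ` N i \<subseteq> B2" if "i \<in> I" for i
      using lift[of "P i \<union> N i"] PNI[OF that] by (simp add: image_Un)
    \<comment> \<open>\<open>z\<close> and \<open>b\<close> have the same image under
      \<open>q\<close>, so a row set aside, living on \<open>{z, b}\<close>, lies within one
      part.\<close>
    have other: "P i \<union> N i \<subseteq> A1 \<or> P i \<union> N i \<subseteq> A2" if "i \<in> I - I'" for i
    proof -
      have "q z = z" "q b = z" using zb by (auto simp: q_def)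
      then have "{z, b} \<subseteq> A1 \<or> {z, b} \<subseteq> A2" using qA[OF zb(1)] zb by (auto simp: A1_def A2_def)
      then show ?thesis using rest that by blast
    qed
    have "split_by I P N A1 A2"
      using B(5) unfolding split_by_def
    proof (elim disjE bexE conjE)
      assume "\<forall>i\<in>I'. q ` P i \<union> q ` N i \<subseteq> B1 \<or> q ` P i \<union> q ` N i \<subseteq> B2"
      then have "P i \<union> N i \<subseteq> A1 \<or> P i \<union> N i \<subseteq> A2" if "i \<in> I" for i
        using inI'[OF that] other[of i] that by (cases "i \<in> I'") simp_all
      then have "\<forall>i\<in>I. P i \<union> N i \<subseteq> A1 \<or> P i \<union> N i \<subseteq> A2" by simp
      then show "(\<forall>i\<in>I. P i \<union> N i \<subseteq> A1 \<or> P i \<union> N i \<subseteq> A2) \<or>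
        (\<exists>i0\<in>I. P i0 \<subseteq> A1 \<and> N i0 \<subseteq> A2 \<and> (\<forall>i\<in>I - {i0}. P i \<union> N i \<subseteq> A1 \<or> P i \<union> N i \<subseteq> A2))" ..
    next
      fix i0 assume i0: "i0 \<in> I'" "q ` P i0 \<subseteq> B1" "q ` N i0 \<subseteq> B2"
        "\<forall>i\<in>I' - {i0}. q ` P i \<union> q ` N i \<subseteq> B1 \<or> q ` P i \<union> q ` N i \<subseteq> B2"
      have "i0 \<in> I" using i0 I' by blast
      then have "P i0 \<subseteq> A1" "N i0 \<subseteq> A2" using lift(1)[of "P i0"] lift(2)[of "N i0"] PNI[of i0] i0(2,3) by simp_all
      moreover have "P i \<union> N i \<subseteq> A1 \<or> P i \<union> N i \<subseteq> A2" if "i \<in> I - {i0}" for i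
        using inI'[of i] other[of i] i0(4) that by (cases "i \<in> I'") simp_all
      ultimately show "(\<forall>i\<in>I. P i \<union> N i \<subseteq> A1 \<or> P i \<union> N i \<subseteq> A2) \<or>
        (\<exists>i0\<in>I. P i0 \<subseteq> A1 \<and> N i0 \<subseteq> A2 \<and> (\<forall>i\<in>I - {i0}. P i \<union> N i \<subseteq> A1 \<or> P i \<union> N i \<subseteq> A2))"
        using i0(1) I' by blast
    qed
    moreover have "A1 \<union> A2 = A" using qA by (auto simp: A1_def A2_def)
    moreover have "A1 \<inter> A2 = {}" using B(3) by (auto simp: A1_def A2_def)
    moreover have "B1 \<subseteq> A1" "B2 \<subseteq> A2" using B(4) by (auto simp: A1_def A2_def q_def)
    moreover have "A1 \<noteq> {}" "A2 \<noteq> {}" using calculation(4,5) B(1,2) by auto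
    ultimately show ?thesis by (intro exI[of _ A1] exI[of _ A2]) simp
  qed
qed

lemma dominating_restrict:
  assumes "dominating A I P N" "A1 \<subseteq> A"
  shows "dominating A1 {i\<in>I. P i \<union> N i \<subseteq> A1} P N"
proof -
  interpret dominating A I P N by fact
  show ?thesis
  proof
    fix C assume C: "C \<subseteq> A1" "C \<noteq> {}"
    have "card (straddling {i\<in>I. P i \<union> N i \<subseteq> A1} P N C) \<le> card (straddling I P N C)"
      by (intro card_mono) (auto simp: straddling_def[of "{i\<in>I. P i \<union> N i \<subseteq> A1}"], auto simp: straddling_def)
    moreover have "C \<subseteq> A" using C assms(2) by blast
    ultimately show "card (straddling {i\<in>I. P i \<union> N i \<subseteq> A1} P N C) < card C"
      using dom[of C] C(2) by linarith
  qed (use finite_subset[OF assms(2) finite_A] finite_I P_ne N_ne in auto)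
qed

section \<open>Linear systems and alternatives\<close>

text \<open>Gaussian elimination with pivot \<open>s0\<close>. The index sets are arbitrary because
  the equations will be indexed by monomials, by ideal generators and by a disjoint sum.\<close>

lemma homogeneous_system:
  fixes a :: "'s \<Rightarrow> 't \<Rightarrow> 'k::field"
  assumes "finite T" "finite S" "card T < card S"
  shows "\<exists>c. (\<exists>s\<in>S. c s \<noteq> 0) \<and> (\<forall>t\<in>T. (\<Sum>s\<in>S. c s * a s t) = 0)"
  using assms
proof (induction T arbitrary: S a)
  case empty
  then obtain s where "s \<in> S" by fastforce
  then show ?case by (intro exI[of _ "\<lambda>_. 1"]) auto
next
  case (insert t T)
  show ?case
  proof (cases "\<forall>s\<in>S. a s t = 0")
    case True
    obtain c where "\<exists>s\<in>S. c s \<noteq> 0" "\<forall>t\<in>T. (\<Sum>s\<in>S. c s * a s t) = 0"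
      using insert.IH[of S a] insert.prems insert.hyps by auto
    then show ?thesis using True by (intro exI[of _ c]) auto
  next
    case False
    then obtain s0 where s0: "s0 \<in> S" "a s0 t \<noteq> 0" by blast
    define S' where "S' = S - {s0}"
    have S: "S = insert s0 S'" "s0 \<notin> S'" "finite S'" using s0 insert.prems by (auto simp: S'_def)
    define a' where "a' s u = a s u - a s t / a s0 t * a s0 u" for s u
    obtain c where c: "\<exists>s\<in>S'. c s \<noteq> 0" "\<forall>u\<in>T. (\<Sum>s\<in>S'. c s * a' s u) = 0"
      using insert.IH[of S' a'] insert.prems insert.hyps S by auto
    define d where "d = - (\<Sum>s\<in>S'. c s * a s t) / a s0 t"
    let ?c = "c(s0 := d)"
    have eq: "(\<Sum>s\<in>S. ?c s * a s u) = d * a s0 u + (\<Sum>s\<in>S'. c s * a s u)" for u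
    proof -
      have "(\<Sum>s\<in>S'. ?c s * a s u) = (\<Sum>s\<in>S'. c s * a s u)" using S by (intro sum.cong) auto
      then show ?thesis using S by simp
    qed
    have "(\<Sum>s\<in>S. ?c s * a s u) = 0" if "u \<in> insert t T" for u
    proof (cases "u = t")
      case True
      show ?thesis unfolding eq using True s0 by (simp add: d_def)
    next
      case False
      then have "0 = (\<Sum>s\<in>S'. c s * a' s u)" using c that by auto
      also have "\<dots> = (\<Sum>s\<in>S'. c s * a s u) - (\<Sum>s\<in>S'. c s * a s t) / a s0 t * a s0 u"
        by (simp add: a'_def right_diff_distrib sum_subtractf sum_distrib_right sum_divide_distrib mult.assoc)
      finally show ?thesis unfolding eq by (simp add: d_def)
    qed
    moreover have "\<exists>s\<in>S. ?c s \<noteq> 0" using c(1) S by auto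
    ultimately show ?thesis by (intro exI[of _ ?c]) blast
  qed
qed

lemma qdot_simps:
  "qdot c (x + y) = qdot c x + qdot c y" "qdot c (t *s x) = t * qdot c x" "qdot c (- x) = - qdot c x"
  "qdot c (x - y) = qdot c x - qdot c y" "qdot c 0 = 0"
  "qdot (c + d) x = qdot c x + qdot d x" "qdot (t *s c) x = t * qdot c x" "qdot (c - d) x = qdot c x - qdot d x"
  by (auto simp: qdot_def sum.distrib sum_distrib_left algebra_simps sum_subtractf sum_negf)

lemma qdot_sum: "qdot c (\<Sum>i\<in>I. f i) = (\<Sum>i\<in>I. qdot c (f i))"
  by (induction I rule: infinite_finite_induct) (auto simp: qdot_simps)

lemma qdot_self_pos: "x \<noteq> 0 \<Longrightarrow> qdot x x > 0"
proof -
  assume "x \<noteq> 0"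
  then obtain i where "x $ i \<noteq> 0" by (auto simp: vec_eq_iff)
  then show ?thesis unfolding qdot_def
    by (intro sum_pos2[of _ i]) (auto simp: zero_less_mult_iff)
qed

lemma small_perturbation:
  fixes u v :: "'i \<Rightarrow> rat"
  assumes "finite I" "\<And>i. i \<in> I \<Longrightarrow> u i > 0"
  obtains e where "e > 0" "\<And>i. i \<in> I \<Longrightarrow> u i + e * v i > 0"
proof -
  \<comment> \<open>Strengthened to all smaller \<open>d\<close>, so that the minimum of two
    thresholds works in the induction.\<close>
  have "\<exists>e>0. \<forall>d. 0 < d \<and> d \<le> e \<longrightarrow> (\<forall>i\<in>I. u i + d * v i > 0)" using assms
  proof (induction I)
    case empty
    then show ?case by (auto intro: exI[of _ 1])
  next
    case (insert i I)
    then obtain e where e: "e > 0" "\<forall>d. 0 < d \<and> d \<le> e \<longrightarrow> (\<forall>i\<in>I. u i + d * v i > 0)" by auto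
    define e' where "e' = u i / (\<bar>v i\<bar> + 1)"
    have ui: "u i > 0" using insert.prems by simp
    then have "e' > 0" by (simp add: e'_def)
    moreover have "u i + d * v i > 0" if "0 < d" "d \<le> e'" for d
    proof -
      have "d * (\<bar>v i\<bar> + 1) \<le> u i" using that(2) by (simp add: e'_def pos_le_divide_eq)
      moreover have "- (d * \<bar>v i\<bar>) \<le> d * v i" using that(1) by (simp add: abs_if)
      ultimately show ?thesis using that(1) by (simp add: algebra_simps)
    qed
    ultimately show ?case using e by (intro exI[of _ "min e e'"]) auto
  qed
  then obtain e where e: "e > 0" "\<forall>d. 0 < d \<and> d \<le> e \<longrightarrow> (\<forall>i\<in>I. u i + d * v i > 0)" by blast
  show thesis by (rule that[of e]) (use e in auto)
qed

text \<open>Gordan's theorem, by induction on the number of vectors. If the functional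
  \<open>c\<close> found for the others is negative at \<open>f t\<close>, the others are projected
  along \<open>f t\<close> into the hyperplane where \<open>c\<close> vanishes; either alternative
  there lifts back.\<close>

lemma gordan:
  fixes f :: "'i \<Rightarrow> rat ^ 'n"
  assumes "finite I"
  shows "(\<exists>c. \<forall>i\<in>I. qdot c (f i) > 0) \<or>
    (\<exists>l. (\<forall>i\<in>I. l i \<ge> 0) \<and> (\<exists>i\<in>I. l i > 0) \<and> (\<Sum>i\<in>I. l i *s f i) = 0)"
  using assms
proof (induction I arbitrary: f)
  case (insert t I)
  consider c where "\<forall>i\<in>I. qdot c (f i) > 0"
    | l where "\<forall>i\<in>I. l i \<ge> 0" "\<exists>i\<in>I. l i > 0" "(\<Sum>i\<in>I. l i *s f i) = 0" using insert.IH[of f] by blast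
  then show ?case
  proof cases
    case 2
    have "(\<Sum>i\<in>I. (l(t := 0)) i *s f i) = (\<Sum>i\<in>I. l i *s f i)"
      using insert.hyps by (intro sum.cong) auto
    then have "(\<Sum>i\<in>insert t I. (l(t := 0)) i *s f i) = 0" using insert.hyps 2(3) by simp
    then show ?thesis using 2 insert.hyps by (intro disjI2 exI[of _ "l(t := 0)"]) auto
  next
    case (1 c)
    consider "qdot c (f t) > 0" | "qdot c (f t) = 0" | "qdot c (f t) < 0" by linarith
    then show ?thesis
    proof cases
      case 2
      show ?thesis
      proof (cases "f t = 0")
        case True
        then have "(\<Sum>i\<in>insert t I. (if i = t then 1 else 0) *s f i) = 0" using insert.hyps
          by (auto intro: sum.neutral)
        then show ?thesis by (intro disjI2 exI[of _ "\<lambda>i. if i = t then 1 else 0"] conjI) simp_all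
      next
        case False
        \<comment> \<open>\<open>c\<close> vanishes at \<open>f t\<close>; tilting it slightly
          towards \<open>f t\<close> makes it positive there and keeps it positive at the
          others.\<close>
        obtain e where e: "e > 0" "\<And>i. i \<in> I \<Longrightarrow> qdot c (f i) + e * qdot (f t) (f i) > 0"
          by (rule small_perturbation[OF insert.hyps(1), of "\<lambda>i. qdot c (f i)" "\<lambda>i. qdot (f t) (f i)"])
             (use 1 in auto)
        then show ?thesis using 2 qdot_self_pos[OF False]
          by (intro disjI1 exI[of _ "c + e *s f t"]) (auto simp: qdot_simps)
      qed
    next
      case 3
      let ?r = "\<lambda>i. qdot c (f i) / qdot c (f t)"
      define g where "g i = f i - ?r i *s f t" for i
      consider d where "\<forall>i\<in>I. qdot d (g i) > 0"
        | l where "\<forall>i\<in>I. l i \<ge> 0" "\<exists>i\<in>I. l i > 0" "(\<Sum>i\<in>I. l i *s g i) = 0" using insert.IH[of g] by blast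
      then show ?thesis
      proof cases
        case (1 d)
        obtain e where e: "e > 0" "\<And>i. i \<in> I \<Longrightarrow> qdot d (g i) + e * ?r i > 0"
          by (rule small_perturbation[OF insert.hyps(1), of "\<lambda>i. qdot d (g i)" ?r]) (use 1 in auto)
        \<comment> \<open>Solved from the requirement that \<open>d + b *s c\<close> take the value
          \<open>e\<close> at \<open>f t\<close>.\<close>
        define b where "b = (e - qdot d (f t)) / qdot c (f t)"
        have "qdot (d + b *s c) (f t) = e" using 3 by (simp add: qdot_simps b_def)
        moreover have "qdot (d + b *s c) (f i) = qdot d (g i) + e * ?r i" for i
          by (simp add: qdot_simps b_def g_def left_diff_distrib diff_divide_distrib mult.commute)
        ultimately show ?thesis using e by (intro disjI1 exI[of _ "d + b *s c"]) auto
      next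
        case (2 l)
        define m where "m = - (\<Sum>i\<in>I. l i * ?r i)"
        have r: "?r i < 0" if "i \<in> I" for i using 3 \<open>\<forall>i\<in>I. qdot c (f i) > 0\<close> that by (simp add: divide_less_0_iff)
        have "(\<Sum>i\<in>I. l i * ?r i) \<le> 0" using 2(1) r
          by (intro sum_nonpos mult_nonneg_nonpos) (auto simp: less_imp_le)
        then have "m \<ge> 0" by (simp add: m_def)
        have "(\<Sum>i\<in>I. l i *s g i) = (\<Sum>i\<in>I. l i *s f i) - (\<Sum>i\<in>I. (l i * ?r i) *s f t)"
          by (simp add: g_def vec.scale_right_diff_distrib sum_subtractf)
        also have "(\<Sum>i\<in>I. (l i * ?r i) *s f t) = (- m) *s f t"
          by (simp add: m_def vec.scale_sum_left)
        finally have "(\<Sum>i\<in>I. l i *s f i) + m *s f t = 0" using 2(3) by simp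
        moreover have "(\<Sum>i\<in>I. (l(t := m)) i *s f i) = (\<Sum>i\<in>I. l i *s f i)"
          using insert.hyps by (intro sum.cong) auto
        ultimately have "(\<Sum>i\<in>insert t I. (l(t := m)) i *s f i) = 0" using insert.hyps by (simp add: add.commute)
        then show ?thesis using 2 insert.hyps \<open>m \<ge> 0\<close> by (intro disjI2 exI[of _ "l(t := m)"]) auto
      qed
    qed (use 1 in \<open>intro disjI1 exI[of _ c], simp\<close>)
  qed
qed auto

text \<open>Gordan's theorem in the quotient by the line of \<open>v\<close>, modelled by the
  orthogonal projection \<open>g\<close>. The hypothesis says that no nontrivial nonnegative
  combination lies on this line, multiples of either sign included.\<close>

lemma gordan_modulo:
  fixes S :: "(rat ^ 'n) set"
  assumes "finite S" "v \<noteq> 0"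
    and "\<And>l t. (\<And>s. s \<in> S \<Longrightarrow> l s \<ge> 0) \<Longrightarrow> (\<Sum>s\<in>S. l s *s s) = t *s v \<Longrightarrow> \<forall>s\<in>S. l s = 0"
  obtains c where "qdot c v = 0" "\<And>s. s \<in> S \<Longrightarrow> qdot c s > 0"
proof -
  let ?k = "\<lambda>x. qdot v x / qdot v v"
  have vv: "qdot v v > 0" using assms(2) by (rule qdot_self_pos)
  define g where "g x = x - ?k x *s v" for x
  have no: "\<not> (\<exists>l. (\<forall>s\<in>S. l s \<ge> 0) \<and> (\<exists>s\<in>S. l s > 0) \<and> (\<Sum>s\<in>S. l s *s g s) = 0)"
  proof
    assume "\<exists>l. (\<forall>s\<in>S. l s \<ge> 0) \<and> (\<exists>s\<in>S. l s > 0) \<and> (\<Sum>s\<in>S. l s *s g s) = 0"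
    then obtain l where l: "\<forall>s\<in>S. l s \<ge> 0" "\<exists>s\<in>S. l s > 0" "(\<Sum>s\<in>S. l s *s g s) = 0" by blast
    have "(\<Sum>s\<in>S. l s *s g s) = (\<Sum>s\<in>S. l s *s s) - (\<Sum>s\<in>S. l s * ?k s) *s v"
      by (simp add: g_def vec.scale_right_diff_distrib sum_subtractf vec.scale_sum_left)
    then have "(\<Sum>s\<in>S. l s *s s) = (\<Sum>s\<in>S. l s * ?k s) *s v" using l(3) by simp
    then have "\<forall>s\<in>S. l s = 0" by (rule assms(3)[rotated]) (use l(1) in simp)
    then show False using l(2) by auto
  qed
  have "\<exists>d. \<forall>s\<in>S. qdot d (g s) > 0"
    by (rule disjE[OF gordan[OF assms(1), of g]]) (assumption, erule notE[OF no])
  then obtain d where d: "\<And>s. s \<in> S \<Longrightarrow> qdot d (g s) > 0" by auto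
  define c where "c = d - (qdot d v / qdot v v) *s v"
  have "qdot c x = qdot d (g x)" for x
    using vv by (simp add: c_def g_def qdot_simps)
  moreover have "g v = 0" using vv by (simp add: g_def)
  ultimately show thesis using that[of c] d by (simp add: qdot_simps)
qed

section \<open>Rational cones and their extreme rays\<close>

definition cone_closed :: "(rat ^ 'n) set \<Rightarrow> bool" where
  "cone_closed T \<longleftrightarrow> 0 \<in> T \<and> (\<forall>x\<in>T. \<forall>y\<in>T. x + y \<in> T) \<and> (\<forall>x\<in>T. \<forall>c\<ge>0. c *s x \<in> T)"

lemma cone_closedD:
  assumes "cone_closed T"
  shows "0 \<in> T" "x \<in> T \<Longrightarrow> y \<in> T \<Longrightarrow> x + y \<in> T" "x \<in> T \<Longrightarrow> c \<ge> 0 \<Longrightarrow> c *s x \<in> T"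
  using assms by (auto simp: cone_closed_def)

lemma cone_closed_sum:
  assumes "cone_closed T" "\<And>i. i \<in> F \<Longrightarrow> f i \<in> T"
  shows "(\<Sum>i\<in>F. f i) \<in> T"
  using assms(2) by (induction F rule: infinite_finite_induct) (auto simp: cone_closedD[OF assms(1)])

lemma pos_cone_closed: "cone_closed (pos_cone S)"
proof -
  have "(\<Sum>v\<in>F. c v *s v) + (\<Sum>v\<in>G. d v *s v) \<in> pos_cone S"
    if F: "finite F" "F \<subseteq> S" "\<forall>v\<in>F. c v \<ge> 0" and G: "finite G" "G \<subseteq> S" "\<forall>v\<in>G. d v \<ge> 0" for F G c d
  proof -
    define e where "e v = (if v \<in> F then c v else 0) + (if v \<in> G then d v else 0)" for v
    have "(\<Sum>v\<in>F \<union> G. e v *s v) = (\<Sum>v\<in>F \<union> G. (if v \<in> F then c v else 0) *s v) +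
        (\<Sum>v\<in>F \<union> G. (if v \<in> G then d v else 0) *s v)"
      by (simp add: e_def vec.scale_left_distrib sum.distrib)
    also have "(\<Sum>v\<in>F \<union> G. (if v \<in> F then c v else 0) *s v) = (\<Sum>v\<in>F. c v *s v)"
      using F G by (intro sum.mono_neutral_cong_right) auto
    also have "(\<Sum>v\<in>F \<union> G. (if v \<in> G then d v else 0) *s v) = (\<Sum>v\<in>G. d v *s v)"
      using F G by (intro sum.mono_neutral_cong_right) auto
    finally have "(\<Sum>v\<in>F. c v *s v) + (\<Sum>v\<in>G. d v *s v) = (\<Sum>v\<in>F \<union> G. e v *s v)" by simp
    then show ?thesis unfolding pos_cone_def using F G
      by (intro CollectI exI[of _ "F \<union> G"] exI[of _ e]) (auto simp: e_def)
  qed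
  moreover have "c *s (\<Sum>v\<in>F. d v *s v) \<in> pos_cone S"
    if "finite F" "F \<subseteq> S" "\<forall>v\<in>F. d v \<ge> 0" "c \<ge> 0" for F c d
    unfolding pos_cone_def using that
    by (intro CollectI exI[of _ F] exI[of _ "\<lambda>v. c * d v"]) (auto simp: vec.scale_sum_right)
  moreover have "0 \<in> pos_cone S" unfolding pos_cone_def
    by (intro CollectI exI[of _ "{}"]) auto
  ultimately show ?thesis by (auto simp: cone_closed_def pos_cone_def[of S])
qed

lemmas pos_cone_0 = cone_closedD(1)[OF pos_cone_closed]
lemmas pos_cone_add = cone_closedD(2)[OF pos_cone_closed]
lemmas pos_cone_scale = cone_closedD(3)[OF pos_cone_closed]

lemma pos_cone_base: "S \<subseteq> pos_cone S"
proof
  fix x assume "x \<in> S"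
  then show "x \<in> pos_cone S" unfolding pos_cone_def
    by (intro CollectI exI[of _ "{x}"] exI[of _ "\<lambda>_. 1"]) auto
qed

lemma pos_cone_minimal: "cone_closed T \<Longrightarrow> S \<subseteq> T \<Longrightarrow> pos_cone S \<subseteq> T"
  by (auto simp: pos_cone_def intro!: cone_closed_sum cone_closedD(3))

lemma pos_cone_mono: "S \<subseteq> T \<Longrightarrow> pos_cone S \<subseteq> pos_cone T"
  using pos_cone_minimal[OF pos_cone_closed, of S T] pos_cone_base[of T] by blast

lemma pos_cone_finite:
  assumes "finite S" "x \<in> pos_cone S"
  obtains c where "x = (\<Sum>v\<in>S. c v *s v)" "\<And>v. c v \<ge> 0"
proof -
  obtain F c where F: "finite F" "F \<subseteq> S" "\<forall>v\<in>F. c v \<ge> 0" "x = (\<Sum>v\<in>F. c v *s v)"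
    using assms(2) by (auto simp: pos_cone_def)
  have "x = (\<Sum>v\<in>S. (if v \<in> F then c v else 0) *s v)"
    unfolding F(4) using F assms(1) by (intro sum.mono_neutral_cong_left) auto
  then show thesis by (rule that) (use F in auto)
qed

lemma cone_closed_plus:
  assumes "cone_closed S" "cone_closed T"
  shows "cone_closed {x + y | x y. x \<in> S \<and> y \<in> T}"
  unfolding cone_closed_def
proof (intro conjI ballI allI impI)
  show "0 \<in> {x + y | x y. x \<in> S \<and> y \<in> T}" using cone_closedD(1) assms by force
next
  fix a b assume "a \<in> {x + y | x y. x \<in> S \<and> y \<in> T}" "b \<in> {x + y | x y. x \<in> S \<and> y \<in> T}"
  then obtain x y x' y' where "a = x + y" "x \<in> S" "y \<in> T" "b = x' + y'" "x' \<in> S" "y' \<in> T" by blast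
  then show "a + b \<in> {x + y | x y. x \<in> S \<and> y \<in> T}" using cone_closedD(2) assms
    by (intro CollectI exI[of _ "x + x'"] exI[of _ "y + y'"]) (auto simp: algebra_simps)
next
  fix a c assume "a \<in> {x + y | x y. x \<in> S \<and> y \<in> T}" "(0::rat) \<le> c"
  then obtain x y where "a = x + y" "x \<in> S" "y \<in> T" by blast
  then show "c *s a \<in> {x + y | x y. x \<in> S \<and> y \<in> T}" using cone_closedD(3) assms \<open>0 \<le> c\<close>
    by (intro CollectI exI[of _ "c *s x"] exI[of _ "c *s y"]) (auto simp: vec.scale_right_distrib)
qed

lemma pos_cone_Un:
  "pos_cone (S \<union> T) = {x + y | x y. x \<in> pos_cone S \<and> y \<in> pos_cone T}" (is "_ = ?R")
proof
  have "S \<subseteq> ?R"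
  proof
    fix x assume "x \<in> S"
    then show "x \<in> ?R" using pos_cone_base[of S] pos_cone_0[of T]
      by (intro CollectI exI[of _ x] exI[of _ 0]) auto
  qed
  moreover have "T \<subseteq> ?R"
  proof
    fix x assume "x \<in> T"
    then show "x \<in> ?R" using pos_cone_base[of T] pos_cone_0[of S]
      by (intro CollectI exI[of _ 0] exI[of _ x]) auto
  qed
  ultimately show "pos_cone (S \<union> T) \<subseteq> ?R"
    by (intro pos_cone_minimal cone_closed_plus pos_cone_closed Un_least)
  show "?R \<subseteq> pos_cone (S \<union> T)"
    using pos_cone_mono[of S "S \<union> T"] pos_cone_mono[of T "S \<union> T"] pos_cone_add by blast
qed

lemma pos_cone_idem: "pos_cone (pos_cone S) = pos_cone S"
  using pos_cone_minimal[OF pos_cone_closed, of "pos_cone S" S] pos_cone_base by blast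

lemma pos_cone_Un_pos_cone: "pos_cone (pos_cone S \<union> pos_cone T) = pos_cone (S \<union> T)"
  by (simp add: pos_cone_Un pos_cone_idem)

lemma subspace_cone_closed: "vec.subspace V \<Longrightarrow> cone_closed V"
  by (auto simp: cone_closed_def vec.subspace_def)

lemma span_pos_cone: "vec.span (pos_cone S) = vec.span S"
proof -
  have "pos_cone S \<subseteq> vec.span S"
    by (intro pos_cone_minimal subspace_cone_closed vec.subspace_span vec.span_superset)
  then show ?thesis
    by (metis pos_cone_base subset_antisym vec.span_mono vec.span_span)
qed

lemma cone_dim_pos_cone: "cone_dim (pos_cone S) = vec.dim S"
  unfolding cone_dim_def by (metis span_pos_cone vec.dim_span)

lemma strongly_convexD: "strongly_convex \<sigma> \<Longrightarrow> x \<in> \<sigma> \<Longrightarrow> - x \<in> \<sigma> \<Longrightarrow> x = 0"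
  unfolding strongly_convex_def by (metis Int_iff image_eqI minus_minus singletonD)

lemma strongly_convex_iff:
  assumes "cone_closed \<sigma>"
  shows "strongly_convex \<sigma> \<longleftrightarrow> (\<forall>x. x \<in> \<sigma> \<longrightarrow> - x \<in> \<sigma> \<longrightarrow> x = 0)"
proof
  assume *: "\<forall>x. x \<in> \<sigma> \<longrightarrow> - x \<in> \<sigma> \<longrightarrow> x = 0"
  have "\<sigma> \<inter> uminus ` \<sigma> \<subseteq> {0}"
  proof
    fix x assume "x \<in> \<sigma> \<inter> uminus ` \<sigma>"
    then have "x \<in> \<sigma>" "- x \<in> \<sigma>" by auto
    then show "x \<in> {0}" using * by simp
  qed
  moreover have "0 \<in> uminus ` \<sigma>" using cone_closedD(1)[OF assms] by (metis imageI minus_zero)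
  ultimately show "strongly_convex \<sigma>" unfolding strongly_convex_def using cone_closedD(1)[OF assms] by blast
qed (use strongly_convexD in blast)

lemma strongly_convex_subset:
  assumes "strongly_convex \<sigma>" "cone_closed \<tau>" "\<tau> \<subseteq> \<sigma>"
  shows "strongly_convex \<tau>"
  unfolding strongly_convex_iff[OF assms(2)] using strongly_convexD[OF assms(1)] assms(3) by blast

lemma pointed_sum_zero:
  assumes sc: "strongly_convex \<sigma>" and cl: "cone_closed \<sigma>" and fin: "finite F"
    and f: "\<And>i. i \<in> F \<Longrightarrow> f i \<in> \<sigma>" and sum: "(\<Sum>i\<in>F. f i) = 0" and i: "i \<in> F"
  shows "f i = 0"
proof -
  have "f i + (\<Sum>j\<in>F - {i}. f j) = 0" using sum sum.remove[OF fin i, of f] by simp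
  then have "- f i = (\<Sum>j\<in>F - {i}. f j)" by (simp add: neg_eq_iff_add_eq_0)
  also have "\<dots> \<in> \<sigma>" using f by (intro cone_closed_sum[OF cl]) auto
  finally show ?thesis using strongly_convexD[OF sc] f[OF i] by blast
qed

lemma face_cone_closed:
  assumes "cone_closed \<sigma>"
  shows "cone_closed (\<sigma> \<inter> {x. qdot c x = 0})"
  using assms by (auto simp: cone_closed_def qdot_simps)

lemma half_line:
  assumes sc: "strongly_convex \<tau>" and cl: "cone_closed \<tau>" and dim: "cone_dim \<tau> = 1"
    and v: "v \<in> \<tau>" "v \<noteq> 0"
  shows "\<tau> = {t *s v | t. t \<ge> 0}"
proof
  show "{t *s v | t. t \<ge> 0} \<subseteq> \<tau>" using cone_closedD(3)[OF cl v(1)] by blast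
  show "\<tau> \<subseteq> {t *s v | t. t \<ge> 0}"
  proof
    fix x assume x: "x \<in> \<tau>"
    have "\<tau> \<subseteq> vec.span {v}"
      using v dim by (intro vec.card_ge_dim_independent) (auto simp: cone_dim_def)
    then obtain t where t: "x = t *s v" using x by (auto simp: vec.span_singleton)
    have "t \<ge> 0"
    proof (rule ccontr)
      assume "\<not> t \<ge> 0"
      then have "(- 1 / t) *s x \<in> \<tau>" using cone_closedD(3)[OF cl x, of "- 1 / t"] by (simp add: divide_nonneg_neg)
      moreover have "(- 1 / t) *s x = - v" using \<open>\<not> t \<ge> 0\<close> by (simp add: t)
      ultimately show False using strongly_convexD[OF sc v(1)] v(2) by simp
    qed
    then show "x \<in> {t *s v | t. t \<ge> 0}" using t by blast
  qed
qed

lemma cone_dim_half_line: "v \<noteq> 0 \<Longrightarrow> cone_dim {t *s v | t. t \<ge> 0} = 1"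
proof -
  assume v: "v \<noteq> 0"
  have "v \<in> {t *s v | t. t \<ge> 0}" by (intro CollectI exI[of _ 1]) simp
  then have "vec.dim {v} \<le> vec.dim {t *s v | t. t \<ge> 0}" by (intro vec.dim_subset) auto
  moreover have "vec.dim {t *s v | t. t \<ge> 0} \<le> card {v}"
    by (intro vec.dim_le_card) (auto simp: vec.span_singleton)
  ultimately show ?thesis using v by (simp add: cone_dim_def)
qed

lemma extreme_rayE:
  assumes "\<rho> \<in> extreme_rays \<sigma>" "strongly_convex \<sigma>" "cone_closed \<sigma>"
  obtains c where "\<rho> = \<sigma> \<inter> {x. qdot c x = 0}" "\<And>x. x \<in> \<sigma> \<Longrightarrow> qdot c x \<ge> 0" "cone_dim \<rho> = 1"
    "cone_closed \<rho>" "strongly_convex \<rho>" "\<And>v. v \<in> \<rho> \<Longrightarrow> v \<noteq> 0 \<Longrightarrow> \<rho> = {t *s v | t. t \<ge> 0}"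
proof -
  obtain c where c: "\<rho> = \<sigma> \<inter> {x. qdot c x = 0}" "\<forall>x\<in>\<sigma>. qdot c x \<ge> 0" "cone_dim \<rho> = 1"
    using assms(1) by (auto simp: extreme_rays_def faces_def)
  have cl: "cone_closed \<rho>" unfolding c(1) using face_cone_closed[OF assms(3)] .
  have sc: "strongly_convex \<rho>" using strongly_convex_subset[OF assms(2) cl] c(1) by blast
  show thesis by (rule that[of c]) (use c cl sc half_line[OF sc cl c(3)] in auto)
qed

lemma dim_1_nonzero: "cone_dim \<tau> = 1 \<Longrightarrow> \<exists>v\<in>\<tau>. v \<noteq> 0"
proof (rule ccontr)
  assume "cone_dim \<tau> = 1" "\<not> (\<exists>v\<in>\<tau>. v \<noteq> 0)"
  then have "\<tau> \<subseteq> {0}" by auto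
  then have "vec.dim \<tau> = 0" by simp
  then show False using \<open>cone_dim \<tau> = 1\<close> unfolding cone_dim_def by linarith
qed

lemma extreme_rayI:
  assumes "\<And>x. x \<in> \<sigma> \<Longrightarrow> qdot c x \<ge> 0" "\<rho> = \<sigma> \<inter> {x. qdot c x = 0}" "cone_dim \<rho> = 1"
  shows "\<rho> \<in> extreme_rays \<sigma>"
  using assms unfolding extreme_rays_def faces_def by auto

text \<open>A one-dimensional face is generated by any of its nonzero vectors, so a subcone
  containing one of them contains the face, and the old supporting functional still cuts it
  out.\<close>

lemma extreme_ray_subcone:
  assumes \<rho>: "\<rho> \<in> extreme_rays \<sigma>" and sc: "strongly_convex \<sigma>" and cl: "cone_closed \<sigma>"
    and sub: "\<tau> \<subseteq> \<sigma>" and cl': "cone_closed \<tau>" and v: "v \<in> \<rho>" "v \<in> \<tau>" "v \<noteq> 0"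
  shows "\<rho> \<in> extreme_rays \<tau>"
proof -
  obtain c where c: "\<rho> = \<sigma> \<inter> {x. qdot c x = 0}" "\<And>x. x \<in> \<sigma> \<Longrightarrow> qdot c x \<ge> 0" "cone_dim \<rho> = 1"
    "\<And>v. v \<in> \<rho> \<Longrightarrow> v \<noteq> 0 \<Longrightarrow> \<rho> = {t *s v | t. t \<ge> 0}"
    by (rule extreme_rayE[OF \<rho> sc cl]) (rule that)
  have "\<rho> \<subseteq> \<tau>" using c(4)[OF v(1,3)] cone_closedD(3)[OF cl' v(2)] by blast
  then have "\<rho> = \<tau> \<inter> {x. qdot c x = 0}" using c(1) sub by blast
  then show ?thesis using c(2,3) sub by (intro extreme_rayI[of \<tau> c]) auto
qed

text \<open>A nonzero vector of the ray is a sum of one vector from each cone. The supporting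
  functional is nonnegative on both, so both lie on the ray, and one of them is nonzero.\<close>

lemma extreme_rays_Un:
  assumes sc: "strongly_convex (pos_cone (S \<union> T))"
  shows "extreme_rays (pos_cone (S \<union> T)) \<subseteq> extreme_rays (pos_cone S) \<union> extreme_rays (pos_cone T)"
proof
  fix \<rho> assume \<rho>: "\<rho> \<in> extreme_rays (pos_cone (S \<union> T))"
  obtain c where c: "\<rho> = pos_cone (S \<union> T) \<inter> {x. qdot c x = 0}"
    "\<And>x. x \<in> pos_cone (S \<union> T) \<Longrightarrow> qdot c x \<ge> 0" "cone_dim \<rho> = 1"
    by (rule extreme_rayE[OF \<rho> sc pos_cone_closed]) (rule that)
  obtain v where v: "v \<in> \<rho>" "v \<noteq> 0" using dim_1_nonzero[OF c(3)] by blast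
  then obtain x y where xy: "v = x + y" "x \<in> pos_cone S" "y \<in> pos_cone T"
    unfolding c(1) pos_cone_Un by blast
  have sub: "pos_cone S \<subseteq> pos_cone (S \<union> T)" "pos_cone T \<subseteq> pos_cone (S \<union> T)" by (auto intro!: pos_cone_mono)
  have "qdot c x \<ge> 0" "qdot c y \<ge> 0" using xy sub c(2) by auto
  moreover have "qdot c x + qdot c y = 0" using v(1) by (simp add: c(1) xy(1) qdot_simps)
  ultimately have "x \<in> \<rho>" "y \<in> \<rho>" unfolding c(1) using xy sub by auto
  moreover have "x \<noteq> 0 \<or> y \<noteq> 0" using v xy by auto
  ultimately show "\<rho> \<in> extreme_rays (pos_cone S) \<union> extreme_rays (pos_cone T)"
    using extreme_ray_subcone[OF \<rho> sc pos_cone_closed sub(1) pos_cone_closed, of x]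
      extreme_ray_subcone[OF \<rho> sc pos_cone_closed sub(2) pos_cone_closed, of y] xy by blast
qed

lemma pos_cone_singleton: "pos_cone {v} = {t *s v | t. t \<ge> 0}"
proof
  have "cone_closed {t *s v | t. t \<ge> 0}"
    unfolding cone_closed_def
  proof (intro conjI ballI allI impI)
    show "0 \<in> {t *s v | t. t \<ge> 0}" by (intro CollectI exI[of _ 0]) simp
  next
    fix x y assume "x \<in> {t *s v | t. t \<ge> 0}" "y \<in> {t *s v | t. t \<ge> 0}"
    then obtain s t where "x = s *s v" "y = t *s v" "s \<ge> 0" "t \<ge> 0" by blast
    then show "x + y \<in> {t *s v | t. t \<ge> 0}"
      by (intro CollectI exI[of _ "s + t"]) (simp add: vec.scale_left_distrib)
  next
    fix x c assume "x \<in> {t *s v | t. t \<ge> 0}" "(0::rat) \<le> c"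
    then obtain s where "x = s *s v" "s \<ge> 0" by blast
    then show "c *s x \<in> {t *s v | t. t \<ge> 0}" using \<open>0 \<le> c\<close>
      by (intro CollectI exI[of _ "c * s"]) simp
  qed
  then show "pos_cone {v} \<subseteq> {t *s v | t. t \<ge> 0}"
    by (rule pos_cone_minimal) (auto intro: exI[of _ 1])
  show "{t *s v | t. t \<ge> 0} \<subseteq> pos_cone {v}"
    using pos_cone_base[of "{v}"] pos_cone_scale by blast
qed

lemma extreme_rays_finite:
  assumes "finite S" "strongly_convex (pos_cone S)"
  shows "finite (extreme_rays (pos_cone S))"
proof -
  have "extreme_rays (pos_cone S) \<subseteq> (\<lambda>s. pos_cone {s}) ` S"
  proof
    fix \<rho> assume \<rho>: "\<rho> \<in> extreme_rays (pos_cone S)"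
    obtain c where c: "\<rho> = pos_cone S \<inter> {x. qdot c x = 0}"
      "\<And>x. x \<in> pos_cone S \<Longrightarrow> qdot c x \<ge> 0" "cone_dim \<rho> = 1"
      "\<And>v. v \<in> \<rho> \<Longrightarrow> v \<noteq> 0 \<Longrightarrow> \<rho> = {t *s v | t. t \<ge> 0}"
      by (rule extreme_rayE[OF \<rho> assms(2) pos_cone_closed]) (rule that)
    obtain v where v: "v \<in> \<rho>" "v \<noteq> 0" using dim_1_nonzero[OF c(3)] by blast
    obtain l where l: "v = (\<Sum>s\<in>S. l s *s s)" "\<And>s. l s \<ge> 0"
      using pos_cone_finite[OF assms(1), of v] v c(1) by blast
    obtain s where s: "s \<in> S" "l s *s s \<noteq> 0"
      using v(2) unfolding l(1) by (rule sum.not_neutral_contains_not_neutral)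
    have "(\<Sum>s\<in>S. l s * qdot c s) = 0" using v(1) by (simp add: c(1) l(1) qdot_sum qdot_simps)
    moreover have "l s * qdot c s \<ge> 0" if "s \<in> S" for s using l(2)[of s] c(2)[of s] pos_cone_base[of S] that by (intro mult_nonneg_nonneg) auto
    ultimately have "l s * qdot c s = 0" using sum_nonneg_eq_0_iff[OF assms(1), of "\<lambda>s. l s * qdot c s"] s(1) by blast
    then have "qdot c s = 0" using s by auto
    then have "s \<in> \<rho>" using c(1) s pos_cone_base by auto
    then have "\<rho> = pos_cone {s}" using c(4)[of s] s by (auto simp: pos_cone_singleton)
    then show "\<rho> \<in> (\<lambda>s. pos_cone {s}) ` S" using s by blast
  qed
  then show ?thesis using finite_subset assms(1) by blast
qed

lemma extreme_rays_dim_1: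
  assumes "strongly_convex \<sigma>" "cone_closed \<sigma>" "cone_dim \<sigma> = 1"
  shows "extreme_rays \<sigma> \<subseteq> {\<sigma>}"
proof
  fix \<rho> assume \<rho>: "\<rho> \<in> extreme_rays \<sigma>"
  obtain c where c: "\<rho> = \<sigma> \<inter> {x. qdot c x = 0}" "cone_dim \<rho> = 1"
      "\<And>v. v \<in> \<rho> \<Longrightarrow> v \<noteq> 0 \<Longrightarrow> \<rho> = {t *s v | t. t \<ge> 0}"
    by (rule extreme_rayE[OF \<rho> assms(1,2)]) (rule that)
  obtain v where v: "v \<in> \<rho>" "v \<noteq> 0" using dim_1_nonzero[OF c(2)] by blast
  then have "\<sigma> = {t *s v | t. t \<ge> 0}" using half_line[OF assms, of v] c(1) by blast
  then show "\<rho> \<in> {\<sigma>}" using c(3)[OF v] by simp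
qed

lemma pos_cone_zero_functional:
  assumes S: "finite S" "\<And>s. s \<in> S \<Longrightarrow> qdot c s > 0" and x: "x \<in> pos_cone S" "qdot c x \<le> 0"
  shows "x = 0"
proof -
  obtain l where l: "x = (\<Sum>s\<in>S. l s *s s)" "\<And>s. l s \<ge> 0" using pos_cone_finite[OF S(1) x(1)] by blast
  have "(\<Sum>s\<in>S. l s * qdot c s) \<le> 0" using x(2) by (simp add: l(1) qdot_sum qdot_simps)
  moreover have nn: "l s * qdot c s \<ge> 0" if "s \<in> S" for s using l(2) S(2)[OF that] by simp
  ultimately have "(\<Sum>s\<in>S. l s * qdot c s) = 0" by (meson order_antisym sum_nonneg)
  then have "l s = 0" if "s \<in> S" for s
    using sum_nonneg_eq_0_iff[OF S(1), of "\<lambda>s. l s * qdot c s"] nn that S(2)[OF that] by force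
  then show ?thesis unfolding l(1) by (intro sum.neutral) simp
qed

lemma strongly_convex_pos_cone:
  assumes "finite S" "\<And>s. s \<in> S \<Longrightarrow> qdot c s > 0"
  shows "strongly_convex (pos_cone S)"
  unfolding strongly_convex_iff[OF pos_cone_closed]
proof (intro allI impI)
  fix x assume x: "x \<in> pos_cone S" "- x \<in> pos_cone S"
  show "x = 0"
  proof (cases "qdot c x \<le> 0")
    case True
    then show ?thesis using pos_cone_zero_functional[OF assms x(1)] by blast
  next
    case False
    then show ?thesis using pos_cone_zero_functional[OF assms x(2)] by (simp add: qdot_simps)
  qed
qed

lemma exposed_ray:
  assumes S: "finite S" "\<And>s. s \<in> S \<Longrightarrow> qdot c s > 0" and v: "v \<noteq> 0" "qdot c v = 0"
  shows "pos_cone {v} \<in> extreme_rays (pos_cone (insert v S))"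
proof (rule extreme_rayI[of _ c])
  have dec: "\<exists>t z. x = t *s v + z \<and> t \<ge> 0 \<and> z \<in> pos_cone S" if "x \<in> pos_cone (insert v S)" for x
    using that pos_cone_Un[of "{v}" S] by (auto simp: pos_cone_singleton)
  have pos: "qdot c z \<ge> 0" if "z \<in> pos_cone S" for z
    using pos_cone_zero_functional[OF S that] by (cases "qdot c z \<le> 0") (auto simp: qdot_simps)
  show "qdot c x \<ge> 0" if "x \<in> pos_cone (insert v S)" for x
    using dec[OF that] pos v(2) by (auto simp: qdot_simps)
  show "pos_cone {v} = pos_cone (insert v S) \<inter> {x. qdot c x = 0}"
  proof
    show "pos_cone {v} \<subseteq> pos_cone (insert v S) \<inter> {x. qdot c x = 0}"
      using pos_cone_mono[of "{v}" "insert v S"] v(2) by (auto simp: pos_cone_singleton qdot_simps)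
    show "pos_cone (insert v S) \<inter> {x. qdot c x = 0} \<subseteq> pos_cone {v}"
    proof
      fix x assume x: "x \<in> pos_cone (insert v S) \<inter> {x. qdot c x = 0}"
      then obtain t z where tz: "x = t *s v + z" "t \<ge> 0" "z \<in> pos_cone S" using dec by blast
      then have "qdot c z \<le> 0" using x v(2) by (simp add: qdot_simps)
      then have "z = 0" using pos_cone_zero_functional[OF S tz(3)] by blast
      then show "x \<in> pos_cone {v}" using tz by (auto simp: pos_cone_singleton)
    qed
  qed
  show "cone_dim (pos_cone {v}) = 1" using v(1) by (simp add: pos_cone_singleton cone_dim_half_line)
qed

lemma simplex_functional:
  assumes "vec.independent {r1, r2}" "r1 \<noteq> r2"
  obtains c where "qdot c r1 = 0" "qdot c r2 > 0"
proof -
  have r1: "r1 \<noteq> 0" using assms vec.dependent_zero by blast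
  have r2: "r2 \<notin> vec.span {r1}"
    using assms vec.independent_insert[of r2 "{r1}"] by (simp add: insert_commute)
  have no: "\<forall>s\<in>{r2}. l s = 0" if "(\<Sum>s\<in>{r2}. l s *s s) = t *s r1" for l t
  proof (rule ccontr)
    assume "\<not> (\<forall>s\<in>{r2}. l s = 0)"
    then have "r2 = (1 / l r2) *s (l r2 *s r2)" by simp
    also have "\<dots> = (t / l r2) *s r1" using that by simp
    also have "\<dots> \<in> vec.span {r1}" by (intro vec.span_scale vec.span_base) simp
    finally show False using r2 by simp
  qed
  obtain c where c: "qdot c r1 = 0" "\<And>s. s \<in> {r2} \<Longrightarrow> qdot c s > 0"
  proof (rule gordan_modulo[of "{r2}" r1])
    fix l t assume "(\<Sum>s\<in>{r2}. l s *s s) = t *s r1"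
    then show "\<forall>s\<in>{r2}. l s = 0" by (rule no)
  qed (use r1 in \<open>auto intro: that\<close>)
  show thesis by (rule that[of c]) (use c in auto)
qed

lemma simplex_cone:
  assumes ind: "vec.independent {r1, r2}" "r1 \<noteq> r2"
  defines "\<sigma> \<equiv> pos_cone {r1, r2}"
  shows "strongly_convex \<sigma>" "cone_dim \<sigma> = 2" "card (extreme_rays \<sigma>) = 2"
proof -
  obtain c1 where c1: "qdot c1 r1 = 0" "qdot c1 r2 > 0" by (rule simplex_functional[OF ind])
  have "vec.independent {r2, r1}" using ind(1) by (simp add: insert_commute)
  then obtain c2 where c2: "qdot c2 r2 = 0" "qdot c2 r1 > 0" by (rule simplex_functional) (use ind in auto)
  have "qdot (c1 + c2) s > 0" if "s \<in> {r1, r2}" for s using that c1 c2 by (auto simp: qdot_simps)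
  then show sc: "strongly_convex \<sigma>" unfolding \<sigma>_def by (intro strongly_convex_pos_cone) auto
  show "cone_dim \<sigma> = 2" unfolding \<sigma>_def cone_dim_pos_cone using vec.dim_eq_card_independent[OF ind(1)] ind(2) by simp
  have nz: "r1 \<noteq> 0" "r2 \<noteq> 0" using ind vec.dependent_zero by blast+
  have "pos_cone {r1} \<in> extreme_rays \<sigma>" unfolding \<sigma>_def using c1 nz by (intro exposed_ray[of _ c1]) auto
  moreover have "pos_cone {r2} \<in> extreme_rays \<sigma>" unfolding \<sigma>_def insert_commute[of r1]
    using c2 nz by (intro exposed_ray[of _ c2]) auto
  moreover have "extreme_rays \<sigma> \<subseteq> {pos_cone {r1}, pos_cone {r2}}"
  proof -
    have one: "extreme_rays (pos_cone {r}) \<subseteq> {pos_cone {r}}" if "r \<in> {r1, r2}" for r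
    proof (rule extreme_rays_dim_1[OF _ pos_cone_closed])
      show "strongly_convex (pos_cone {r})"
        by (rule strongly_convex_subset[OF sc pos_cone_closed]) (unfold \<sigma>_def, rule pos_cone_mono, use that in auto)
      show "cone_dim (pos_cone {r}) = 1" using nz that by (auto simp: pos_cone_singleton cone_dim_half_line)
    qed
    have "extreme_rays (pos_cone ({r1} \<union> {r2})) \<subseteq> extreme_rays (pos_cone {r1}) \<union> extreme_rays (pos_cone {r2})"
      by (rule extreme_rays_Un) (use sc in \<open>simp add: \<sigma>_def insert_commute\<close>)
    then show ?thesis using one[of r1] one[of r2] by (auto simp: \<sigma>_def insert_commute)
  qed
  moreover have "pos_cone {r1} \<noteq> pos_cone {r2}"
  proof
    assume "pos_cone {r1} = pos_cone {r2}"
    then have "r2 \<in> pos_cone {r1}" using pos_cone_base by blast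
    then show False using c1 by (auto simp: pos_cone_singleton qdot_simps)
  qed
  ultimately have "extreme_rays \<sigma> = {pos_cone {r1}, pos_cone {r2}}" by blast
  then show "card (extreme_rays \<sigma>) = 2" using \<open>pos_cone {r1} \<noteq> pos_cone {r2}\<close> by simp
qed

section \<open>Pointed cones whose spans meet in a common line\<close>

locale direct_sum =
  fixes S1 S2 :: "(rat ^ 'n) set" and a
  assumes fin: "finite S1" "finite S2"
    and sc1: "strongly_convex (pos_cone S1)" and sc2: "strongly_convex (pos_cone S2)"
    and a: "a \<in> pos_cone S1" "a \<in> pos_cone S2" "a \<noteq> 0"
    and span: "vec.span S1 \<inter> vec.span S2 = {t *s a | t. True}"
begin

lemma in_span: "x \<in> pos_cone S1 \<Longrightarrow> x \<in> vec.span S1" "x \<in> pos_cone S2 \<Longrightarrow> x \<in> vec.span S2"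
  using vec.span_base[of x "pos_cone S1"] vec.span_base[of x "pos_cone S2"] by (auto simp: span_pos_cone)

text \<open>The spans meet in the line of \<open>a\<close>; a negative multiple would put both
  \<open>y\<close> and \<open>- y\<close> into the pointed second cone.\<close>

lemma common_multiple:
  assumes "y \<in> pos_cone S2" "y \<in> vec.span S1" shows "\<exists>t\<ge>0. y = t *s a"
proof -
  obtain t where t: "y = t *s a" using span assms(2) in_span(2)[OF assms(1)] by blast
  show ?thesis
  proof (cases "t \<ge> 0")
    case False
    then have "(- t) *s a \<in> pos_cone S2" using a(2) by (intro pos_cone_scale) auto
    then have "y = 0" using strongly_convexD[OF sc2 assms(1)] by (simp add: t)
    then show ?thesis by (intro exI[of _ 0]) simp
  qed (use t in blast)
qed

lemma swap: "direct_sum S2 S1 a"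
  using fin sc1 sc2 a span by unfold_locales (auto simp: Int_commute)

text \<open>If \<open>x\<close> and \<open>- x\<close> are both decomposed, their components in the
  second cone add up to an element of both spans, that is, a nonnegative multiple of
  \<open>a\<close>. It lies in the first cone together with its negative, so pointedness makes
  everything vanish.\<close>

lemma strongly_convex_sum: "strongly_convex (pos_cone (S1 \<union> S2))"
  unfolding strongly_convex_iff[OF pos_cone_closed]
proof (intro allI impI)
  fix x assume "x \<in> pos_cone (S1 \<union> S2)" "- x \<in> pos_cone (S1 \<union> S2)"
  then obtain x1 x2 y1 y2 where x: "x = x1 + x2" "- x = y1 + y2"
    and 1: "x1 \<in> pos_cone S1" "y1 \<in> pos_cone S1" and 2: "x2 \<in> pos_cone S2" "y2 \<in> pos_cone S2"
    unfolding pos_cone_Un by blast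
  have eq: "x2 + y2 = - (x1 + y1)" using x by (metis add.commute add.left_commute add_eq_0_iff minus_add_cancel)
  have "x2 + y2 \<in> vec.span S1" unfolding eq using 1 in_span(1) by (intro vec.span_neg vec.span_add)
  then obtain t where t: "t \<ge> 0" "x2 + y2 = t *s a" using common_multiple[OF pos_cone_add[OF 2]] by blast
  have "x2 + y2 \<in> pos_cone S1" unfolding t(2) using a(1) t(1) by (rule pos_cone_scale)
  moreover have "- (x2 + y2) \<in> pos_cone S1" unfolding eq minus_minus by (rule pos_cone_add[OF 1])
  ultimately have z: "x2 + y2 = 0" by (rule strongly_convexD[OF sc1])
  then have "y2 = - x2" "y1 = - x1" using eq by (auto simp: eq_neg_iff_add_eq_0 add.commute)
  then have "x1 = 0" "x2 = 0" using strongly_convexD[OF sc1 1(1)] strongly_convexD[OF sc2 2(1)] 1 2 by auto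
  then show "x = 0" using x by simp
qed

lemma cone_dim_sum: "cone_dim (pos_cone (S1 \<union> S2)) + 1 = cone_dim (pos_cone S1) + cone_dim (pos_cone S2)"
proof -
  have "vec.dim (vec.span S1 \<inter> vec.span S2) = 1"
  proof -
    have "{t *s a | t. True} = vec.span {a}" by (auto simp: vec.span_singleton)
    then show ?thesis using a(3) by (simp add: span)
  qed
  then have "vec.dim (vec.span (S1 \<union> S2)) + 1 = vec.dim (vec.span S1) + vec.dim (vec.span S2)"
    using vec.dim_sums_Int[of "vec.span S1" "vec.span S2"] by (simp add: vec.span_Un)
  then show ?thesis by (simp add: cone_dim_pos_cone)
qed

text \<open>The supporting functional is found by Gordan's theorem modulo the ray; the original functional on
  the first cone, positive at \<open>a\<close>, shows that no positive combination of the other generators lies on the ray.\<close>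

lemma extreme_ray_lift:
  assumes \<rho>: "\<rho> \<in> extreme_rays (pos_cone S1)" and "a \<notin> \<rho>"
  shows "\<rho> \<in> extreme_rays (pos_cone (S1 \<union> S2))"
proof -
  obtain c where c: "\<rho> = pos_cone S1 \<inter> {x. qdot c x = 0}"
    "\<And>x. x \<in> pos_cone S1 \<Longrightarrow> qdot c x \<ge> 0" "cone_dim \<rho> = 1"
    "cone_closed \<rho>" "\<And>v. v \<in> \<rho> \<Longrightarrow> v \<noteq> 0 \<Longrightarrow> \<rho> = {t *s v | t. t \<ge> 0}"
    by (rule extreme_rayE[OF \<rho> sc1 pos_cone_closed]) (rule that)
  obtain v where v: "v \<in> \<rho>" "v \<noteq> 0" using dim_1_nonzero[OF c(3)] by blast
  have \<rho>v: "\<rho> = pos_cone {v}" using c(5)[OF v] by (simp add: pos_cone_singleton)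
  \<comment> \<open>The generators off the ray: a functional that vanishes on \<open>v\<close> and
    is positive on \<open>S'\<close> exposes the ray in the sum.\<close>
  define S' where "S' = {s \<in> S1 \<union> S2. s \<notin> \<rho>}"
  have finS': "finite S'" using fin by (auto simp: S'_def)
  have no: "\<forall>s\<in>S'. l s = 0" if l: "\<And>s. s \<in> S' \<Longrightarrow> l s \<ge> 0" "(\<Sum>s\<in>S'. l s *s s) = t *s v" for l t
  proof -
    let ?A = "S' \<inter> S1" and ?B = "S' - S1"
    let ?x = "\<Sum>s\<in>?A. l s *s s" and ?y = "\<Sum>s\<in>?B. l s *s s"
    have xy: "?x + ?y = t *s v" using l(2) finS' sum.Int_Diff[of S' _ S1] by metis
    have x: "?x \<in> pos_cone S1" using l(1) pos_cone_base[of S1]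
      by (intro cone_closed_sum[OF pos_cone_closed] pos_cone_scale) auto
    have B: "l s *s s \<in> pos_cone S2" if "s \<in> ?B" for s using l(1) pos_cone_base[of S2] that
      by (intro pos_cone_scale) (auto simp: S'_def)
    have y: "?y \<in> pos_cone S2" using B by (intro cone_closed_sum[OF pos_cone_closed])
    have "v \<in> pos_cone S1" using v c(1) by blast
    then have "t *s v - ?x \<in> vec.span S1" using x in_span(1) by (intro vec.span_diff vec.span_scale)
    moreover have "t *s v - ?x = ?y" unfolding xy[symmetric] by (rule add_diff_cancel_left')
    \<comment> \<open>The contribution of the second cone lies in both spans, so it is a nonnegative
      multiple of \<open>a\<close>. Evaluating \<open>c\<close> then gives two nonnegative terms
      with sum 0.\<close>
    ultimately obtain b where b: "b \<ge> 0" "?y = b *s a" using common_multiple[OF y] by auto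
    have "qdot c ?x + b * qdot c a = 0"
    proof -
      have "qdot c ?x + qdot c ?y = qdot c (t *s v)" unfolding xy[symmetric] by (simp only: qdot_simps(1))
      then show ?thesis using v(1) by (simp add: b(2) qdot_simps(2) c(1))
    qed
    moreover have "qdot c ?x \<ge> 0" using c(2)[OF x] .
    moreover have ca: "qdot c a > 0" using c(2)[OF a(1)] \<open>a \<notin> \<rho>\<close> a(1) by (auto simp: c(1) less_le)
    ultimately have "qdot c ?x = 0" "b * qdot c a = 0"
      using mult_nonneg_nonneg[OF b(1) less_imp_le[OF ca]] by linarith+
    then have "b = 0" using ca by simp
    have A0: "l s = 0" if "s \<in> ?A" for s
    proof -
      have pos: "qdot c s > 0" if "s \<in> ?A" for s
        using c(2)[of s] that pos_cone_base[of S1] by (auto simp: S'_def c(1) less_le)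
      have "(\<Sum>s\<in>?A. l s * qdot c s) = 0" using \<open>qdot c ?x = 0\<close> by (simp add: qdot_sum qdot_simps)
      moreover have "l s * qdot c s \<ge> 0" if "s \<in> ?A" for s using l(1) pos[OF that] that by simp
      ultimately have "l s * qdot c s = 0"
        using sum_nonneg_eq_0_iff[of ?A "\<lambda>s. l s * qdot c s"] finS' that by blast
      then show ?thesis using pos[OF that] by simp
    qed
    have B0: "l s = 0" if "s \<in> ?B" for s
    proof -
      have "?y = 0" using b(2) \<open>b = 0\<close> by simp
      then have "l s *s s = 0" using pointed_sum_zero[OF sc2 pos_cone_closed, of ?B "\<lambda>s. l s *s s"] B finS' that by blast
      moreover have "s \<noteq> 0" using that cone_closedD(1)[OF c(4)] by (auto simp: S'_def)
      ultimately show ?thesis by simp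
    qed
    show ?thesis using A0 B0 by blast
  qed
  obtain d where d: "qdot d v = 0" "\<And>s. s \<in> S' \<Longrightarrow> qdot d s > 0"
  proof (rule gordan_modulo[OF finS' v(2)])
    fix l t assume "\<And>s. s \<in> S' \<Longrightarrow> 0 \<le> l s" "(\<Sum>s\<in>S'. l s *s s) = t *s v"
    then show "\<forall>s\<in>S'. l s = 0" by (rule no)
  qed (rule that)
  have "pos_cone {v} \<in> extreme_rays (pos_cone (insert v S'))" by (rule exposed_ray[OF finS' d(2) v(2) d(1)])
  moreover have "pos_cone (insert v S') = pos_cone (S1 \<union> S2)"
  proof (rule antisym)
    have "v \<in> pos_cone (S1 \<union> S2)" using v c(1) pos_cone_mono[of S1 "S1 \<union> S2"] by blast
    then show "pos_cone (insert v S') \<subseteq> pos_cone (S1 \<union> S2)"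
      using pos_cone_base[of "S1 \<union> S2"] by (intro pos_cone_minimal[OF pos_cone_closed]) (auto simp: S'_def)
    have "s \<in> pos_cone (insert v S')" if "s \<in> S1 \<union> S2" for s
    proof (cases "s \<in> \<rho>")
      case True
      then show ?thesis unfolding \<rho>v using pos_cone_mono[of "{v}" "insert v S'"] by blast
    next
      case False
      then show ?thesis using that pos_cone_base[of "insert v S'"] by (auto simp: S'_def)
    qed
    then show "pos_cone (S1 \<union> S2) \<subseteq> pos_cone (insert v S')"
      by (intro pos_cone_minimal[OF pos_cone_closed]) blast
  qed
  ultimately show ?thesis by (simp add: \<rho>v)
qed

lemma extreme_rays_common:
  assumes "\<rho> \<in> extreme_rays (pos_cone S1)" "\<rho> \<in> extreme_rays (pos_cone S2)"
  shows "a \<in> \<rho>"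
proof -
  obtain c where c: "\<rho> = pos_cone S1 \<inter> {x. qdot c x = 0}" "cone_dim \<rho> = 1" "cone_closed \<rho>"
    by (rule extreme_rayE[OF assms(1) sc1 pos_cone_closed]) (rule that)
  obtain v where v: "v \<in> \<rho>" "v \<noteq> 0" using dim_1_nonzero[OF c(2)] by blast
  have "v \<in> pos_cone S2" using assms(2) v(1) by (auto simp: extreme_rays_def faces_def)
  moreover have "v \<in> vec.span S1" using v c(1) in_span(1) by blast
  ultimately obtain t where t: "t \<ge> 0" "v = t *s a" using common_multiple by blast
  then have "a = (1 / t) *s v" using v(2) by auto
  then show ?thesis using cone_closedD(3)[OF c(3) v(1), of "1 / t"] t(1) by simp
qed

end

text \<open>As \<open>a\<close> lies on no ray of either summand, all rays survive and none is
  shared, while the dimensions add up to one more than that of the sum. The bound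
  \<open>cone_dim \<sigma> \<ge> 2\<close> keeps the truncated subtraction exact.\<close>

lemma general_bipyramidal_extreme_rays:
  assumes "\<sigma> \<in> general_bipyramidal"
  shows "(\<exists>S. finite S \<and> \<sigma> = pos_cone S) \<and> strongly_convex \<sigma> \<and> cone_dim \<sigma> \<ge> 2 \<and>
    card (extreme_rays \<sigma>) = 2 * cone_dim \<sigma> - 2"
  using assms
proof induction
  case (simplex2 r1 r2)
  then show ?case using simplex_cone[of r1 r2] by (auto intro: exI[of _ "{r1, r2}"])
next
  case (dsum \<sigma>1 \<sigma>2 \<sigma>)
  obtain S1 S2 where S: "finite S1" "\<sigma>1 = pos_cone S1" "finite S2" "\<sigma>2 = pos_cone S2"
    using dsum.IH by auto
  obtain a where ai: "a \<in> \<sigma>1" "a \<in> \<sigma>2" "vec.span \<sigma>1 \<inter> vec.span \<sigma>2 = {t *s a | t. True}"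
    "\<And>\<rho>. \<rho> \<in> extreme_rays \<sigma>1 \<Longrightarrow> a \<notin> \<rho>" "\<And>\<rho>. \<rho> \<in> extreme_rays \<sigma>2 \<Longrightarrow> a \<notin> \<rho>" "\<sigma> = pos_cone (\<sigma>1 \<union> \<sigma>2)"
    using dsum.hyps(3) unfolding internal_direct_sum_def by blast
  have \<sigma>: "\<sigma> = pos_cone (S1 \<union> S2)" using ai(6) by (simp add: S pos_cone_Un_pos_cone)
  have sc: "strongly_convex (pos_cone S1)" "strongly_convex (pos_cone S2)" using dsum.IH S by auto
  \<comment> \<open>That \<open>a\<close> is nonzero follows from the existence of an extreme ray:
    the ray contains 0 but not \<open>a\<close>.\<close>
  have "extreme_rays \<sigma>1 \<noteq> {}" using dsum.IH(1) by auto
  then obtain \<rho> where \<rho>: "\<rho> \<in> extreme_rays \<sigma>1" by blast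
  have "cone_closed \<rho>" using \<rho> unfolding S(2) by (rule extreme_rayE[OF _ sc(1) pos_cone_closed])
  then have a0: "a \<noteq> 0" using ai(4)[OF \<rho>] cone_closedD(1) by blast
  interpret direct_sum S1 S2 a
    using S sc ai(1-3) a0 by unfold_locales (auto simp: span_pos_cone)
  interpret swap: direct_sum S2 S1 a by (rule swap)
  have "extreme_rays \<sigma> = extreme_rays \<sigma>1 \<union> extreme_rays \<sigma>2"
  proof
    show "extreme_rays \<sigma> \<subseteq> extreme_rays \<sigma>1 \<union> extreme_rays \<sigma>2"
      using extreme_rays_Un[OF strongly_convex_sum] by (simp add: \<sigma> S)
    show "extreme_rays \<sigma>1 \<union> extreme_rays \<sigma>2 \<subseteq> extreme_rays \<sigma>"
      using extreme_ray_lift swap.extreme_ray_lift ai(4,5) unfolding \<sigma> S(2,4) by (auto simp: Un_commute)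
  qed
  moreover have "extreme_rays \<sigma>1 \<inter> extreme_rays \<sigma>2 = {}"
    using extreme_rays_common ai(4) unfolding S(2,4) by blast
  moreover have "finite (extreme_rays \<sigma>1)" "finite (extreme_rays \<sigma>2)"
    using extreme_rays_finite S sc by auto
  ultimately have "card (extreme_rays \<sigma>) = card (extreme_rays \<sigma>1) + card (extreme_rays \<sigma>2)"
    by (simp add: card_Un_disjoint)
  moreover have "cone_dim \<sigma> + 1 = cone_dim \<sigma>1 + cone_dim \<sigma>2" using cone_dim_sum by (simp add: \<sigma> S)
  ultimately have "cone_dim \<sigma> \<ge> 2" "card (extreme_rays \<sigma>) = 2 * cone_dim \<sigma> - 2" using dsum.IH by auto
  then show ?case using strongly_convex_sum \<sigma> fin by auto
qed

section \<open>Relation systems\<close>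

text \<open>Rows now carry linear relations with positive coefficients. The supports drive the
  combinatorics; the coefficients yield the common vector of the two parts of a split.\<close>

locale relation_system = dominating A I P N
  for A :: "(rat ^ 'n) set" and I :: "'i set" and P N +
  assumes nonzero: "0 \<notin> A" and pointed: "strongly_convex (pos_cone A)"
    and relation: "i \<in> I \<Longrightarrow> \<exists>u. (\<forall>x\<in>P i \<union> N i. u x > 0) \<and> (\<Sum>x\<in>P i. u x *s x) = (\<Sum>x\<in>N i. u x *s x)"

lemma relation_system_restrict:
  assumes "relation_system A I P N" "A1 \<subseteq> A"
  shows "relation_system A1 {i\<in>I. P i \<union> N i \<subseteq> A1} P N"
proof -
  interpret relation_system A I P N by fact
  interpret r: dominating A1 "{i\<in>I. P i \<union> N i \<subseteq> A1}" P N
    by (rule dominating_restrict[OF dominating_axioms assms(2)])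
  show ?thesis
  proof
    show "strongly_convex (pos_cone A1)"
      by (rule strongly_convex_subset[OF pointed pos_cone_closed pos_cone_mono[OF assms(2)]])
  qed (use assms(2) nonzero relation in auto)
qed

text \<open>The relation of a crossing row equates a positive combination of points of
  \<open>A1\<close> with one of points of \<open>A2\<close>; pointedness makes this common vector
  nonzero.\<close>

lemma relation_system_split:
  assumes "relation_system A I P N" "card A \<ge> 2"
  obtains A1 A2 I1 I2 where "relation_system A1 I1 P N" "relation_system A2 I2 P N"
    "A1 \<union> A2 = A" "card A1 + card A2 = card A" "A1 \<noteq> {}" "A2 \<noteq> {}"
    "card I = card I1 + card I2 \<or>
     card I = card I1 + card I2 + 1 \<and> (\<exists>a. a \<in> pos_cone A1 \<and> a \<in> pos_cone A2 \<and> a \<noteq> 0)"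
proof -
  interpret relation_system A I P N by fact
  obtain A1 A2 where A: "A1 \<noteq> {}" "A2 \<noteq> {}" "A1 \<inter> A2 = {}" "A1 \<union> A2 = A" "split_by I P N A1 A2"
    using dominating_split[OF dominating_axioms assms(2)] by blast
  define I1 where "I1 = {i\<in>I. P i \<union> N i \<subseteq> A1}"
  define I2 where "I2 = {i\<in>I. P i \<union> N i \<subseteq> A2}"
  have fin: "finite I1" "finite I2" using finite_I by (auto simp: I1_def I2_def)
  have disj: "I1 \<inter> I2 = {}" using A(3) P_ne by (fastforce simp: I1_def I2_def)
  have card12: "card (I1 \<union> I2) = card I1 + card I2" using fin disj by (rule card_Un_disjoint)
  have cases: "card I = card I1 + card I2 \<or>
     card I = card I1 + card I2 + 1 \<and> (\<exists>a. a \<in> pos_cone A1 \<and> a \<in> pos_cone A2 \<and> a \<noteq> 0)"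
    using A(5) unfolding split_by_def
  proof (elim disjE bexE conjE)
    assume "\<forall>i\<in>I. P i \<union> N i \<subseteq> A1 \<or> P i \<union> N i \<subseteq> A2"
    then have "I = I1 \<union> I2" unfolding I1_def I2_def by blast
    then show ?thesis using card12 by simp
  next
    fix i0 assume i0: "i0 \<in> I" "P i0 \<subseteq> A1" "N i0 \<subseteq> A2"
      "\<forall>i\<in>I - {i0}. P i \<union> N i \<subseteq> A1 \<or> P i \<union> N i \<subseteq> A2"
    have "\<not> N i0 \<subseteq> A1" "\<not> P i0 \<subseteq> A2" using i0(2,3) P_ne[OF i0(1)] N_ne[OF i0(1)] A(3) by blast+
    then have "i0 \<notin> I1 \<union> I2" by (simp add: I1_def I2_def)
    moreover have "I = insert i0 (I1 \<union> I2)" using i0(1,4) unfolding I1_def I2_def by blast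
    ultimately have "card I = card I1 + card I2 + 1" using fin card12 by simp
    moreover have "\<exists>a. a \<in> pos_cone A1 \<and> a \<in> pos_cone A2 \<and> a \<noteq> 0"
    proof -
      obtain u where u: "\<forall>x\<in>P i0 \<union> N i0. u x > 0" "(\<Sum>x\<in>P i0. u x *s x) = (\<Sum>x\<in>N i0. u x *s x)"
        using relation[OF i0(1)] by blast
      let ?a = "\<Sum>x\<in>P i0. u x *s x"
      have "?a \<in> pos_cone A1" using u(1) i0(2) pos_cone_base[of A1]
        by (intro cone_closed_sum[OF pos_cone_closed] pos_cone_scale) (auto simp: less_imp_le)
      moreover have "?a \<in> pos_cone A2" unfolding u(2) using u(1) i0(3) pos_cone_base[of A2]
        by (intro cone_closed_sum[OF pos_cone_closed] pos_cone_scale) (auto simp: less_imp_le)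
      moreover have "?a \<noteq> 0"
      proof
        assume 0: "?a = 0"
        obtain x where x: "x \<in> P i0" using P_ne[OF i0(1)] by blast
        have "u x *s x = 0"
        proof (rule pointed_sum_zero[OF pointed pos_cone_closed _ _ 0 x])
          show "finite (P i0)" using P_sub[OF i0(1)] finite_A finite_subset by blast
          show "u y *s y \<in> pos_cone A" if "y \<in> P i0" for y
            using that u(1) P_sub[OF i0(1)] pos_cone_base[of A] by (intro pos_cone_scale) (auto simp: less_imp_le)
        qed
        moreover have "x \<noteq> 0" using x P_sub[OF i0(1)] nonzero by blast
        moreover have "u x > 0" using u(1) x by blast
        ultimately show False by simp
      qed
      ultimately show ?thesis by blast
    qed
    ultimately show ?thesis by blast
  qed
  have fA: "finite A1" "finite A2" using A(4) finite_A by auto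
  show thesis
  proof (rule that[OF _ _ A(4) _ A(1,2) cases])
    show "relation_system A1 I1 P N" "relation_system A2 I2 P N"
      unfolding I1_def I2_def by (rule relation_system_restrict[OF assms(1)], use A(4) in blast)+
    show "card A1 + card A2 = card A" using card_Un_disjoint[OF fA A(3)] A(4) by simp
  qed
qed

lemma dim_Un:
  "vec.dim (S \<union> T) + vec.dim (vec.span S \<inter> vec.span T) = vec.dim S + vec.dim (T :: ('a::field ^ 'n) set)"
proof -
  have "vec.dim (vec.span (S \<union> T)) + vec.dim (vec.span S \<inter> vec.span T) = vec.dim (vec.span S) + vec.dim (vec.span T)"
    using vec.dim_sums_Int[of "vec.span S" "vec.span T"] by (simp add: vec.span_Un)
  then show ?thesis by simp
qed

lemma dim_pos: "x \<in> S \<Longrightarrow> x \<noteq> 0 \<Longrightarrow> vec.dim S > 0"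
  for S :: "('a::field ^ 'n) set"
  using vec.dim_eq_0[of S] by (metis gr0I singletonD subsetD)

text \<open>A crossing row adds one to the number of rows, but it also contributes a nonzero vector
  to the intersection of the spans, so the dimension of the union drops by at least one.\<close>

lemma relation_system_dim:
  assumes "relation_system A I P N"
  shows "vec.dim A + card I \<le> card A"
  using assms
proof (induction "card A" arbitrary: A I rule: less_induct)
  case less
  interpret relation_system A I P N by fact
  show ?case
  proof (cases "card A \<ge> 2")
    case False
    have "vec.dim A \<le> card A" using finite_A by (rule vec.dim_le_card')
    moreover have "I = {}"
    proof (cases "A = {}")
      case True
      then show ?thesis using P_sub P_ne by auto
    next
      case False
      then have "card I < card A" using dom[of A] straddling_all by auto
      then have "card I = 0" using \<open>\<not> card A \<ge> 2\<close> by linarith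
      then show ?thesis using finite_I by simp
    qed
    ultimately show ?thesis by simp
  next
    case True
    obtain A1 A2 I1 I2 where s: "relation_system A1 I1 P N" "relation_system A2 I2 P N"
      "A1 \<union> A2 = A" "card A1 + card A2 = card A" "A1 \<noteq> {}" "A2 \<noteq> {}"
      "card I = card I1 + card I2 \<or>
       card I = card I1 + card I2 + 1 \<and> (\<exists>a. a \<in> pos_cone A1 \<and> a \<in> pos_cone A2 \<and> a \<noteq> 0)"
      by (rule relation_system_split[OF less.prems True])
    have "finite A1" "finite A2" using s(3) finite_A by auto
    then have "card A1 < card A" "card A2 < card A" using s(4-6) by (auto simp flip: card_0_eq)
    then have IH: "vec.dim A1 + card I1 \<le> card A1" "vec.dim A2 + card I2 \<le> card A2" using less.hyps s(1,2) by auto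
    have dim: "vec.dim A + vec.dim (vec.span A1 \<inter> vec.span A2) = vec.dim A1 + vec.dim A2"
      using dim_Un[of A1 A2] s(3) by simp
    show ?thesis
      using s(7)
    proof
      assume "card I = card I1 + card I2"
      then show ?thesis using IH dim s(4) by linarith
    next
      assume c: "card I = card I1 + card I2 + 1 \<and> (\<exists>a. a \<in> pos_cone A1 \<and> a \<in> pos_cone A2 \<and> a \<noteq> 0)"
      then obtain a where a: "a \<in> pos_cone A1" "a \<in> pos_cone A2" "a \<noteq> 0" by blast
      then have "a \<in> vec.span A1 \<inter> vec.span A2"
        using vec.span_base[of a "pos_cone A1"] vec.span_base[of a "pos_cone A2"] by (simp add: span_pos_cone)
      then have "vec.dim (vec.span A1 \<inter> vec.span A2) > 0" using a(3) by (rule dim_pos)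
      then show ?thesis using IH dim s(4) c by linarith
    qed
  qed
qed

text \<open>The dimension bound of \<open>relation_system_dim\<close> is attained on both parts of a split whenever it is
  attained on the whole, so that the two spans meet exactly in the line of the crossing relation.\<close>

lemma relation_system_extreme_rays:
  assumes "relation_system A I P N" "vec.dim A + card I = card A" "vec.dim A \<ge> 2"
  shows "card (extreme_rays (pos_cone A)) \<le> 2 * vec.dim A - 2 \<and>
    (card (extreme_rays (pos_cone A)) = 2 * vec.dim A - 2 \<longrightarrow> pos_cone A \<in> general_bipyramidal)"
  using assms
proof (induction "card A" arbitrary: A I rule: less_induct)
  case less
  interpret relation_system A I P N by fact
  have "vec.dim A \<le> card A" using finite_A by (rule vec.dim_le_card')
  then have "card A \<ge> 2" using less.prems by simp
  then obtain A1 A2 I1 I2 where s: "relation_system A1 I1 P N" "relation_system A2 I2 P N"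
    "A1 \<union> A2 = A" "card A1 + card A2 = card A" "A1 \<noteq> {}" "A2 \<noteq> {}"
    "card I = card I1 + card I2 \<or>
     card I = card I1 + card I2 + 1 \<and> (\<exists>a. a \<in> pos_cone A1 \<and> a \<in> pos_cone A2 \<and> a \<noteq> 0)"
    by (rule relation_system_split[OF less.prems(1)])
  interpret s1: relation_system A1 I1 P N by fact
  interpret s2: relation_system A2 I2 P N by fact
  let ?r = "\<lambda>A. card (extreme_rays (pos_cone A))"
  have small: "card A1 < card A" "card A2 < card A"
    using s(4-6) s1.finite_A s2.finite_A by (auto simp flip: card_0_eq)
  have fin: "finite (extreme_rays (pos_cone A1))" "finite (extreme_rays (pos_cone A2))"
    using extreme_rays_finite s1.finite_A s1.pointed s2.finite_A s2.pointed by auto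
  have rays: "extreme_rays (pos_cone A) \<subseteq> extreme_rays (pos_cone A1) \<union> extreme_rays (pos_cone A2)"
    using extreme_rays_Un[of A1 A2] pointed s(3) by simp
  have "?r A \<le> card (extreme_rays (pos_cone A1) \<union> extreme_rays (pos_cone A2))" using rays fin by (intro card_mono) auto
  also have "\<dots> \<le> ?r A1 + ?r A2" by (rule card_Un_le)
  finally have le: "?r A \<le> ?r A1 + ?r A2" .
  have dim: "vec.dim A + vec.dim (vec.span A1 \<inter> vec.span A2) = vec.dim A1 + vec.dim A2"
    using dim_Un[of A1 A2] s(3) by simp
  have d: "vec.dim A1 + card I1 \<le> card A1" "vec.dim A2 + card I2 \<le> card A2"
    using relation_system_dim s(1,2) by blast+
  have pos: "vec.dim A1 > 0" "vec.dim A2 > 0"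
    using s(5,6) s1.nonzero s2.nonzero dim_pos[of _ A1] dim_pos[of _ A2] by (metis all_not_in_conv)+
  have one: "?r B \<le> 1" if "strongly_convex (pos_cone B)" "vec.dim B = 1" for B :: "(rat ^ 'n) set"
    using card_mono[OF _ extreme_rays_dim_1[OF that(1) pos_cone_closed]] that(2) by (simp add: cone_dim_pos_cone)
  show ?case
    using s(7)
  proof
    assume "card I = card I1 + card I2"
    \<comment> \<open>Equality for the whole leaves no room: it holds for both parts, and the spans
      meet only in 0.\<close>
    then have e: "vec.dim A1 + card I1 = card A1" "vec.dim A2 + card I2 = card A2"
      "vec.dim A = vec.dim A1 + vec.dim A2" using d dim s(4) less.prems(2) by linarith+
    have IH: "?r B1 \<le> 2 * vec.dim B1 - 2" if "vec.dim B1 \<ge> 2" "B1 = A1 \<or> B1 = A2" for B1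
      using less.hyps[OF small(1) s(1) e(1)] less.hyps[OF small(2) s(2) e(2)] that by blast
    consider "vec.dim A1 = 1" "vec.dim A2 = 1" | "vec.dim A1 \<ge> 2" | "vec.dim A2 \<ge> 2" using pos by linarith
    then show ?thesis
    proof cases
      case 1
      obtain r1 where r1: "r1 \<in> A1" using s(5) by blast
      obtain r2 where r2: "r2 \<in> A2" using s(6) by blast
      have line: "pos_cone B = pos_cone {r}"
        if "strongly_convex (pos_cone B)" "vec.dim B = 1" "r \<in> B" "r \<noteq> 0" for B :: "(rat ^ 'n) set" and r
        using half_line[OF that(1) pos_cone_closed, of r] that pos_cone_base[of B]
        by (auto simp: cone_dim_pos_cone pos_cone_singleton)
      have nz: "r1 \<noteq> 0" "r2 \<noteq> 0" using r1 r2 s1.nonzero s2.nonzero by blast+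
      have "pos_cone A1 = pos_cone {r1}" "pos_cone A2 = pos_cone {r2}"
        using line[OF s1.pointed 1(1) r1 nz(1)] line[OF s2.pointed 1(2) r2 nz(2)] by auto
      then have \<sigma>: "pos_cone A = pos_cone {r1, r2}"
        using pos_cone_Un[of A1 A2] pos_cone_Un[of "{r1}" "{r2}"] s(3) by (simp add: insert_commute)
      have "vec.dim {r1, r2} = 2" using \<sigma> cone_dim_pos_cone[of A] cone_dim_pos_cone[of "{r1, r2}"] e(3) 1 by simp
      moreover have "card {r1, r2} \<le> 2" by (simp add: card_insert_if)
      moreover have "vec.dim {r1, r2} \<le> card {r1, r2}" by (intro vec.dim_le_card') simp
      ultimately have c2: "card {r1, r2} = vec.dim {r1, r2}" "r1 \<noteq> r2" by auto
      then have "vec.independent {r1, r2}"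
        by (intro vec.card_le_dim_spanning[of _ "{r1, r2}"]) (auto simp: vec.span_superset)
      then have "pos_cone A \<in> general_bipyramidal" unfolding \<sigma> using c2(2) by (rule general_bipyramidal.simplex2)
      moreover have "?r A \<le> 2" using le one[OF s1.pointed 1(1)] one[OF s2.pointed 1(2)] by linarith
      ultimately show ?thesis using e(3) 1 by simp
    next
      case 2
      \<comment> \<open>A ray has one extreme ray, so \<open>2 * dim - 1\<close> bounds the count in
        every positive dimension; the other part, of dimension at least two, keeps the total at most
        \<open>2 * dim - 3\<close>.\<close>
      have "?r A2 \<le> 2 * vec.dim A2 - 1"
        using IH[of A2] one[OF s2.pointed] pos(2) by (cases "vec.dim A2 = 1") auto
      then have "?r A < 2 * vec.dim A - 2" using le IH[of A1] 2 e(3) pos by simp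
      then show ?thesis by simp
    next
      case 3
      have "?r A1 \<le> 2 * vec.dim A1 - 1"
        using IH[of A1] one[OF s1.pointed] pos(1) by (cases "vec.dim A1 = 1") auto
      then have "?r A < 2 * vec.dim A - 2" using le IH[of A2] 3 e(3) pos by simp
      then show ?thesis by simp
    qed
  next
    assume c: "card I = card I1 + card I2 + 1 \<and> (\<exists>a. a \<in> pos_cone A1 \<and> a \<in> pos_cone A2 \<and> a \<noteq> 0)"
    then obtain a where a: "a \<in> pos_cone A1" "a \<in> pos_cone A2" "a \<noteq> 0" by blast
    have aspan: "a \<in> vec.span A1 \<inter> vec.span A2"
      using a vec.span_base[of a "pos_cone A1"] vec.span_base[of a "pos_cone A2"] by (simp add: span_pos_cone)
    then have "vec.dim (vec.span A1 \<inter> vec.span A2) > 0" using a(3) by (rule dim_pos)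
    then have e: "vec.dim A1 + card I1 = card A1" "vec.dim A2 + card I2 = card A2"
      "vec.dim A + 1 = vec.dim A1 + vec.dim A2" "vec.dim (vec.span A1 \<inter> vec.span A2) = 1"
      using d dim s(4) less.prems(2) c by linarith+
    \<comment> \<open>A part of dimension one is the ray of \<open>a\<close>, which already lies in
      the other cone.\<close>
    have absorb: "pos_cone A = pos_cone B2"
      if "pos_cone A = pos_cone (B1 \<union> B2)" "strongly_convex (pos_cone B1)" "vec.dim B1 = 1"
        "a \<in> pos_cone B1" "a \<in> pos_cone B2" for B1 B2
    proof -
      have "pos_cone B1 = {t *s a | t. t \<ge> 0}"
        using half_line[OF that(2) pos_cone_closed _ that(4) a(3)] that(3) by (simp add: cone_dim_pos_cone)
      then have "pos_cone B1 \<subseteq> pos_cone B2" by (auto intro: pos_cone_scale[OF that(5)])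
      then have "B1 \<union> B2 \<subseteq> pos_cone B2" using pos_cone_base[of B1] pos_cone_base[of B2] by blast
      then show ?thesis unfolding that(1)
        using pos_cone_minimal[OF pos_cone_closed] pos_cone_mono[of B2 "B1 \<union> B2"] by blast
    qed
    consider "vec.dim A1 = 1" | "vec.dim A2 = 1" | "vec.dim A1 \<ge> 2" "vec.dim A2 \<ge> 2" using pos by linarith
    then show ?thesis
    proof cases
      case 1
      have "pos_cone A = pos_cone A2" by (rule absorb[OF _ s1.pointed 1 a(1,2)]) (simp add: s(3))
      moreover have "vec.dim A = vec.dim A2" using 1 e(3) by simp
      ultimately show ?thesis using less.hyps[OF small(2) s(2) e(2)] less.prems(3) by simp
    next
      case 2
      have "pos_cone A = pos_cone A1"
        by (rule absorb[OF _ s2.pointed 2 a(2,1)]) (simp add: s(3) Un_commute[of A2])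
      moreover have "vec.dim A = vec.dim A1" using 2 e(3) by simp
      ultimately show ?thesis using less.hyps[OF small(1) s(1) e(1)] less.prems(3) by simp
    next
      case 3
      note IH1 = less.hyps[OF small(1) s(1) e(1) 3(1)] and IH2 = less.hyps[OF small(2) s(2) e(2) 3(2)]
      have bound: "?r A \<le> 2 * vec.dim A - 2" using le IH1 IH2 e(3) 3 by linarith
      have "pos_cone A \<in> general_bipyramidal" if eq: "?r A = 2 * vec.dim A - 2"
      proof -
        have gb: "?r A1 = 2 * vec.dim A1 - 2" "?r A2 = 2 * vec.dim A2 - 2" "?r A = ?r A1 + ?r A2"
          using le IH1 IH2 e(3) 3 eq by linarith+
        have Un: "card (extreme_rays (pos_cone A1) \<union> extreme_rays (pos_cone A2)) = ?r A1 + ?r A2"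
          using \<open>?r A \<le> card (extreme_rays (pos_cone A1) \<union> extreme_rays (pos_cone A2))\<close> gb(3)
            card_Un_le[of "extreme_rays (pos_cone A1)" "extreme_rays (pos_cone A2)"] by linarith
        then have disj: "extreme_rays (pos_cone A1) \<inter> extreme_rays (pos_cone A2) = {}"
          using card_Un_Int[OF fin] fin by simp
        have all: "extreme_rays (pos_cone A) = extreme_rays (pos_cone A1) \<union> extreme_rays (pos_cone A2)"
          using rays fin Un gb(3) by (intro card_subset_eq) auto
        have sub: "pos_cone A1 \<subseteq> pos_cone A" "pos_cone A2 \<subseteq> pos_cone A" using s(3) by (auto intro!: pos_cone_mono)
        \<comment> \<open>Both parts contain \<open>a\<close>, so an extreme ray through
          \<open>a\<close> would be extreme in both; equality of the counts has made their sets of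
          rays disjoint.\<close>
        have no: "a \<notin> \<rho>" if "\<rho> \<in> extreme_rays (pos_cone A)" for \<rho>
        proof
          assume "a \<in> \<rho>"
          then have "\<rho> \<in> extreme_rays (pos_cone A1)" "\<rho> \<in> extreme_rays (pos_cone A2)"
            by (rule extreme_ray_subcone[OF that pointed pos_cone_closed sub(1) pos_cone_closed _ a(1,3)],
                rule extreme_ray_subcone[OF that pointed pos_cone_closed sub(2) pos_cone_closed _ a(2,3)])
          then show False using disj by blast
        qed
        have "vec.span A1 \<inter> vec.span A2 \<subseteq> vec.span {a}"
          using e(4) a(3) aspan by (intro vec.card_ge_dim_independent) auto
        moreover have "vec.span {a} \<subseteq> vec.span A1 \<inter> vec.span A2"
          using aspan by (intro vec.span_minimal) (auto intro: vec.subspace_inter)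
        ultimately have "vec.span A1 \<inter> vec.span A2 = vec.span {a}" by blast
        also have "\<dots> = {t *s a | t. True}" by (auto simp: vec.span_singleton)
        finally have span: "vec.span A1 \<inter> vec.span A2 = {t *s a | t. True}" .
        have "internal_direct_sum (pos_cone A1) (pos_cone A2) (pos_cone A)"
          unfolding internal_direct_sum_def
        proof (intro conjI)
          show "\<exists>a\<in>pos_cone A1 \<inter> pos_cone A2. vec.span (pos_cone A1) \<inter> vec.span (pos_cone A2) = {t *s a |t. True} \<and>
             (\<forall>\<rho>\<in>extreme_rays (pos_cone A1). a \<notin> \<rho>) \<and> (\<forall>\<rho>\<in>extreme_rays (pos_cone A2). a \<notin> \<rho>)"
            using a span no unfolding all span_pos_cone by (intro bexI[of _ a] conjI ballI) simp_all
          show "pos_cone A = pos_cone (pos_cone A1 \<union> pos_cone A2)" by (simp add: pos_cone_Un_pos_cone s(3))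
          show "rational_polyhedral_cone (pos_cone A1)" "rational_polyhedral_cone (pos_cone A2)"
            using s1.finite_A s2.finite_A by (auto simp: rational_polyhedral_cone_def)
        qed (rule s1.pointed s2.pointed)+
        then show ?thesis
          by (rule general_bipyramidal.dsum[rotated 2]) (use IH1 IH2 gb in simp_all)
      qed
      then show ?thesis using bound by blast
    qed
  qed
qed

section \<open>Toric ideals\<close>

abbreviation lookup :: "('a \<Rightarrow>\<^sub>0 'b::zero) \<Rightarrow> 'a \<Rightarrow> 'b" where "lookup \<equiv> Poly_Mapping.lookup"
abbreviation keys :: "('a \<Rightarrow>\<^sub>0 'b::zero) \<Rightarrow> 'a set" where "keys \<equiv> Poly_Mapping.keys"
abbreviation single :: "'a \<Rightarrow> 'b::zero \<Rightarrow> 'a \<Rightarrow>\<^sub>0 'b" where "single \<equiv> Poly_Mapping.single"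

type_synonym 'n expo = "(int ^ 'n) \<Rightarrow>\<^sub>0 nat"

lemma lat_deg_superset:
  assumes "finite S" "keys e \<subseteq> S"
  shows "lat_deg e = (\<Sum>a\<in>S. int (lookup e a) *s a)"
  unfolding lat_deg_def using assms by (intro sum.mono_neutral_cong_left) (auto simp: in_keys_iff)

lemma lat_deg_add: "lat_deg (e + f) = lat_deg e + lat_deg f"
proof -
  let ?S = "keys e \<union> keys f"
  have "lat_deg g = (\<Sum>a\<in>?S. int (lookup g a) *s a)" if "keys g \<subseteq> ?S" for g
    using that by (intro lat_deg_superset) auto
  note * = this
  show ?thesis using keys_add[of e f]
    by (simp add: * lookup_add vector_sadd_rdistrib sum.distrib)
qed

lemma lat_deg_0 [simp]: "lat_deg 0 = 0"
  by (simp add: lat_deg_def)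

lemma lat_deg_single: "lat_deg (single a k) = int k *s a"
  by (simp add: lat_deg_def)

lemma poly_mapping_sum_single:
  "p = (\<Sum>e\<in>keys p. single e (lookup p e))"
  by (rule poly_mapping_eqI) (auto simp: lookup_sum lookup_single when_def in_keys_iff sum.delta)

lemma poly_mapping_mult_eq_sum:
  fixes p q :: "('e::comm_monoid_add \<Rightarrow>\<^sub>0 'k::comm_ring_1)"
  shows "p * q = (\<Sum>g\<in>keys p. \<Sum>e\<in>keys q.
    single (g + e) (lookup p g * lookup q e))"
proof -
  have "p * q = (\<Sum>g\<in>keys p. single g (lookup p g)) *
      (\<Sum>e\<in>keys q. single e (lookup q e))"
    using poly_mapping_sum_single[of p] poly_mapping_sum_single[of q] by simp
  also have "\<dots> = (\<Sum>g\<in>keys p. \<Sum>e\<in>keys q.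
    single (g + e) (lookup p g * lookup q e))"
    by (simp add: sum_product mult_single)
  finally show ?thesis .
qed

text \<open>The linear functional with value \<open>\<phi> e\<close> on the monomial
  \<open>e\<close>. Coefficients of the toric image have this form, and so do the functionals that
  bound the number of generators.\<close>

definition coeff_sum :: "('e \<Rightarrow> 'k) \<Rightarrow> ('e \<Rightarrow>\<^sub>0 'k) \<Rightarrow> 'k::comm_ring_1" where
  "coeff_sum \<phi> p = (\<Sum>e\<in>keys p. \<phi> e * lookup p e)"

lemma coeff_sum_superset:
  assumes "finite S" "keys p \<subseteq> S"
  shows "coeff_sum \<phi> p = (\<Sum>e\<in>S. \<phi> e * lookup p e)"
  unfolding coeff_sum_def using assms by (intro sum.mono_neutral_left) (auto simp: in_keys_iff)

lemma coeff_sum_add: "coeff_sum \<phi> (p + q) = coeff_sum \<phi> p + coeff_sum \<phi> q"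
proof -
  let ?S = "keys p \<union> keys q"
  have *: "coeff_sum \<phi> g = (\<Sum>e\<in>?S. \<phi> e * lookup g e)" if "keys g \<subseteq> ?S" for g
    using that by (intro coeff_sum_superset) auto
  show ?thesis using keys_add[of p q] by (simp add: * lookup_add distrib_left sum.distrib)
qed

lemma coeff_sum_0 [simp]: "coeff_sum \<phi> 0 = 0"
  by (simp add: coeff_sum_def)

lemma coeff_sum_sum: "coeff_sum \<phi> (\<Sum>i\<in>S. f i) = (\<Sum>i\<in>S. coeff_sum \<phi> (f i))"
  by (induction S rule: infinite_finite_induct) (auto simp: coeff_sum_add)

lemma coeff_sum_single [simp]: "coeff_sum \<phi> (single e c) = \<phi> e * c"
  by (simp add: coeff_sum_def)

lemma coeff_sum_mult:
  fixes p q :: "('e::comm_monoid_add \<Rightarrow>\<^sub>0 'k::comm_ring_1)"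
  shows "coeff_sum \<phi> (p * q) =
    (\<Sum>g\<in>keys p. lookup p g * coeff_sum (\<lambda>e. \<phi> (g + e)) q)"
  by (simp add: poly_mapping_mult_eq_sum[of p q] coeff_sum_sum)
     (simp add: coeff_sum_def sum_distrib_left algebra_simps)

lemma toric_image_coeff_eq: "toric_image_coeff p u = coeff_sum (\<lambda>e. if lat_deg e = u then 1 else 0) p"
  unfolding toric_image_coeff_def coeff_sum_def
  by (intro sum.mono_neutral_cong_left) auto

text \<open>Grouped by degree, the value becomes a combination of coefficients of the toric image,
  all of which vanish.\<close>

lemma toric_ideal_degree_sum:
  assumes p: "p \<in> toric_ideal K A"
    and \<phi>: "\<And>e f. keys e \<subseteq> A \<Longrightarrow> keys f \<subseteq> A \<Longrightarrow> lat_deg e = lat_deg f \<Longrightarrow> \<phi> e = \<phi> f"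
  shows "coeff_sum \<phi> p = 0"
proof -
  let ?k = "keys p"
  have keys: "keys e \<subseteq> A" if "e \<in> ?k" for e
    using p that by (auto simp: toric_ideal_def poly_ring_def)
  have "coeff_sum \<phi> p = (\<Sum>u\<in>lat_deg ` ?k. \<Sum>e\<in>{e\<in>?k. lat_deg e = u}. \<phi> e * lookup p e)"
    unfolding coeff_sum_def by (rule sum.image_gen) simp
  also have "\<dots> = 0"
  proof (rule sum.neutral, rule ballI)
    fix u assume "u \<in> lat_deg ` ?k"
    then obtain e0 where e0: "e0 \<in> ?k" "lat_deg e0 = u" by blast
    have "(\<Sum>e\<in>{e\<in>?k. lat_deg e = u}. \<phi> e * lookup p e) =
        (\<Sum>e\<in>{e\<in>?k. lat_deg e = u}. \<phi> e0 * lookup p e)"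
      using \<phi> keys e0 by (intro sum.cong arg_cong2[of _ _ _ _ "(*)"]) auto
    also have "\<dots> = \<phi> e0 * toric_image_coeff p u"
      by (simp add: toric_image_coeff_def sum_distrib_left)
    also have "\<dots> = 0" using p by (simp add: toric_ideal_def)
    finally show "(\<Sum>e\<in>{e\<in>?k. lat_deg e = u}. \<phi> e * lookup p e) = 0" .
  qed
  finally show ?thesis .
qed

lemma poly_ring_0 [simp]: "0 \<in> poly_ring K A"
  by (simp add: poly_ring_def)

lemma poly_ring_1 [simp]: "1 \<in> poly_ring K A"
  by (simp add: poly_ring_def)

lemma poly_ring_single [simp]: "keys e \<subseteq> A \<Longrightarrow> single e c \<in> poly_ring K A"
  by (simp add: poly_ring_def)

lemma poly_ring_add: "p \<in> poly_ring K A \<Longrightarrow> q \<in> poly_ring K A \<Longrightarrow> p + q \<in> poly_ring K A"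
  using keys_add[of p q] by (auto simp: poly_ring_def)

lemma poly_ring_uminus: "p \<in> poly_ring K A \<Longrightarrow> - p \<in> poly_ring K A"
  by (auto simp: poly_ring_def in_keys_iff)

lemma poly_ring_mult: "p \<in> poly_ring K A \<Longrightarrow> q \<in> poly_ring K A \<Longrightarrow> p * q \<in> poly_ring K A"
proof -
  assume p: "p \<in> poly_ring K A" and q: "q \<in> poly_ring K A"
  have "keys e \<subseteq> A" if e: "e \<in> keys (p * q)" for e
  proof -
    obtain g f where "e = g + f" "g \<in> keys p" "f \<in> keys q"
      using e keys_mult[of p q] by blast
    moreover have "keys g \<subseteq> A" "keys f \<subseteq> A"
      using p q calculation by (auto simp: poly_ring_def)
    ultimately show ?thesis using keys_add[of g f] by blast
  qed
  then show ?thesis by (simp add: poly_ring_def)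
qed

lemma poly_ring_sum: "(\<And>i. i \<in> S \<Longrightarrow> f i \<in> poly_ring K A) \<Longrightarrow> (\<Sum>i\<in>S. f i) \<in> poly_ring K A"
  by (induction S rule: infinite_finite_induct) (auto intro: poly_ring_add)

lemma poly_ring_power: "p \<in> poly_ring K A \<Longrightarrow> p ^ n \<in> poly_ring K A"
  by (induction n) (auto intro: poly_ring_mult)

lemma toric_ideal_iff:
  "p \<in> toric_ideal K A \<longleftrightarrow>
    p \<in> poly_ring K A \<and> (\<forall>u. coeff_sum (\<lambda>e. if lat_deg e = u then 1 else 0) p = 0)"
  by (simp add: toric_ideal_def toric_image_coeff_eq)

lemma toric_ideal_is_ideal: "ideal_in (poly_ring K A) (toric_ideal K A)"
  unfolding ideal_in_def
proof (intro conjI ballI)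
  fix h f assume h: "h \<in> poly_ring K A" and f: "f \<in> toric_ideal K A"
  have "coeff_sum (\<lambda>e. if lat_deg e = u then 1 else 0) (h * f) = 0" for u
    unfolding coeff_sum_mult
    by (intro sum.neutral ballI mult_eq_0_iff[THEN iffD2] disjI2 toric_ideal_degree_sum[OF f])
       (simp add: lat_deg_add)
  moreover have "h * f \<in> poly_ring K A" using h f by (auto simp: toric_ideal_def intro: poly_ring_mult)
  ultimately show "h * f \<in> toric_ideal K A" by (simp add: toric_ideal_iff)
qed (auto simp: toric_ideal_iff coeff_sum_add intro: poly_ring_add)

lemma binomial_in_toric_ideal:
  fixes K :: "'k::field itself"
  assumes "keys e \<subseteq> A" "keys f \<subseteq> A" "lat_deg e = lat_deg f"
  shows "single e 1 - single f 1 \<in> toric_ideal K A"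
proof -
  have eq: "single e (1::'k) - single f 1 = single e 1 + single f (-1)"
    by (simp add: single_uminus)
  show ?thesis unfolding eq using assms by (simp add: toric_ideal_iff coeff_sum_add poly_ring_add)
qed

text \<open>The target is the Laurent polynomial ring with exponents ordered lexicographically, which the
  library knows to be an integral domain.\<close>

lemma toric_ideal_prime: "prime_ideal_in (poly_ring K A) (toric_ideal (K :: 'k::field itself) (A :: (int ^ 'n) set))"
proof -
  \<comment> \<open>Coordinates are numbered by naturals because the lexicographic order requires a
    linearly ordered index type.\<close>
  obtain idx :: "'n \<Rightarrow> nat" where idx: "inj idx"
    using finite_imp_inj_to_nat_seg[of "UNIV :: 'n set"] by auto
  define lx where "lx v = (\<Sum>i\<in>UNIV. single (idx i) (v $ i))" for v :: "int ^ 'n"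
  have l_add: "lx (u + v) = lx u + lx v" for u v by (simp add: lx_def single_add sum.distrib)
  have l_lookup: "lookup (lx v) (idx i) = v $ i" for v i
    using inj_eq[OF idx] by (simp add: lx_def lookup_sum lookup_single when_def sum.delta)
  have l_inj: "lx u = lx v \<longleftrightarrow> u = v" for u v
    using l_lookup by (metis vec_eq_iff)
  define im :: "('k, 'n) lpoly \<Rightarrow> ((nat \<Rightarrow>\<^sub>0 int) \<Rightarrow>\<^sub>0 'k)"
    where "im p = (\<Sum>e\<in>keys p. single (lx (lat_deg e)) (lookup p e))" for p
  have im_lookup: "lookup (im p) m = coeff_sum (\<lambda>e. if lx (lat_deg e) = m then 1 else 0) p" for p m
    unfolding im_def coeff_sum_def lookup_sum
    by (intro sum.cong) (auto simp: lookup_single when_def)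
  have im_0: "im p = 0 \<longleftrightarrow> (\<forall>u. coeff_sum (\<lambda>e. if lat_deg e = u then 1 else 0) p = 0)" for p
  proof
    assume *: "im p = 0"
    show "\<forall>u. coeff_sum (\<lambda>e. if lat_deg e = u then 1 else 0) p = 0"
    proof
      fix u
      have "lookup (im p) (lx u) = 0" using * by simp
      then show "coeff_sum (\<lambda>e. if lat_deg e = u then 1 else 0) p = 0" by (simp add: im_lookup l_inj)
    qed
  next
    assume *: "\<forall>u. coeff_sum (\<lambda>e. if lat_deg e = u then 1 else 0) p = 0"
    show "im p = 0"
    proof (rule poly_mapping_eqI)
      fix m
      show "lookup (im p) m = lookup 0 m"
      proof (cases "\<exists>u. m = lx u")
        case True
        then show ?thesis using * by (auto simp: im_lookup l_inj)
      next
        case False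
        then have "(\<lambda>e. if lx (lat_deg e) = m then 1 else 0) = (\<lambda>e. 0 :: 'k)" by (auto simp: fun_eq_iff)
        then show ?thesis by (simp add: im_lookup coeff_sum_def)
      qed
    qed
  qed
  have im_add: "im (p + q) = im p + im q" for p q
    by (rule poly_mapping_eqI) (simp add: im_lookup lookup_add coeff_sum_add)
  have im_sum: "im (sum f S) = (\<Sum>x\<in>S. im (f x))" for f :: "'n expo \<Rightarrow> _" and S
    by (induction S rule: infinite_finite_induct) (auto simp: im_add, auto simp: im_def)
  have im_single: "im (single e c) = single (lx (lat_deg e)) c" for e c
    by (simp add: im_def)
  have im_mult: "im (p * q) = im p * im q" for p q
    unfolding poly_mapping_mult_eq_sum[of p q] im_sum im_single
    by (simp add: im_def sum_product mult_single lat_deg_add l_add)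
  have "1 \<notin> toric_ideal K A"
  proof
    assume "1 \<in> toric_ideal K A"
    then have "coeff_sum (\<lambda>e :: 'n expo. if lat_deg e = 0 then 1 else 0 :: 'k) 1 = 0"
      unfolding toric_ideal_iff by blast
    then show False by (simp add: coeff_sum_def)
  qed
  moreover have "(1 :: ('k, 'n) lpoly) \<in> poly_ring K A" by simp
  ultimately have "toric_ideal K A \<noteq> poly_ring K A" by blast
  moreover have "x \<in> toric_ideal K A \<or> y \<in> toric_ideal K A"
    if "x \<in> poly_ring K A" "y \<in> poly_ring K A" "x * y \<in> toric_ideal K A" for x y
  proof -
    have "im x * im y = 0" using that(3) im_0[of "x * y"] by (simp add: toric_ideal_iff im_mult)
    then have "im x = 0 \<or> im y = 0" by simp
    then show ?thesis using that im_0 by (simp add: toric_ideal_iff)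
  qed
  ultimately show ?thesis unfolding prime_ideal_in_def using toric_ideal_is_ideal by blast
qed

lemma rat_of_lat_simps:
  "rat_of_lat (a + b) = rat_of_lat a + rat_of_lat b" "rat_of_lat (a - b) = rat_of_lat a - rat_of_lat b"
  "rat_of_lat (k *s a) = of_int k *s rat_of_lat a"
  "rat_of_lat 0 = 0" "rat_of_lat (- a) = - rat_of_lat a"
  by (simp_all add: rat_of_lat_def vec_eq_iff)

lemma rat_of_lat_inj: "rat_of_lat a = rat_of_lat b \<longleftrightarrow> a = b"
  by (simp add: rat_of_lat_def vec_eq_iff)

lemma inj_rat_of_lat: "inj_on rat_of_lat S"
  by (simp add: inj_on_def rat_of_lat_inj)

lemma rat_of_lat_sum: "rat_of_lat (\<Sum>i\<in>S. f i) = (\<Sum>i\<in>S. rat_of_lat (f i))"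
  by (induction S rule: infinite_finite_induct) (auto simp: rat_of_lat_simps)

lemma int_scale_diff: "(k - l) *s a = k *s a - l *s (a :: int ^ 'n)"
  by (simp add: vec_eq_iff left_diff_distrib)

section \<open>Height of the toric ideal by counting independent polynomials\<close>

definition monomial_on :: "'a set \<Rightarrow> ('a \<Rightarrow> nat) \<Rightarrow> ('a \<Rightarrow>\<^sub>0 nat)" where
  "monomial_on B g = (\<Sum>b\<in>B. single b (g b))"

lemma lookup_monomial_on:
  "finite B \<Longrightarrow> lookup (monomial_on B g) a = (if a \<in> B then g a else 0)"
  by (simp add: monomial_on_def lookup_sum lookup_single when_def)

lemma keys_monomial_on: "finite B \<Longrightarrow> keys (monomial_on B g) \<subseteq> B"
  by (auto simp: in_keys_iff lookup_monomial_on split: if_splits)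

lemma lat_deg_monomial_on: "finite B \<Longrightarrow> lat_deg (monomial_on B g) = (\<Sum>b\<in>B. int (g b) *s b)"
  using lat_deg_superset[OF _ keys_monomial_on, of B g] by (simp add: lookup_monomial_on)

text \<open>Linear independence over the coefficients of the residue classes of the family modulo
  \<open>P\<close>; scalars enter as constant polynomials.\<close>

definition indep_mod :: "('e::comm_monoid_add \<Rightarrow>\<^sub>0 'k::comm_ring_1) set \<Rightarrow> 's set \<Rightarrow> ('s \<Rightarrow> 'e \<Rightarrow>\<^sub>0 'k) \<Rightarrow> bool" where
  "indep_mod P S v \<longleftrightarrow> (\<forall>c. (\<Sum>s\<in>S. single 0 (c s) * v s) \<in> P \<longrightarrow> (\<forall>s\<in>S. c s = 0))"

text \<open>A bound on each single exponent rather than on the total degree, so that the admissible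
  monomials in \<open>A\<close> number \<open>(D + 1) ^ card A\<close>.\<close>

definition exp_bounded :: "nat \<Rightarrow> ('k::field, 'n) lpoly \<Rightarrow> bool" where
  "exp_bounded D p \<longleftrightarrow> (\<forall>e\<in>keys p. \<forall>a. lookup e a \<le> D)"

lemma exp_bounded_mult: "exp_bounded D p \<Longrightarrow> exp_bounded D' q \<Longrightarrow> exp_bounded (D + D') (p * q)"
  unfolding exp_bounded_def
proof (intro ballI allI)
  fix e a assume *: "\<forall>e\<in>keys p. \<forall>a. lookup e a \<le> D"
    "\<forall>e\<in>keys q. \<forall>a. lookup e a \<le> D'" "e \<in> keys (p * q)"
  obtain g f where "e = g + f" "g \<in> keys p" "f \<in> keys q"
    using *(3) keys_mult[of p q] by blast
  then show "lookup e a \<le> D + D'" using * by (simp add: lookup_add add_mono)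
qed

lemma exp_bounded_power: "exp_bounded D p \<Longrightarrow> exp_bounded (n * D) (p ^ n)"
proof (induction n)
  case 0
  then show ?case by (simp add: exp_bounded_def)
next
  case (Suc n)
  then show ?case using exp_bounded_mult[of D p "n * D" "p ^ n"] by simp
qed

lemma exp_bounded_mono: "exp_bounded D p \<Longrightarrow> D \<le> D' \<Longrightarrow> exp_bounded D' p"
  unfolding exp_bounded_def using order_trans by blast

lemma exp_bounded_exists: "\<exists>D. exp_bounded D p"
proof -
  let ?S = "\<Union>e\<in>keys p. lookup e ` keys e"
  have "lookup e a \<le> Max (insert 0 ?S)" if "e \<in> keys p" for e a
  proof (cases "a \<in> keys e")
    case True
    then show ?thesis using that by (intro Max_ge) auto
  next
    case False
    then show ?thesis by (simp add: in_keys_iff)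
  qed
  then show ?thesis unfolding exp_bounded_def by blast
qed

text \<open>The box of points with \<open>k\<close> coordinates below \<open>t\<close>. With lists,
  a further coordinate, the exponent of a new factor, is put in front.\<close>

definition index_lists :: "nat \<Rightarrow> nat \<Rightarrow> nat list set" where
  "index_lists k t = {xs. set xs \<subseteq> {..<t} \<and> length xs = k}"

lemma card_index_lists: "card (index_lists k t) = t ^ k"
  using card_lists_length_eq[of "{..<t}" k] by (simp add: index_lists_def)

lemma finite_index_lists [simp]: "finite (index_lists k t)"
  using finite_lists_length_eq[of "{..<t}" k] by (simp add: index_lists_def)

lemma sum_index_lists_Suc:
  "(\<Sum>xs\<in>index_lists (Suc k) t. f xs) = (\<Sum>l<t. \<Sum>xs\<in>index_lists k t. f (l # xs))"
proof -
  have eq: "index_lists (Suc k) t = (\<lambda>(l, xs). l # xs) ` ({..<t} \<times> index_lists k t)"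
    by (auto simp: index_lists_def length_Suc_conv image_iff)
  have "(\<Sum>xs\<in>index_lists (Suc k) t. f xs) = (\<Sum>(l, xs)\<in>{..<t} \<times> index_lists k t. f (l # xs))"
    unfolding eq by (subst sum.reindex) (auto simp: inj_on_def intro!: sum.cong)
  then show ?thesis by (simp add: sum.cartesian_product)
qed

lemma ideal_in_uminus: "ideal_in (poly_ring K A) J \<Longrightarrow> x \<in> J \<Longrightarrow> - x \<in> J"
proof -
  assume J: "ideal_in (poly_ring K A) J" "x \<in> J"
  have "(- 1) * x \<in> J" using J poly_ring_uminus[OF poly_ring_1] unfolding ideal_in_def by blast
  then show ?thesis by simp
qed

text \<open>The lowest power of \<open>f\<close> with a nonzero coefficient can be cancelled modulo \<open>P\<close>,
  and the remaining terms lie in \<open>Q\<close>.\<close>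

lemma indep_mod_step:
  fixes K :: "'k::field itself"
  assumes P: "prime_ideal_in (poly_ring K A) P" and Q: "prime_ideal_in (poly_ring K A) Q"
    and PQ: "P \<subseteq> Q" and f: "f \<in> Q" "f \<notin> P"
    and v: "\<And>xs. xs \<in> index_lists k t \<Longrightarrow> v xs \<in> poly_ring K A" and ind: "indep_mod Q (index_lists k t) v"
  shows "indep_mod P (index_lists (Suc k) t) (\<lambda>xs. f ^ hd xs * v (tl xs))"
  unfolding indep_mod_def
proof (intro allI impI)
  let ?R = "poly_ring K A"
  fix c :: "nat list \<Rightarrow> 'k"
  define T where "T l = (\<Sum>xs\<in>index_lists k t. single 0 (c (l # xs)) * v xs)" for l
  assume "(\<Sum>s\<in>index_lists (Suc k) t. single 0 (c s) * (f ^ hd s * v (tl s))) \<in> P"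
  then have sum: "(\<Sum>l<t. f ^ l * T l) \<in> P"
    by (simp add: sum_index_lists_Suc T_def sum_distrib_left mult.left_commute)
  have Pi: "ideal_in ?R P" and Qi: "ideal_in ?R Q" using P Q by (auto simp: prime_ideal_in_def)
  have fR: "f \<in> ?R" using f(1) Qi by (auto simp: ideal_in_def)
  have TR: "T l \<in> ?R" for l unfolding T_def using v by (intro poly_ring_sum poly_ring_mult poly_ring_single) auto
  have fpow: "f ^ l \<notin> P" for l
  proof (induction l)
    case 0
    show ?case
    proof
      assume "f ^ 0 \<in> P"
      then have "r \<in> P" if "r \<in> ?R" for r
        using Pi that unfolding ideal_in_def by (metis mult.right_neutral power_0)
      then show False using P unfolding prime_ideal_in_def ideal_in_def by blast
    qed
  next
    case (Suc l)
    then show ?case using P f(2) fR poly_ring_power[OF fR, of l] unfolding prime_ideal_in_def by auto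
  qed
  have zero: "\<forall>xs\<in>index_lists k t. c (l # xs) = 0" if "l < t" for l
    using that
  proof (induction l rule: less_induct)
    case (less l)
    \<comment> \<open>The terms beyond the power \<open>l\<close>, divided by
      \<open>f ^ Suc l\<close>. After cancelling \<open>f ^ l\<close> modulo the prime
      \<open>P\<close>, the sum is \<open>T l + f * W\<close>, and \<open>f * W\<close> lies in
      \<open>Q\<close>.\<close>
    define W where "W = (\<Sum>j\<in>{Suc l..<t}. f ^ (j - Suc l) * T j)"
    have WR: "W \<in> ?R" unfolding W_def by (intro poly_ring_sum poly_ring_mult poly_ring_power fR TR)
    have T0: "T j = 0" if "j < l" for j unfolding T_def using less that by (intro sum.neutral) auto
    have "(\<Sum>j<t. f ^ j * T j) = (\<Sum>j\<in>{l..<t}. f ^ j * T j)"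
      using T0 by (intro sum.mono_neutral_right) auto
    also have "\<dots> = f ^ l * T l + (\<Sum>j\<in>{Suc l..<t}. f ^ j * T j)"
      using less.prems by (simp add: sum.atLeast_Suc_lessThan)
    also have "(\<Sum>j\<in>{Suc l..<t}. f ^ j * T j) = f ^ l * (f * W)"
      unfolding W_def sum_distrib_left
    proof (intro sum.cong refl)
      fix j assume "j \<in> {Suc l..<t}"
      then have "j = l + Suc (j - Suc l)" by simp
      then have "f ^ j = f ^ l * (f * f ^ (j - Suc l))" by (metis power_add power_Suc)
      then show "f ^ j * T j = f ^ l * (f * (f ^ (j - Suc l) * T j))" by (simp add: mult.assoc)
    qed
    finally have "f ^ l * (T l + f * W) \<in> P" using sum by (simp add: distrib_left)
    moreover have "T l + f * W \<in> ?R" using TR WR fR by (intro poly_ring_add poly_ring_mult)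
    ultimately have "T l + f * W \<in> P" using P fpow[of l] poly_ring_power[OF fR, of l]
      unfolding prime_ideal_in_def by blast
    moreover have "f * W \<in> Q" using Qi f(1) WR unfolding ideal_in_def by (metis mult.commute)
    ultimately have "T l + f * W + - (f * W) \<in> Q"
      using Qi PQ ideal_in_uminus[OF Qi, of "f * W"] unfolding ideal_in_def by blast
    then have "T l \<in> Q" by simp
    then show ?case using ind[unfolded indep_mod_def, THEN spec, of "\<lambda>xs. c (l # xs)"] by (simp add: T_def)
  qed
  show "\<forall>s\<in>index_lists (Suc k) t. c s = 0"
  proof
    fix s assume "s \<in> index_lists (Suc k) t"
    then obtain l xs where "s = l # xs" "l < t" "xs \<in> index_lists k t"
      by (auto simp: index_lists_def length_Suc_conv)
    then show "c s = 0" using zero by simp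
  qed
qed

text \<open>The family lies in the space spanned by the monomials in \<open>A\<close> with exponents
  at most \<open>D\<close>. A larger family has a nontrivial relation with value 0, an element of
  \<open>J\<close>.\<close>

lemma indep_mod_card_bound:
  fixes v :: "'s \<Rightarrow> ('k::field, 'n::finite) lpoly"
  assumes A: "finite A" and S: "finite S" and ind: "indep_mod J S v" and J: "0 \<in> J"
    and v: "\<And>s. s \<in> S \<Longrightarrow> v s \<in> poly_ring K A \<and> exp_bounded D (v s)"
  shows "card S \<le> (D + 1) ^ card A"
proof -
  define E where "E = {e :: 'n expo. keys e \<subseteq> A \<and> (\<forall>a. lookup e a \<le> D)}"
  have inj: "inj_on (\<lambda>e. restrict (lookup e) A) E"
  proof (rule inj_onI, rule poly_mapping_eqI)
    fix e f a assume e: "e \<in> E" "f \<in> E" "restrict (lookup e) A = restrict (lookup f) A"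
    show "lookup e a = lookup f a"
    proof (cases "a \<in> A")
      case True
      then show ?thesis using fun_cong[OF e(3), of a] by simp
    next
      case False
      then have "a \<notin> keys e" "a \<notin> keys f" using e by (auto simp: E_def)
      then show ?thesis by (simp add: in_keys_iff)
    qed
  qed
  have sub: "(\<lambda>e. restrict (lookup e) A) ` E \<subseteq> (\<Pi>\<^sub>E a\<in>A. {..D})" by (auto simp: E_def)
  have finPi: "finite (\<Pi>\<^sub>E a\<in>A. {..D})" using A by (intro finite_PiE) auto
  have finE: "finite E" using inj_on_finite[OF inj sub finPi] .
  have cardE: "card E \<le> (D + 1) ^ card A"
    using card_inj_on_le[OF inj sub finPi] A by (simp add: card_PiE)
  show ?thesis
  proof (rule ccontr)
    assume "\<not> card S \<le> (D + 1) ^ card A"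
    then have "card E < card S" using cardE by simp
    then obtain c where c: "\<exists>s\<in>S. c s \<noteq> 0" "\<forall>e\<in>E. (\<Sum>s\<in>S. c s * lookup (v s) e) = 0"
      using homogeneous_system[OF finE S, of "\<lambda>s e. lookup (v s) e"] by blast
    have lk: "lookup (single 0 d * p) e = d * lookup p e" for d e and p :: "('k, 'n) lpoly"
    proof -
      have "single 0 d * p = Poly_Mapping.map ((*) d) p" by (simp add: mult_map_scale_conv_mult)
      then show ?thesis by (simp add: Poly_Mapping.map.rep_eq when_def)
    qed
    have "(\<Sum>s\<in>S. single 0 (c s) * v s) = 0"
    proof (rule poly_mapping_eqI)
      fix e
      have "(\<Sum>s\<in>S. c s * lookup (v s) e) = 0"
      proof (cases "e \<in> E")
        case False
        have "lookup (v s) e = 0" if "s \<in> S" for s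
        proof (rule ccontr)
          assume "lookup (v s) e \<noteq> 0"
          then have "e \<in> keys (v s)" by (simp add: in_keys_iff)
          then have "e \<in> E" using v[OF that] by (auto simp: E_def poly_ring_def exp_bounded_def)
          then show False using False by simp
        qed
        then show ?thesis by simp
      qed (use c in blast)
      then show "lookup (\<Sum>s\<in>S. single 0 (c s) * v s) e = lookup 0 e"
        by (simp add: lookup_sum lk)
    qed
    then have "\<forall>s\<in>S. c s = 0" using ind J unfolding indep_mod_def by auto
    then show False using c(1) by blast
  qed
qed

text \<open>Monomials in the variables of a basis \<open>B\<close> chosen among the points have
  pairwise distinct degrees, hence are independent modulo the toric ideal; \<open>t ^ card B\<close>
  of them have all exponents below \<open>t\<close>.\<close>

lemma indep_mod_toric_base:
  fixes K :: "'k::field itself" and A :: "(int ^ 'n) set"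
  assumes A: "finite A"
  shows "\<exists>v. (\<forall>xs\<in>index_lists (vec.dim (rat_of_lat ` A)) t. v xs \<in> poly_ring K A \<and> exp_bounded t (v xs)) \<and>
    indep_mod (toric_ideal K A) (index_lists (vec.dim (rat_of_lat ` A)) t) v"
proof -
  let ?d = "vec.dim (rat_of_lat ` A)"
  obtain B' where B': "B' \<subseteq> rat_of_lat ` A" "vec.independent B'" "card B' = ?d"
    using vec.basis_exists[of "rat_of_lat ` A"] by metis
  define B where "B = {a\<in>A. rat_of_lat a \<in> B'}"
  have B: "rat_of_lat ` B = B'" "B \<subseteq> A" "finite B" using B' A by (auto simp: B_def)
  have cardB: "card B = ?d" using card_image[OF inj_rat_of_lat, of B] B B' by simp
  let ?m = "monomial_on B"
  note lk = lookup_monomial_on[OF B(3)] and keys = keys_monomial_on[OF B(3)] and deg = lat_deg_monomial_on[OF B(3)]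
  have deg_inj: "g b = h b" if "lat_deg (?m g) = lat_deg (?m h)" "b \<in> B" for g h b
  proof -
    let ?q = "\<lambda>b. of_int (int (g b) - int (h b)) :: rat"
    have "(\<Sum>b\<in>B. (int (g b) - int (h b)) *s b) = 0"
      using that(1) by (simp add: deg int_scale_diff sum_subtractf)
    then have "rat_of_lat (\<Sum>b\<in>B. (int (g b) - int (h b)) *s b) = 0" by (simp add: rat_of_lat_simps)
    then have "(\<Sum>b\<in>B. ?q b *s rat_of_lat b) = 0" by (simp add: rat_of_lat_sum rat_of_lat_simps)
    then have "(\<Sum>w\<in>B'. ?q (inv_into B rat_of_lat w) *s w) = 0"
      unfolding B(1)[symmetric] by (subst sum.reindex[OF inj_rat_of_lat]) (simp add: inv_into_f_f[OF inj_rat_of_lat])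
    then have "?q (inv_into B rat_of_lat (rat_of_lat b)) = 0"
      using vec.independentD[OF B'(2) _ order_refl, of "\<lambda>w. ?q (inv_into B rat_of_lat w)" "rat_of_lat b"]
        B that(2) by blast
    then show ?thesis using that(2) by (simp add: inv_into_f_f[OF inj_rat_of_lat])
  qed
  let ?G = "\<Pi>\<^sub>E b\<in>B. {..<t}"
  have "finite ?G" "card ?G = card (index_lists ?d t)"
    using B(3) cardB by (auto simp: card_PiE card_index_lists intro: finite_PiE)
  then obtain h where h: "bij_betw h (index_lists ?d t) ?G"
    by (metis finite_index_lists finite_same_card_bij)
  define v :: "nat list \<Rightarrow> ('k, 'n) lpoly" where "v xs = single (?m (h xs)) 1" for xs
  have hG: "h xs \<in> ?G" if "xs \<in> index_lists ?d t" for xs using h that by (auto simp: bij_betw_def)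
  have 1: "v xs \<in> poly_ring K A \<and> exp_bounded t (v xs)" if "xs \<in> index_lists ?d t" for xs
  proof -
    have "lookup (?m (h xs)) a \<le> t" for a
      using hG[OF that] by (force simp: lk PiE_iff)
    moreover have "keys (?m (h xs)) \<subseteq> A" using keys B(2) by blast
    ultimately show ?thesis by (auto simp: v_def exp_bounded_def)
  qed
  have "indep_mod (toric_ideal K A) (index_lists ?d t) v"
    unfolding indep_mod_def
  proof (intro allI impI ballI)
    fix c xs assume *: "(\<Sum>s\<in>index_lists ?d t. single 0 (c s) * v s) \<in> toric_ideal K A"
      and xs: "xs \<in> index_lists ?d t"
    let ?u = "lat_deg (?m (h xs))"
    have inj: "lat_deg (?m (h s)) = ?u \<longleftrightarrow> s = xs" if "s \<in> index_lists ?d t" for s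
    proof
      assume "lat_deg (?m (h s)) = ?u"
      then have "\<And>b. b \<in> B \<Longrightarrow> h s b = h xs b" by (rule deg_inj)
      then have "h s = h xs" using hG[OF that] hG[OF xs] by (intro PiE_ext[of _ B "\<lambda>_. {..<t}"]) auto
      then show "s = xs" using h that xs by (auto simp: bij_betw_def inj_on_def)
    qed simp
    have "0 = coeff_sum (\<lambda>e. if lat_deg e = ?u then 1 else 0) (\<Sum>s\<in>index_lists ?d t. single 0 (c s) * v s)"
      using * by (simp add: toric_ideal_iff)
    also have "\<dots> = (\<Sum>s\<in>index_lists ?d t. if s = xs then c s else 0)"
      unfolding coeff_sum_sum using inj by (intro sum.cong) (auto simp: v_def mult_single)
    also have "\<dots> = c xs" using xs by simp
    finally show "c xs = 0" by simp
  qed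
  then show ?thesis using 1 by blast
qed

text \<open>Otherwise \<open>t = C ^ m + 1\<close> is a counterexample: already
  \<open>t ^ Suc m\<close> exceeds \<open>(C * t) ^ m\<close>.\<close>

lemma exponential_gap:
  fixes a m C :: nat
  assumes "\<And>t. t \<ge> 1 \<Longrightarrow> t ^ a \<le> (C * t) ^ m"
  shows "a \<le> m"
proof (rule ccontr)
  assume "\<not> a \<le> m"
  then have am: "a = m + Suc (a - Suc m)" by simp
  define t where "t = C ^ m + 1"
  have t1: "t \<ge> 1" by (simp add: t_def)
  have "t ^ m * t \<le> t ^ m * (t * t ^ (a - Suc m))" using t1 by simp
  also have "\<dots> = t ^ a" by (subst am) (simp add: power_add)
  also have "\<dots> \<le> (C * t) ^ m" by (rule assms[OF t1])
  also have "\<dots> = t ^ m * C ^ m" by (simp add: power_mult_distrib)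
  finally have "t \<le> C ^ m" using t1 by simp
  then show False by (simp add: t_def)
qed

text \<open>Otherwise the products of powers of elements \<open>f\<^sub>i \<in> c (i + 1) - c i\<close> with the monomials in a maximal
  independent set of variables give too many linearly independent polynomials of bounded degree.\<close>

lemma toric_chain_length:
  fixes K :: "'k::field itself" and A :: "(int ^ 'n) set"
  assumes A: "finite A" and prime: "\<And>i. i \<le> n \<Longrightarrow> prime_ideal_in (poly_ring K A) (c i)"
    and strict: "\<And>i. i < n \<Longrightarrow> c i \<subset> c (Suc i)" and last: "c n = toric_ideal K A"
  shows "n + vec.dim (rat_of_lat ` A) \<le> card A"
proof -
  let ?d = "vec.dim (rat_of_lat ` A)" and ?R = "poly_ring K A"
  \<comment> \<open>The chain is descended from the toric ideal: each step adds one coordinate to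
    the index lists, and \<open>D\<close> does not depend on \<open>t\<close>, so the exponents stay
    linear in \<open>t\<close>.\<close>
  have "\<exists>D. \<forall>t\<ge>1. \<exists>v. (\<forall>xs\<in>index_lists (j + ?d) t. v xs \<in> ?R \<and> exp_bounded (D * t) (v xs)) \<and>
      indep_mod (c (n - j)) (index_lists (j + ?d) t) v" if "j \<le> n" for j
    using that
  proof (induction j)
    case 0
    show ?case using indep_mod_toric_base[OF A, of _ K] by (intro exI[of _ 1]) (simp add: last)
  next
    case (Suc j)
    then obtain D where D: "\<And>t. t \<ge> 1 \<Longrightarrow> \<exists>v. (\<forall>xs\<in>index_lists (j + ?d) t. v xs \<in> ?R \<and> exp_bounded (D * t) (v xs)) \<and>
      indep_mod (c (n - j)) (index_lists (j + ?d) t) v" by auto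
    define i where "i = n - Suc j"
    have i: "i < n" "Suc i = n - j" using Suc.prems by (auto simp: i_def)
    obtain f where f: "f \<in> c (n - j)" "f \<notin> c i" using strict[OF i(1)] i(2) by auto
    have prs: "prime_ideal_in ?R (c i)" "prime_ideal_in ?R (c (n - j))" using prime i by auto
    have fR: "f \<in> ?R" using f(1) prs(2) by (auto simp: prime_ideal_in_def ideal_in_def)
    obtain D' where D': "exp_bounded D' f" using exp_bounded_exists by blast
    show ?case
    proof (intro exI[of _ "D' + D"] allI impI)
      fix t :: nat assume "t \<ge> 1"
      then obtain v where v: "\<And>xs. xs \<in> index_lists (j + ?d) t \<Longrightarrow> v xs \<in> ?R \<and> exp_bounded (D * t) (v xs)"
        "indep_mod (c (n - j)) (index_lists (j + ?d) t) v" using D by blast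
      let ?v = "\<lambda>xs. f ^ hd xs * v (tl xs)"
      have ind': "indep_mod (c i) (index_lists (Suc (j + ?d)) t) ?v"
        using strict[OF i(1)] i(2) f v by (intro indep_mod_step[OF prs]) auto
      have bd: "?v xs \<in> ?R \<and> exp_bounded ((D' + D) * t) (?v xs)" if xs: "xs \<in> index_lists (Suc (j + ?d)) t" for xs
      proof -
        obtain l ys where l: "xs = l # ys" "l < t" "ys \<in> index_lists (j + ?d) t"
          using xs by (auto simp: index_lists_def length_Suc_conv)
        have "exp_bounded (t * D') (f ^ l)"
          by (rule exp_bounded_mono[OF exp_bounded_power[OF D']]) (use l in simp)
        then have "exp_bounded (t * D' + D * t) (f ^ l * v ys)" using v(1)[OF l(3)] by (intro exp_bounded_mult) auto
        moreover have "f ^ l * v ys \<in> ?R" using v(1)[OF l(3)] fR by (intro poly_ring_mult poly_ring_power) auto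
        moreover have "t * D' + D * t = (D' + D) * t" by (simp add: algebra_simps)
        ultimately show ?thesis using l(1) by simp
      qed
      show "\<exists>v. (\<forall>xs\<in>index_lists (Suc j + ?d) t. v xs \<in> ?R \<and> exp_bounded ((D' + D) * t) (v xs)) \<and>
        indep_mod (c (n - Suc j)) (index_lists (Suc j + ?d) t) v" 
        unfolding i_def[symmetric] add_Suc by (intro exI[of _ ?v] conjI ballI bd ind')
    qed
  qed
  from this[of n] obtain D where D: "\<And>t. t \<ge> 1 \<Longrightarrow> \<exists>v. (\<forall>xs\<in>index_lists (n + ?d) t. v xs \<in> ?R \<and> exp_bounded (D * t) (v xs)) \<and>
      indep_mod (c 0) (index_lists (n + ?d) t) v" by auto
  have z: "0 \<in> c 0" using prime[of 0] by (auto simp: prime_ideal_in_def ideal_in_def)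
  show ?thesis
  proof (rule exponential_gap[of _ "D + 1"])
    fix t :: nat assume t: "t \<ge> 1"
    then obtain v where v: "\<forall>xs\<in>index_lists (n + ?d) t. v xs \<in> ?R \<and> exp_bounded (D * t) (v xs)"
      "indep_mod (c 0) (index_lists (n + ?d) t) v" using D by blast
    have "card (index_lists (n + ?d) t) \<le> (D * t + 1) ^ card A"
      by (rule indep_mod_card_bound[OF A finite_index_lists v(2) z, of K]) (use v(1) in blast)
    then have "t ^ (n + ?d) \<le> (D * t + 1) ^ card A" by (simp only: card_index_lists)
    also have "\<dots> \<le> ((D + 1) * t) ^ card A" using t by (intro power_mono) auto
    finally show "t ^ (n + ?d) \<le> ((D + 1) * t) ^ card A" .
  qed
qed

text \<open>The toric ideal is prime, so it occurs itself in the infimum defining the height. The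
  upper bound is what limits the number of generators of a complete intersection.\<close>

lemma toric_ideal_height:
  fixes K :: "'k::field itself" and A :: "(int ^ 'n) set"
  assumes "finite A"
  shows "ideal_height (poly_ring K A) (toric_ideal K A) \<le> enat (card A - vec.dim (rat_of_lat ` A))"
proof -
  have "ideal_height (poly_ring K A) (toric_ideal K A) \<le> prime_height (poly_ring K A) (toric_ideal K A)"
    unfolding ideal_height_def using toric_ideal_prime by (intro INF_lower) auto
  also have "\<dots> \<le> enat (card A - vec.dim (rat_of_lat ` A))"
    unfolding prime_height_def
  proof (rule SUP_least)
    fix n assume "n \<in> {n. \<exists>c. (\<forall>i\<le>n. prime_ideal_in (poly_ring K A) (c i)) \<and>
        (\<forall>i<n. c i \<subset> c (Suc i)) \<and> c n = toric_ideal K A}"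
    then obtain c where "\<forall>i\<le>n. prime_ideal_in (poly_ring K A) (c i)" "\<forall>i<n. c i \<subset> c (Suc i)" "c n = toric_ideal K A"
      by blast
    then have "n + vec.dim (rat_of_lat ` A) \<le> card A" using toric_chain_length[OF assms, of n K c] by blast
    then show "enat n \<le> enat (card A - vec.dim (rat_of_lat ` A))" by simp
  qed
  finally show ?thesis .
qed

section \<open>Dickson's lemma and finite generation\<close>

lemma nat_incseq_subseq:
  fixes g :: "nat \<Rightarrow> nat"
  shows "\<exists>r. strict_mono r \<and> incseq (\<lambda>n. g (r n))"
proof -
  obtain s where s: "strict_mono s" "monoseq (\<lambda>n. g (s n))" using seq_monosub[of g] by blast
  show ?thesis
  proof (cases "incseq (\<lambda>n. g (s n))")
    case False
    then have dec: "decseq (\<lambda>n. g (s n))" using s(2) by (auto simp: monoseq_iff)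
    obtain N where N: "\<And>n. g (s N) \<le> g (s n)" using ex_has_least_nat[of "\<lambda>_. True" _ "\<lambda>n. g (s n)"] by blast
    have "g (s (n + N)) = g (s N)" for n using N[of "n + N"] decseqD[OF dec, of N "n + N"] by simp
    then have "incseq (\<lambda>n. g (s (n + N)))" by (simp add: incseq_def)
    moreover have "strict_mono (\<lambda>n. s (n + N))" using s(1) by (auto simp: strict_mono_def)
    ultimately show ?thesis by blast
  qed (use s in blast)
qed

lemma incseq_subseq:
  fixes f :: "nat \<Rightarrow> 'a \<Rightarrow> nat"
  assumes "finite A"
  shows "\<exists>r. strict_mono r \<and> (\<forall>a\<in>A. incseq (\<lambda>n. f (r n) a))"
  using assms
proof (induction A)
  case empty
  then show ?case by (auto intro: exI[of _ id] simp: strict_mono_def)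
next
  case (insert a A)
  then obtain r where r: "strict_mono r" "\<forall>a\<in>A. incseq (\<lambda>n. f (r n) a)" by blast
  obtain s where s: "strict_mono s" "incseq (\<lambda>n. f (r (s n)) a)" using nat_incseq_subseq[of "\<lambda>n. f (r n) a"] by blast
  have "incseq (\<lambda>n. f (r (s n)) b)" if "b \<in> A" for b
    using r(2) that strict_mono_mono[OF s(1)] unfolding incseq_def mono_def by blast
  moreover have "strict_mono (\<lambda>n. r (s n))" using r(1) s(1) by (auto simp: strict_mono_def)
  ultimately show ?case using s(2) by (intro exI[of _ "\<lambda>n. r (s n)"]) auto
qed

lemma dickson:
  fixes f :: "nat \<Rightarrow> 'a \<Rightarrow> nat"
  assumes "finite A"
  obtains i j where "i < j" "\<And>a. a \<in> A \<Longrightarrow> f i a \<le> f j a"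
proof -
  obtain r where r: "strict_mono r" "\<forall>a\<in>A. incseq (\<lambda>n. f (r n) a)" using incseq_subseq[OF assms] by blast
  show thesis
  proof (rule that[of "r 0" "r 1"])
    show "r 0 < r 1" using r(1) by (simp add: strict_mono_def)
    show "f (r 0) a \<le> f (r 1) a" if "a \<in> A" for a using r(2) that unfolding incseq_def by blast
  qed
qed

lemma generated_ideal_in_base: "finite G \<Longrightarrow> g \<in> G \<Longrightarrow> g \<in> generated_ideal_in (poly_ring K A) G"
  unfolding generated_ideal_in_def
proof (intro CollectI exI[of _ "\<lambda>x. if x = g then 1 else 0"] conjI ballI)
  assume G: "finite G" "g \<in> G"
  have "(\<Sum>x\<in>G. (if x = g then 1 else 0) * x) = (\<Sum>x\<in>G. if x = g then x else 0)"
    by (intro sum.cong) auto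
  then show "g = (\<Sum>x\<in>G. (if x = g then 1 else 0) * x)" using G by simp
qed auto

lemma generated_ideal_in_ideal:
  assumes "G \<subseteq> poly_ring K A"
  shows "ideal_in (poly_ring K A) (generated_ideal_in (poly_ring K A) G)"
  unfolding ideal_in_def
proof (intro conjI ballI)
  let ?R = "poly_ring K A"
  show "generated_ideal_in ?R G \<subseteq> ?R"
    using assms by (auto simp: generated_ideal_in_def intro!: poly_ring_sum poly_ring_mult)
  show "0 \<in> generated_ideal_in ?R G" unfolding generated_ideal_in_def
    by (intro CollectI exI[of _ "\<lambda>_. 0"]) auto
  fix x assume "x \<in> generated_ideal_in ?R G"
  then obtain h where h: "x = (\<Sum>g\<in>G. h g * g)" "\<forall>g\<in>G. h g \<in> ?R" by (auto simp: generated_ideal_in_def)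
  { fix y assume "y \<in> generated_ideal_in ?R G"
    then obtain k where k: "y = (\<Sum>g\<in>G. k g * g)" "\<forall>g\<in>G. k g \<in> ?R" by (auto simp: generated_ideal_in_def)
    show "x + y \<in> generated_ideal_in ?R G" unfolding generated_ideal_in_def using h k
      by (intro CollectI exI[of _ "\<lambda>g. h g + k g"]) (auto simp: distrib_right sum.distrib intro: poly_ring_add) }
  fix r assume "r \<in> ?R"
  then show "r * x \<in> generated_ideal_in ?R G" unfolding generated_ideal_in_def using h
    by (intro CollectI exI[of _ "\<lambda>g. r * h g"]) (auto simp: sum_distrib_left mult.assoc intro: poly_ring_mult)
qed

lemma ideal_in_sum:
  assumes "ideal_in R J" "\<And>i. i \<in> S \<Longrightarrow> f i \<in> J"
  shows "(\<Sum>i\<in>S. f i) \<in> J"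
  using assms(2) by (induction S rule: infinite_finite_induct) (use assms(1) in \<open>auto simp: ideal_in_def\<close>)

lemma generated_ideal_in_minimal:
  assumes "ideal_in R J" "G \<subseteq> J" shows "generated_ideal_in R G \<subseteq> J"
  using assms unfolding generated_ideal_in_def
  by (auto intro!: ideal_in_sum[OF assms(1)]) (auto simp: ideal_in_def)

text \<open>Replacing each monomial of \<open>p\<close> by a chosen monomial of \<open>p\<close> of
  the same degree gives 0; subtracting this zero writes \<open>p\<close> as a combination of
  binomials.\<close>

lemma toric_ideal_spanned_by_binomials:
  fixes K :: "'k::field itself"
  assumes J: "ideal_in (poly_ring K A) J"
    and bin: "\<And>e f. keys e \<subseteq> A \<Longrightarrow> keys f \<subseteq> A \<Longrightarrow> lat_deg e = lat_deg f \<Longrightarrow>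
      single e 1 - single f 1 \<in> J"
  shows "toric_ideal K A \<subseteq> J"
proof
  fix p assume p: "p \<in> toric_ideal K A"
  let ?k = "keys p"
  have keys: "keys e \<subseteq> A" if "e \<in> ?k" for e
    using p that by (auto simp: toric_ideal_def poly_ring_def)
  define r where "r u = (SOME e. e \<in> ?k \<and> lat_deg e = u)" for u
  have r: "r (lat_deg e) \<in> ?k" "lat_deg (r (lat_deg e)) = lat_deg e" if "e \<in> ?k" for e
    using someI[of "\<lambda>x. x \<in> ?k \<and> lat_deg x = lat_deg e" e] that unfolding r_def by auto
  have zero: "(\<Sum>e\<in>?k. single (r (lat_deg e)) (lookup p e)) = 0"
  proof (rule poly_mapping_eqI)
    fix m
    have "lookup (\<Sum>e\<in>?k. single (r (lat_deg e)) (lookup p e)) m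
        = coeff_sum (\<lambda>e. if r (lat_deg e) = m then 1 else 0) p"
      unfolding coeff_sum_def lookup_sum by (intro sum.cong) (auto simp: lookup_single when_def)
    also have "\<dots> = 0" by (intro toric_ideal_degree_sum[OF p]) simp
    finally show "lookup (\<Sum>e\<in>?k. single (r (lat_deg e)) (lookup p e)) m
        = lookup 0 m" by simp
  qed
  have "p = (\<Sum>e\<in>?k. single e (lookup p e)) -
      (\<Sum>e\<in>?k. single (r (lat_deg e)) (lookup p e))"
    unfolding zero using poly_mapping_sum_single[of p] by simp
  also have "\<dots> = (\<Sum>e\<in>?k. single 0 (lookup p e) *
      (single e 1 - single (r (lat_deg e)) 1))"
    unfolding sum_subtractf[symmetric] by (intro sum.cong) (auto simp: right_diff_distrib mult_single)
  also have "\<dots> \<in> J"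
  proof (rule ideal_in_sum[OF J])
    fix e assume e: "e \<in> ?k"
    have "single e 1 - single (r (lat_deg e)) 1 \<in> J"
      using r[OF e] keys e by (intro bin) auto
    moreover have "single 0 (lookup p e) \<in> poly_ring K A" by simp
    ultimately show "single 0 (lookup p e) *
      (single e 1 - single (r (lat_deg e)) 1) \<in> J"
      using J unfolding ideal_in_def by blast
  qed
  finally show "p \<in> J" .
qed

text \<open>The pairs of exponents of equal degree form a monoid that is closed under differences, so its
  minimal nonzero elements, finitely many by Dickson's lemma, generate it.\<close>

lemma toric_ideal_finitely_generated:
  fixes K :: "'k::field itself" and A :: "(int ^ 'n) set"
  assumes A: "finite A"
  shows "\<exists>G. finite G \<and> G \<subseteq> poly_ring K A \<and> generated_ideal_in (poly_ring K A) G = toric_ideal K A"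
proof -
  define S where "S = {(e, f). keys e \<subseteq> A \<and> keys f \<subseteq> A \<and> lat_deg e = lat_deg f \<and> (e, f) \<noteq> (0, 0)}"
  define le where "le x y \<longleftrightarrow> (\<forall>a. lookup (fst x) a \<le> lookup (fst y) a \<and> lookup (snd x) a \<le> lookup (snd y) a)"
    for x y :: "'n expo \<times> 'n expo"
  define M where "M = {x\<in>S. \<forall>y\<in>S. le y x \<longrightarrow> y = x}"
  have "finite M"
  proof (rule ccontr)
    assume "infinite M"
    then obtain s :: "nat \<Rightarrow> _" where s: "inj s" "range s \<subseteq> M" using infinite_countable_subset by blast
    define f where "f n b = (case b of Inl a \<Rightarrow> lookup (fst (s n)) a | Inr a \<Rightarrow> lookup (snd (s n)) a)" for n b
    have "finite (A <+> A)" using A by simp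
    then obtain i j where ij: "i < j" "\<And>b. b \<in> A <+> A \<Longrightarrow> f i b \<le> f j b" by (rule dickson[where f = f]) (rule that)
    have sM: "s n \<in> M" for n using s(2) by auto
    have "lookup (fst (s i)) a \<le> lookup (fst (s j)) a \<and> lookup (snd (s i)) a \<le> lookup (snd (s j)) a" for a
    proof (cases "a \<in> A")
      case True
      then show ?thesis using ij(2)[OF InlI[OF True]] ij(2)[OF InrI[OF True]] by (simp add: f_def)
    next
      case False
      then have "a \<notin> keys (fst (s i))" "a \<notin> keys (snd (s i))" using sM[of i] by (auto simp: M_def S_def)
      then show ?thesis by (simp add: in_keys_iff)
    qed
    then have "le (s i) (s j)" by (simp add: le_def)
    then have "s i = s j" using sM[of i] sM[of j] by (auto simp: M_def)
    then show False using s(1) ij(1) by (auto dest: injD)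
  qed
  define G where "G = (\<lambda>(e, f). single e 1 - single f (1::'k)) ` M"
  have finG: "finite G" using \<open>finite M\<close> by (simp add: G_def)
  have GI: "G \<subseteq> toric_ideal K A" unfolding G_def M_def S_def by (auto intro!: binomial_in_toric_ideal)
  have GR: "G \<subseteq> poly_ring K A" using GI by (auto simp: toric_ideal_def)
  let ?J = "generated_ideal_in (poly_ring K A) G"
  have J: "ideal_in (poly_ring K A) ?J" using GR by (rule generated_ideal_in_ideal)
  define size where "size x = (\<Sum>a\<in>A. lookup (fst x) a + lookup (snd x) a)"
    for x :: "'n expo \<times> 'n expo"
  have size_pos: "size x > 0" if "x \<in> S" for x
  proof (rule ccontr)
    assume "\<not> size x > 0"
    then have z: "lookup (fst x) a = 0 \<and> lookup (snd x) a = 0" if "a \<in> A" for a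
      using A that by (auto simp: size_def)
    have "fst x = 0" "snd x = 0"
      by (rule poly_mapping_eqI; use z \<open>x \<in> S\<close> in \<open>auto simp: S_def in_keys_iff\<close>)+
    then show False using \<open>x \<in> S\<close> by (cases x) (auto simp: S_def)
  qed
  have inJ: "single (fst x) 1 - single (snd x) 1 \<in> ?J" if "x \<in> S" for x
    using that
  proof (induction "size x" arbitrary: x rule: less_induct)
    case less
    show ?case
    proof (cases "x \<in> M")
      case True
      then have "single (fst x) 1 - single (snd x) 1 \<in> G"
        unfolding G_def by (intro image_eqI[of _ _ x]) (auto simp: case_prod_beta)
      then show ?thesis using finG by (intro generated_ideal_in_base)
    next
      case False
      then obtain y where y: "y \<in> S" "le y x" "y \<noteq> x" using less.prems by (auto simp: M_def)
      \<comment> \<open>A nonminimal pair \<open>x\<close> is the sum of the strictly smaller pairs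
        \<open>y\<close> and \<open>z\<close>, and its binomial is a combination of theirs.\<close>
      define z where "z = (fst x - fst y, snd x - snd y)"
      have x: "fst x = fst y + fst z" "snd x = snd y + snd z"
        using y(2) by (auto intro!: poly_mapping_eqI simp: z_def le_def lookup_add lookup_minus)
      have zS: "z \<in> S"
      proof -
        have "keys (fst z) \<subseteq> keys (fst x)" "keys (snd z) \<subseteq> keys (snd x)"
          by (auto simp: z_def in_keys_iff lookup_minus)
        moreover have "lat_deg (fst z) = lat_deg (snd z)"
        proof -
          have "lat_deg (fst y) + lat_deg (fst z) = lat_deg (snd y) + lat_deg (snd z)"
          proof -
            have "lat_deg (fst x) = lat_deg (snd x)" using less.prems by (auto simp: S_def)
            then show ?thesis by (simp only: x lat_deg_add)
          qed
          then show ?thesis using y(1) by (auto simp: S_def)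
        qed
        moreover have "z \<noteq> (0, 0)" using x y(3) by (auto simp: prod_eq_iff)
        moreover have "keys (fst x) \<subseteq> A" "keys (snd x) \<subseteq> A" using less.prems by (auto simp: S_def)
        ultimately show ?thesis unfolding S_def by (simp add: case_prod_beta) (metis order_trans prod.collapse)
      qed
      have sz: "size x = size y + size z" by (simp add: size_def x lookup_add sum.distrib)
      have IH: "single (fst y) 1 - single (snd y) 1 \<in> ?J"
        "single (fst z) 1 - single (snd z) 1 \<in> ?J"
        using less.hyps sz size_pos[OF y(1)] size_pos[OF zS] y(1) zS by auto
      have R: "single (fst z) (1::'k) \<in> poly_ring K A" "single (snd y) (1::'k) \<in> poly_ring K A"
        using zS y(1) by (auto simp: S_def)
      have "single (fst z) 1 * (single (fst y) 1 - single (snd y) 1) +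
        single (snd y) 1 * (single (fst z) 1 - single (snd z) 1) \<in> ?J"
        using IH R J unfolding ideal_in_def by blast
      moreover have "single (fst x) (1::'k) - single (snd x) 1 =
        single (fst z) 1 * (single (fst y) 1 - single (snd y) 1) +
        single (snd y) 1 * (single (fst z) 1 - single (snd z) 1)"
        by (simp add: x right_diff_distrib mult_single add.commute)
      ultimately show ?thesis by simp
    qed
  qed
  have "toric_ideal K A \<subseteq> ?J"
  proof (rule toric_ideal_spanned_by_binomials[OF J])
    fix e f :: "'n expo"
    assume ef: "keys e \<subseteq> A" "keys f \<subseteq> A" "lat_deg e = lat_deg f"
    show "single e 1 - single f 1 \<in> ?J"
    proof (cases "(e, f) = (0, 0)")
      case True
      then show ?thesis using J by (simp add: ideal_in_def)
    next
      case False
      then have "(e, f) \<in> S" using ef by (simp add: S_def)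
      then show ?thesis using inJ[of "(e, f)"] by simp
    qed
  qed
  moreover have "?J \<subseteq> toric_ideal K A" using toric_ideal_is_ideal GI by (rule generated_ideal_in_minimal)
  ultimately show ?thesis using finG GR by blast
qed

text \<open>Finite generation makes the \<open>LEAST\<close> in \<open>min_num_gens\<close>
  attained; the height bound limits its value.\<close>

lemma complete_intersection_generators:
  fixes K :: "'k::field itself" and A :: "(int ^ 'n) set"
  assumes A: "finite A" and ci: "complete_intersection_ideal (poly_ring K A) (toric_ideal K A)"
  obtains G where "finite G" "generated_ideal_in (poly_ring K A) G = toric_ideal K A"
    "card G + vec.dim (rat_of_lat ` A) \<le> card A"
proof -
  let ?P = "\<lambda>n. \<exists>G. finite G \<and> card G = n \<and> G \<subseteq> poly_ring K A \<and> generated_ideal_in (poly_ring K A) G = toric_ideal K A"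
  have "\<exists>n. ?P n" using toric_ideal_finitely_generated[OF A, of K] by blast
  then have "?P (min_num_gens (poly_ring K A) (toric_ideal K A))"
    unfolding min_num_gens_def by (rule LeastI_ex)
  moreover have "min_num_gens (poly_ring K A) (toric_ideal K A) \<le> card A - vec.dim (rat_of_lat ` A)"
    using ci toric_ideal_height[OF A, of K] unfolding complete_intersection_ideal_def by (metis enat_ord_simps(1))
  moreover have "vec.dim (rat_of_lat ` A) \<le> card A"
    using vec.dim_le_card'[of "rat_of_lat ` A"] card_image_le[OF A, of rat_of_lat] A by simp
  ultimately show thesis using that by fastforce
qed

text \<open>Each \<open>\<phi> j\<close> annihilates \<open>\<mm> \<cdot> I\<close> for the augmentation ideal \<open>\<mm>\<close> with augmentation \<open>\<eta>\<close>, so the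
  \<open>\<phi> j\<close> are independent functionals on \<open>I / (\<mm> \<cdot> I)\<close>.\<close>

lemma generators_lower_bound:
  fixes \<phi> :: "'j \<Rightarrow> 'e::comm_monoid_add \<Rightarrow> 'k::field"
  assumes G: "finite G" and J: "finite J"
    and mult: "\<And>j h g. j \<in> J \<Longrightarrow> h \<in> R \<Longrightarrow> g \<in> G \<Longrightarrow> coeff_sum (\<phi> j) (h * g) = \<eta> h * coeff_sum (\<phi> j) g"
    and b: "\<And>k. k \<in> J \<Longrightarrow> b k \<in> generated_ideal_in R G"
    and dual: "\<And>j k. j \<in> J \<Longrightarrow> k \<in> J \<Longrightarrow> coeff_sum (\<phi> j) (b k) = (if j = k then 1 else 0)"
  shows "card J \<le> card G"
proof (rule ccontr)
  assume "\<not> card J \<le> card G"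
  \<comment> \<open>A nontrivial combination of the functionals vanishes on all generators, hence on
    the ideal, against the duality with the elements \<open>b k\<close>.\<close>
  then obtain c where c: "\<exists>j\<in>J. c j \<noteq> 0" "\<forall>g\<in>G. (\<Sum>j\<in>J. c j * coeff_sum (\<phi> j) g) = 0"
    using homogeneous_system[OF G J, of "\<lambda>j g. coeff_sum (\<phi> j) g"] by auto
  have "c k = 0" if k: "k \<in> J" for k
  proof -
    obtain h where h: "b k = (\<Sum>g\<in>G. h g * g)" "\<forall>g\<in>G. h g \<in> R" using b[OF k] by (auto simp: generated_ideal_in_def)
    have "c k = (\<Sum>j\<in>J. c j * coeff_sum (\<phi> j) (b k))"
      using k J by (simp add: dual if_distrib cong: if_cong)
    also have "\<dots> = (\<Sum>j\<in>J. c j * (\<Sum>g\<in>G. \<eta> (h g) * coeff_sum (\<phi> j) g))"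
      using mult h by (simp add: coeff_sum_sum)
    also have "\<dots> = (\<Sum>j\<in>J. \<Sum>g\<in>G. \<eta> (h g) * (c j * coeff_sum (\<phi> j) g))"
      by (simp add: sum_distrib_left mult.left_commute)
    also have "\<dots> = (\<Sum>g\<in>G. \<eta> (h g) * (\<Sum>j\<in>J. c j * coeff_sum (\<phi> j) g))"
      unfolding sum_distrib_left by (rule sum.swap)
    also have "\<dots> = 0" using c(2) by simp
    finally show ?thesis .
  qed
  then show False using c(1) by blast
qed

section \<open>Binomial generators of a pointed configuration\<close>

lemma clear_denominators:
  fixes l :: "'a \<Rightarrow> rat"
  assumes "finite S"
  obtains N :: nat and k where "N > 0" "\<And>s. s \<in> S \<Longrightarrow> of_nat N * l s = of_int (k s)"
proof -
  have "\<exists>N::nat. N > 0 \<and> (\<forall>s\<in>S. \<exists>k. of_nat N * l s = of_int k)" using assms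
  proof (induction S)
    case (insert s S)
    then obtain N :: nat where N: "N > 0" "\<forall>s\<in>S. \<exists>k. of_nat N * l s = of_int k" by blast
    obtain a b where q: "quotient_of (l s) = (a, b)" by force
    have b: "b > 0" "l s = of_int a / of_int b" using quotient_of_denom_pos[OF q] quotient_of_div[OF q] by auto
    have "of_nat (N * nat b) * l s = of_int (int N * a)" using b by simp
    moreover have "\<exists>k. of_nat (N * nat b) * l t = of_int k" if t: "t \<in> S" for t
    proof -
      obtain k where "of_nat N * l t = of_int k" using N(2) t by blast
      moreover have "of_nat (N * nat b) * l t = of_int b * (of_nat N * l t)" using b(1) by simp
      ultimately have "of_nat (N * nat b) * l t = of_int (b * k)" by simp
      then show ?thesis by blast
    qed
    moreover have "N * nat b > 0" using N(1) b(1) by simp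
    ultimately show ?case by blast
  qed (auto intro: exI[of _ 1])
  then obtain N :: nat where N: "N > 0" "\<forall>s\<in>S. \<exists>k. of_nat N * l s = of_int k" by blast
  then obtain k where "\<forall>s\<in>S. of_nat N * l s = of_int (k s)" by metis
  then show thesis using that N(1) by blast
qed

text \<open>Denominators of a rational relation are cleared, and negative coefficients are moved to
  the side of \<open>s\<close>.\<close>

lemma lattice_relation:
  assumes B: "finite B" and s: "rat_of_lat s \<in> vec.span (rat_of_lat ` B)"
  obtains N e f where "N > 0" "keys e \<subseteq> B" "keys f \<subseteq> B"
    "lat_deg (single s N + e) = lat_deg f"
proof -
  obtain u where "rat_of_lat s = (\<Sum>v\<in>rat_of_lat ` B. u v *s v)"
    using s vec.span_finite[of "rat_of_lat ` B"] B by auto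
  then have u: "rat_of_lat s = (\<Sum>b\<in>B. u (rat_of_lat b) *s rat_of_lat b)"
    by (simp add: sum.reindex[OF inj_rat_of_lat])
  obtain N :: nat and k where N: "N > 0" "\<And>b. b \<in> B \<Longrightarrow> of_nat N * u (rat_of_lat b) = of_int (k b)"
    by (rule clear_denominators[OF B, of "\<lambda>b. u (rat_of_lat b)"]) (rule that)
  have "rat_of_lat (int N *s s) = of_nat N *s rat_of_lat s" by (simp add: rat_of_lat_simps)
  also have "\<dots> = (\<Sum>b\<in>B. (of_nat N * u (rat_of_lat b)) *s rat_of_lat b)"
    unfolding u vec.scale_sum_right by simp
  also have "\<dots> = (\<Sum>b\<in>B. rat_of_lat (k b *s b))"
    using N(2) by (intro sum.cong) (auto simp: rat_of_lat_simps)
  finally have Ns: "int N *s s = (\<Sum>b\<in>B. k b *s b)" by (simp add: rat_of_lat_sum[symmetric] rat_of_lat_inj)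
  let ?e = "monomial_on B (\<lambda>b. nat (- k b))" and ?f = "monomial_on B (\<lambda>b. nat (k b))"
  have "lat_deg (single s N + ?e) = (\<Sum>b\<in>B. k b *s b + int (nat (- k b)) *s b)"
    by (simp add: lat_deg_add lat_deg_single lat_deg_monomial_on[OF B] Ns sum.distrib)
  also have "\<dots> = lat_deg ?f" unfolding lat_deg_monomial_on[OF B]
    by (intro sum.cong refl) (simp add: vec_eq_iff distrib_right[symmetric])
  finally show thesis using that[of N ?e ?f] N(1) keys_monomial_on[OF B] by blast
qed

locale toric_config =
  fixes A :: "(int ^ 'n) set"
  assumes finite_A: "finite A" and pointed: "nat_monoid A \<inter> uminus ` nat_monoid A = {0}"
begin

text \<open>The condition \<open>pointed\<close> allows 0 in \<open>A\<close>. The combinatorics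
  uses the nonzero points, and the variable of 0 is handled separately.\<close>

abbreviation "A' \<equiv> A - {0}"

lemma finite_A': "finite A'"
  using finite_A by simp

text \<open>If \<open>c a\<close> were positive, lowering it by one would exhibit \<open>- a\<close>
  as an element of the monoid.\<close>

lemma pointed_coeff:
  assumes "(\<Sum>a\<in>A'. int (c a) *s a) = 0" "a \<in> A'"
  shows "c a = 0"
proof (rule ccontr)
  assume "c a \<noteq> 0"
  then obtain m where m: "c a = Suc m" by (cases "c a") auto
  have nm: "(\<Sum>x\<in>A'. int (d x) *s x) \<in> nat_monoid A" for d
  proof -
    have "(\<Sum>x\<in>A'. int (d x) *s x) = (\<Sum>x\<in>A. of_int (int (d x)) *s x)"
      using finite_A by (intro sum.mono_neutral_cong_left) auto
    then show ?thesis unfolding nat_monoid_def by blast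
  qed
  have "a = (\<Sum>x\<in>A'. int (if x = a then 1 else 0) *s x)"
  proof -
    have "(\<Sum>x\<in>A'. int (if x = a then 1 else 0) *s x) = (\<Sum>x\<in>A'. if x = a then x else 0)"
      by (intro sum.cong) auto
    then show ?thesis using assms(2) finite_A' by simp
  qed
  then have a: "a \<in> nat_monoid A" using nm[of "\<lambda>x. if x = a then 1 else 0"] by simp
  have "(\<Sum>x\<in>A'. int ((c(a := m)) x) *s x) = (\<Sum>x\<in>A'. int (c x) *s x) - a"
  proof -
    have "(\<Sum>x\<in>A'. int (c x) *s x) - (\<Sum>x\<in>A'. int ((c(a := m)) x) *s x) = (\<Sum>x\<in>A'. if x = a then x else 0)"
    proof -
      have "int (c x) *s x - int ((c(a := m)) x) *s x = (if x = a then x else 0)" for x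
        by (cases "x = a") (simp_all add: m vector_sadd_rdistrib)
      then show ?thesis unfolding sum_subtractf[symmetric] by simp
    qed
    then have "(\<Sum>x\<in>A'. int (c x) *s x) - (\<Sum>x\<in>A'. int ((c(a := m)) x) *s x) = a"
      using assms(2) finite_A' by simp
    then have "(\<Sum>x\<in>A'. int (c x) *s x) = a + (\<Sum>x\<in>A'. int ((c(a := m)) x) *s x)"
      by (simp only: diff_eq_eq)
    then show ?thesis by (simp only: add_diff_cancel_left')
  qed
  then have "- a \<in> nat_monoid A" using nm[of "c(a := m)"] assms(1) by simp
  then have "a \<in> nat_monoid A \<inter> uminus ` nat_monoid A" using a by (metis IntI image_eqI minus_minus)
  then show False using pointed assms(2) by auto
qed

text \<open>The alternative in Gordan's theorem is a nonnegative rational relation which, cleared of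
  denominators, contradicts \<open>pointed_coeff\<close>. The weight makes the rational cone pointed
  and measures degrees in inductions.\<close>

lemma weight_exists: obtains w where "\<And>a. a \<in> A' \<Longrightarrow> qdot w (rat_of_lat a) > 0"
proof -
  have no: "\<not> (\<exists>l. (\<forall>i\<in>A'. l i \<ge> 0) \<and> (\<exists>i\<in>A'. l i > 0) \<and> (\<Sum>i\<in>A'. l i *s rat_of_lat i) = 0)"
  proof
    assume "\<exists>l. (\<forall>i\<in>A'. l i \<ge> 0) \<and> (\<exists>i\<in>A'. l i > 0) \<and> (\<Sum>i\<in>A'. l i *s rat_of_lat i) = 0"
    then obtain l where l: "\<forall>i\<in>A'. l i \<ge> 0" "\<exists>i\<in>A'. l i > 0" "(\<Sum>i\<in>A'. l i *s rat_of_lat i) = 0" by blast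
    obtain N :: nat and k where N: "N > 0" "\<And>a. a \<in> A' \<Longrightarrow> of_nat N * l a = of_int (k a)"
      by (rule clear_denominators[OF finite_A', of l]) (rule that)
    have k: "k a \<ge> 0" if "a \<in> A'" for a
    proof -
      have "(of_int (k a) :: rat) \<ge> 0" using N(2)[OF that] l(1) that by (metis mult_nonneg_nonneg of_nat_0_le_iff)
      then show ?thesis by simp
    qed
    have "rat_of_lat (\<Sum>a\<in>A'. int (nat (k a)) *s a) = (\<Sum>a\<in>A'. (of_nat N * l a) *s rat_of_lat a)"
      unfolding rat_of_lat_sum using N(2) k by (intro sum.cong) (auto simp: rat_of_lat_simps)
    also have "\<dots> = of_nat N *s (\<Sum>a\<in>A'. l a *s rat_of_lat a)" by (simp add: vec.scale_sum_right)
    also have "\<dots> = rat_of_lat 0" by (simp add: l(3) rat_of_lat_simps)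
    finally have "(\<Sum>a\<in>A'. int (nat (k a)) *s a) = 0" by (simp only: rat_of_lat_inj)
    then have "nat (k a) = 0" if "a \<in> A'" for a using pointed_coeff[of "\<lambda>a. nat (k a)"] that by blast
    then have "of_nat N * l a = 0" if "a \<in> A'" for a using N(2)[OF that] k[OF that] that by force
    then show False using l(2) N(1) by force
  qed
  have "\<exists>w. \<forall>a\<in>A'. qdot w (rat_of_lat a) > 0"
    by (rule disjE[OF gordan[OF finite_A', of rat_of_lat]]) (assumption, erule notE[OF no])
  then show thesis using that by blast
qed

section \<open>Linked exponents and the classes indexing binomial generators\<close>

definition X :: "'n expo set" where
  "X = {e. keys e \<subseteq> A'}"

lemma lat_deg_X: "e \<in> X \<Longrightarrow> lat_deg e = (\<Sum>a\<in>A'. int (lookup e a) *s a)"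
  using finite_A' by (intro lat_deg_superset) (auto simp: X_def)

lemma lat_deg_eq_0: "e \<in> X \<Longrightarrow> lat_deg e = 0 \<longleftrightarrow> e = 0"
proof
  assume e: "e \<in> X" "lat_deg e = 0"
  have "lookup e a = 0" for a
  proof (cases "a \<in> A'")
    case True
    then show ?thesis using pointed_coeff[of "lookup e"] e by (simp add: lat_deg_X)
  next
    case False
    then show ?thesis using e(1) by (auto simp: X_def in_keys_iff)
  qed
  then show "e = 0" by (intro poly_mapping_eqI) simp
qed simp

text \<open>Two monomials of equal degree with a common variable differ by that variable times a
  binomial of the ideal. By the classical count, a degree needs one generator fewer than this graph
  has components.\<close>

definition shares :: "'n expo \<Rightarrow> 'n expo \<Rightarrow> bool" where
  "shares e f \<longleftrightarrow> e \<in> X \<and> f \<in> X \<and> lat_deg e = lat_deg f \<and> keys e \<inter> keys f \<noteq> {}"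

abbreviation linked :: "'n expo \<Rightarrow> 'n expo \<Rightarrow> bool" where
  "linked \<equiv> shares\<^sup>*\<^sup>*"

lemma linked_sym: "linked e f \<Longrightarrow> linked f e"
proof -
  have "symp shares" by (auto simp: symp_def shares_def)
  then show "linked e f \<Longrightarrow> linked f e" by (metis symp_rtranclp sympD)
qed

lemma linked_props: "linked e f \<Longrightarrow> e \<in> X \<Longrightarrow> f \<in> X \<and> lat_deg f = lat_deg e"
  by (induction rule: rtranclp_induct) (auto simp: shares_def)

definition rep :: "int ^ 'n \<Rightarrow> 'n expo" where
  "rep u = (SOME e. e \<in> X \<and> lat_deg e = u)"

lemma rep: "e \<in> X \<Longrightarrow> rep (lat_deg e) \<in> X \<and> lat_deg (rep (lat_deg e)) = lat_deg e"
  unfolding rep_def by (rule someI[of "\<lambda>x. x \<in> X \<and> lat_deg x = lat_deg e"]) simp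

text \<open>The classes of linked exponents that do not contain the representative of their degree index a
  minimal set of binomial generators.\<close>

definition \<Gamma> :: "'n expo set set" where
  "\<Gamma> = {Collect (linked e) | e. e \<in> X \<and> \<not> linked e (rep (lat_deg e))}"

text \<open>The generator of the class \<open>\<gamma>\<close> is the binomial of
  \<open>pe \<gamma>\<close>, a member of the class, and \<open>pf \<gamma>\<close>, the
  representative of its degree.\<close>

definition pe :: "'n expo set \<Rightarrow> 'n expo" where
  "pe \<gamma> = (SOME e. e \<in> X \<and> \<gamma> = Collect (linked e) \<and> \<not> linked e (rep (lat_deg e)))"

definition pf :: "'n expo set \<Rightarrow> 'n expo" where
  "pf \<gamma> = rep (lat_deg (pe \<gamma>))"

lemma pe:
  assumes "\<gamma> \<in> \<Gamma>"
  shows "pe \<gamma> \<in> X" "\<gamma> = Collect (linked (pe \<gamma>))" "\<not> linked (pe \<gamma>) (pf \<gamma>)" "pf \<gamma> \<in> X" "lat_deg (pf \<gamma>) = lat_deg (pe \<gamma>)"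
proof -
  have "\<exists>e. e \<in> X \<and> \<gamma> = Collect (linked e) \<and> \<not> linked e (rep (lat_deg e))" using assms by (auto simp: \<Gamma>_def)
  then have *: "pe \<gamma> \<in> X \<and> \<gamma> = Collect (linked (pe \<gamma>)) \<and> \<not> linked (pe \<gamma>) (rep (lat_deg (pe \<gamma>)))"
    unfolding pe_def by (rule someI_ex)
  then show "pe \<gamma> \<in> X" "\<gamma> = Collect (linked (pe \<gamma>))" "\<not> linked (pe \<gamma>) (pf \<gamma>)" by (auto simp: pf_def)
  show "pf \<gamma> \<in> X" "lat_deg (pf \<gamma>) = lat_deg (pe \<gamma>)" using rep[of "pe \<gamma>"] * by (auto simp: pf_def)
qed

lemma pe_pf_nonzero: "\<gamma> \<in> \<Gamma> \<Longrightarrow> pe \<gamma> \<noteq> 0 \<and> pf \<gamma> \<noteq> 0"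
proof -
  assume \<gamma>: "\<gamma> \<in> \<Gamma>"
  have "pe \<gamma> = 0 \<longleftrightarrow> pf \<gamma> = 0" using lat_deg_eq_0[of "pe \<gamma>"] lat_deg_eq_0[of "pf \<gamma>"] pe[OF \<gamma>] by simp
  moreover have "pe \<gamma> \<noteq> pf \<gamma>" using pe(3)[OF \<gamma>] by auto
  ultimately show ?thesis by auto
qed

lemma pe_pf_disjoint: "\<gamma> \<in> \<Gamma> \<Longrightarrow> keys (pe \<gamma>) \<inter> keys (pf \<gamma>) = {}"
  using pe[of \<gamma>] by (metis r_into_rtranclp shares_def)

lemma mem_class: "\<gamma> \<in> \<Gamma> \<Longrightarrow> linked e f \<Longrightarrow> e \<in> \<gamma> \<longleftrightarrow> f \<in> \<gamma>"
  using pe(2)[of \<gamma>] linked_sym by (metis mem_Collect_eq rtranclp_trans)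

text \<open>Exponents sharing a variable are divided by it, which lowers the weight. Chaining such
  steps covers a class, and its generator joins it to the representative of the degree. In this form
  the binomials of \<open>\<Gamma>\<close> generate the relations without reference to a
  field.\<close>

lemma generation:
  assumes Qrefl: "\<And>e. e \<in> X \<Longrightarrow> Q e e"
    and Qsym: "\<And>e f. e \<in> X \<Longrightarrow> f \<in> X \<Longrightarrow> Q e f \<Longrightarrow> Q f e"
    and Qtrans: "\<And>e f g. e \<in> X \<Longrightarrow> f \<in> X \<Longrightarrow> g \<in> X \<Longrightarrow> Q e f \<Longrightarrow> Q f g \<Longrightarrow> Q e g"
    and Qgen: "\<And>\<gamma>. \<gamma> \<in> \<Gamma> \<Longrightarrow> Q (pe \<gamma>) (pf \<gamma>)"
    and Qadd: "\<And>e f a. e \<in> X \<Longrightarrow> f \<in> X \<Longrightarrow> a \<in> A' \<Longrightarrow> Q e f \<Longrightarrow> Q (e + single a 1) (f + single a 1)"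
    and ef: "e \<in> X" "f \<in> X" "lat_deg e = lat_deg f"
  shows "Q e f"
proof -
  obtain w where w: "\<And>a. a \<in> A' \<Longrightarrow> qdot w (rat_of_lat a) > 0" by (rule weight_exists) (rule that)
  let ?w = "\<lambda>u. qdot w (rat_of_lat u)"
  \<comment> \<open>Rational weights are not well-founded, so the induction is on \<open>n\<close>
    with weight below \<open>n * \<delta>\<close>; dividing by a variable lowers the weight by at
    least \<delta>.\<close>
  obtain \<delta> where \<delta>: "\<delta> > 0" "\<And>a. a \<in> A' \<Longrightarrow> \<delta> \<le> ?w a"
  proof -
    have "\<exists>\<delta>>0. \<forall>a\<in>A'. \<delta> \<le> ?w a"
    proof (cases "A' = {}")
      case False
      then show ?thesis using w finite_A' by (intro exI[of _ "Min (?w ` A')"]) auto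
    qed (auto intro: exI[of _ 1])
    then show thesis using that by blast
  qed
  have main: "\<forall>e f. e \<in> X \<longrightarrow> f \<in> X \<longrightarrow> lat_deg e = lat_deg f \<longrightarrow> ?w (lat_deg e) < of_nat n * \<delta> \<longrightarrow> Q e f" for n
  proof (induction n)
    case 0
    have "?w (lat_deg e) \<ge> 0" if "e \<in> X" for e
      unfolding lat_deg_X[OF that] rat_of_lat_sum rat_of_lat_simps qdot_sum qdot_simps
      using w by (intro sum_nonneg mult_nonneg_nonneg) (auto simp: less_imp_le)
    then show ?case by (auto simp: not_less[symmetric])
  next
    case (Suc n)
    have share: "Q e f" if sh: "shares e f" and le: "?w (lat_deg e) < of_nat (Suc n) * \<delta>" for e f
    proof -
      obtain a where a: "a \<in> keys e" "a \<in> keys f" and X: "e \<in> X" "f \<in> X" "lat_deg e = lat_deg f"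
        using sh by (auto simp: shares_def)
      then have aA: "a \<in> A'" by (auto simp: X_def)
      let ?e = "e - single a 1" and ?f = "f - single a 1"
      have dec: "e = ?e + single a 1" "f = ?f + single a 1"
        using a by (auto intro!: poly_mapping_eqI simp: lookup_add lookup_minus lookup_single when_def in_keys_iff)
      have "keys ?e \<subseteq> keys e" "keys ?f \<subseteq> keys f"
        by (auto simp: in_keys_iff lookup_minus)
      then have X': "?e \<in> X" "?f \<in> X" using X by (auto simp: X_def)
      have dg: "lat_deg e = lat_deg ?e + a" "lat_deg f = lat_deg ?f + a"
        using lat_deg_add[of ?e "single a 1"] lat_deg_add[of ?f "single a 1"] dec
        by (auto simp: lat_deg_single)
      have "?w (lat_deg e) = ?w (lat_deg ?e) + ?w a" unfolding dg(1) by (simp add: rat_of_lat_simps qdot_simps)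
      then have "?w (lat_deg ?e) < of_nat n * \<delta>" using le \<delta>(2)[OF aA] by (simp add: distrib_right)
      moreover have "lat_deg ?e = lat_deg ?f" using dg X(3) by simp
      ultimately have "Q ?e ?f" using Suc X' by blast
      then have "Q (?e + single a 1) (?f + single a 1)" using Qadd[OF X' aA] by blast
      then show ?thesis using dec by metis
    qed
    have link: "Q e f" if "linked e f" "e \<in> X" "?w (lat_deg e) < of_nat (Suc n) * \<delta>" for e f
      using that
    proof (induction rule: rtranclp_induct)
      case (step y z)
      have y: "y \<in> X" "lat_deg y = lat_deg e" using linked_props[OF step.hyps(1) step.prems(1)] by auto
      have "z \<in> X" using step.hyps(2) by (auto simp: shares_def)
      moreover have "Q y z" using share[OF step.hyps(2)] step.prems(2) y by simp
      ultimately show ?case using step y Qtrans by blast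
    qed (use Qrefl in blast)
    have to_rep: "Q e (rep (lat_deg e))" if e: "e \<in> X" "?w (lat_deg e) < of_nat (Suc n) * \<delta>" for e
    proof (cases "linked e (rep (lat_deg e))")
      case False
      define \<gamma> where "\<gamma> = Collect (linked e)"
      have \<gamma>: "\<gamma> \<in> \<Gamma>" using False e(1) unfolding \<Gamma>_def \<gamma>_def by blast
      have "linked (pe \<gamma>) e" using pe(2)[OF \<gamma>] by (auto simp: \<gamma>_def)
      then have l: "linked e (pe \<gamma>)" by (rule linked_sym)
      have d: "lat_deg (pe \<gamma>) = lat_deg e" using linked_props[OF l e(1)] by simp
      have "Q e (pe \<gamma>)" using link[OF l e] .
      moreover have "Q (pe \<gamma>) (rep (lat_deg e))" using Qgen[OF \<gamma>] by (simp add: pf_def d)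
      ultimately show ?thesis using Qtrans e(1) pe(1)[OF \<gamma>] rep[OF e(1)] by blast
    qed (use link e in blast)
    show ?case
    proof (intro allI impI)
      fix e f assume ef: "e \<in> X" "f \<in> X" "lat_deg e = lat_deg f" "?w (lat_deg e) < of_nat (Suc n) * \<delta>"
      have "Q e (rep (lat_deg e))" "Q f (rep (lat_deg e))" using to_rep[of e] to_rep[of f] ef by auto
      then show "Q e f" using Qsym Qtrans rep[OF ef(1)] ef by blast
    qed
  qed
  obtain n where "?w (lat_deg e) < of_nat n * \<delta>"
    using reals_Archimedean3[OF \<delta>(1)] by blast
  then show ?thesis using main ef by blast
qed

end

section \<open>Functionals at the augmentation and the number of generators\<close>

context toric_config
begin

text \<open>Setting the variable of the lattice point \<open>0\<close> (if present) to 1.\<close>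

definition drop0 :: "'n expo \<Rightarrow> 'n expo" where
  "drop0 e = e - single 0 (lookup e 0)"

lemma lookup_drop0: "lookup (drop0 e) a = (if a = 0 then 0 else lookup e a)"
  by (simp add: drop0_def lookup_minus lookup_single when_def)

lemma drop0_add: "drop0 (e + f) = drop0 e + drop0 f"
  by (rule poly_mapping_eqI) (simp add: lookup_drop0 lookup_add)

lemma drop0_decomp: "e = drop0 e + single 0 (lookup e 0)"
  by (rule poly_mapping_eqI) (auto simp: lookup_drop0 lookup_add lookup_single when_def)

lemma lat_deg_drop0: "lat_deg (drop0 e) = lat_deg e"
proof -
  have "lat_deg e = lat_deg (drop0 e) + lat_deg (single 0 (lookup e 0))"
    using drop0_decomp[of e] lat_deg_add by metis
  then show ?thesis by (simp add: lat_deg_single)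
qed

lemma drop0_X: "keys e \<subseteq> A \<Longrightarrow> drop0 e \<in> X"
  by (auto simp: X_def in_keys_iff lookup_drop0 split: if_splits)

lemma drop0_id: "e \<in> X \<Longrightarrow> drop0 e = e"
  by (rule poly_mapping_eqI) (auto simp: X_def in_keys_iff lookup_drop0)

lemma X_keys: "e \<in> X \<Longrightarrow> keys e \<subseteq> A"
  by (auto simp: X_def)

text \<open>Values on monomials of the augmentation sending the variable of the point 0 to 1 and all
  others to 0. The value 1 is forced if the augmentation is to vanish on the ideal, which contains
  that variable minus 1.\<close>

abbreviation \<delta>0 :: "'n expo \<Rightarrow> 'k::field" where
  "\<delta>0 g \<equiv> if drop0 g = 0 then 1 else 0"

text \<open>Modelled on derivations at the augmentation: on the ideal, where the augmentation
  vanishes, the Leibniz rule keeps one term. The defect is required to depend only on the degree of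
  \<open>e\<close>, so that it sums to 0 over an element of the ideal.\<close>

definition derivation_like :: "('n expo \<Rightarrow> 'k::field) \<Rightarrow> bool" where
  "derivation_like \<phi> \<longleftrightarrow> (\<forall>g e f. keys g \<subseteq> A \<longrightarrow> keys e \<subseteq> A \<longrightarrow> keys f \<subseteq> A \<longrightarrow>
    lat_deg e = lat_deg f \<longrightarrow> \<phi> (g + e) - \<delta>0 g * \<phi> e = \<phi> (g + f) - \<delta>0 g * \<phi> f)"

lemma derivation_like_mult:
  fixes K :: "'k::field itself"
  assumes \<phi>: "derivation_like \<phi>" and h: "h \<in> poly_ring K A" and p: "p \<in> toric_ideal K A"
  shows "coeff_sum \<phi> (h * p) = coeff_sum \<delta>0 h * coeff_sum \<phi> p"
proof -
  have "coeff_sum (\<lambda>e. \<phi> (g + e)) p = \<delta>0 g * coeff_sum \<phi> p" if "g \<in> keys h" for g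
  proof -
    have g: "keys g \<subseteq> A" using h that by (auto simp: poly_ring_def)
    have "coeff_sum (\<lambda>e. \<phi> (g + e) - \<delta>0 g * \<phi> e) p = 0"
      using \<phi> g unfolding derivation_like_def by (intro toric_ideal_degree_sum[OF p]) blast
    moreover have "coeff_sum (\<lambda>e. \<phi> (g + e) - \<delta>0 g * \<phi> e) p = coeff_sum (\<lambda>e. \<phi> (g + e)) p - \<delta>0 g * coeff_sum \<phi> p"
      by (simp add: coeff_sum_def left_diff_distrib sum_subtractf sum_distrib_left)
    ultimately show ?thesis by simp
  qed
  then have "coeff_sum \<phi> (h * p) = (\<Sum>g\<in>keys h. lookup h g * (\<delta>0 g * coeff_sum \<phi> p))"
    unfolding coeff_sum_mult by (intro sum.cong refl) simp
  also have "\<dots> = coeff_sum \<delta>0 h * coeff_sum \<phi> p"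
    unfolding coeff_sum_def[of \<delta>0] sum_distrib_right by (intro sum.cong refl) (simp add: mult_ac)
  finally show ?thesis .
qed

text \<open>A factor \<open>g\<close> with a variable other than that of 0 makes exponents of equal
  degree share this variable, so they fall into one class; a power of the variable of 0 disappears
  under \<open>drop0\<close>.\<close>

lemma derivation_like_class:
  assumes "\<gamma> \<in> \<Gamma>"
  shows "derivation_like (\<lambda>e. if drop0 e \<in> \<gamma> then 1 else 0 :: 'k::field)"
  unfolding derivation_like_def
proof (intro allI impI)
  fix g e f :: "'n expo"
  assume k: "keys g \<subseteq> A" "keys e \<subseteq> A" "keys f \<subseteq> A" "lat_deg e = lat_deg f"
  show "(if drop0 (g + e) \<in> \<gamma> then 1 else 0) - \<delta>0 g * (if drop0 e \<in> \<gamma> then 1 else 0) =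
    (if drop0 (g + f) \<in> \<gamma> then 1 else 0) - \<delta>0 g * (if drop0 f \<in> \<gamma> then 1 else 0 :: 'k)"
  proof (cases "drop0 g = 0")
    case True
    then show ?thesis by (simp add: drop0_add)
  next
    case False
    then obtain a where a: "a \<in> keys (drop0 g)" by (metis all_not_in_conv keys_eq_empty)
    have "a \<in> keys (drop0 g + drop0 e)" "a \<in> keys (drop0 g + drop0 f)"
      using a by (auto simp: in_keys_iff lookup_add)
    moreover have "drop0 (g + e) \<in> X" "drop0 (g + f) \<in> X"
      using drop0_X k keys_add[of g e] keys_add[of g f] by (meson Un_least order_trans)+
    moreover have "lat_deg (drop0 (g + e)) = lat_deg (drop0 (g + f))" using k by (simp add: lat_deg_drop0 lat_deg_add)
    ultimately have "shares (drop0 (g + e)) (drop0 (g + f))" unfolding shares_def by (auto simp: drop0_add)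
    then have "drop0 (g + e) \<in> \<gamma> \<longleftrightarrow> drop0 (g + f) \<in> \<gamma>" using mem_class[OF assms] by blast
    then show ?thesis using False by simp
  qed
qed

text \<open>The partial derivative in the variable of the point 0, taken at the augmentation; it
  detects the generator due to this point.\<close>

lemma derivation_like_zero:
  "derivation_like (\<lambda>e. if drop0 e = 0 then of_nat (lookup e 0) else 0 :: 'k::field)"
  unfolding derivation_like_def
proof (intro allI impI)
  fix g e f :: "'n expo"
  assume k: "keys g \<subseteq> A" "keys e \<subseteq> A" "keys f \<subseteq> A" "lat_deg e = lat_deg f"
  have add0: "drop0 (g + x) = 0 \<longleftrightarrow> drop0 g = 0 \<and> drop0 x = 0" for x
    by (auto simp: drop0_add poly_mapping_eq_iff fun_eq_iff lookup_add)
  have "drop0 e = 0 \<longleftrightarrow> drop0 f = 0"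
    using lat_deg_eq_0[OF drop0_X[OF k(2)]] lat_deg_eq_0[OF drop0_X[OF k(3)]] k(4) by (simp add: lat_deg_drop0)
  then show "(if drop0 (g + e) = 0 then of_nat (lookup (g + e) 0) else 0) -
      \<delta>0 g * (if drop0 e = 0 then of_nat (lookup e 0) else 0) =
    (if drop0 (g + f) = 0 then of_nat (lookup (g + f) 0) else 0) -
      \<delta>0 g * (if drop0 f = 0 then of_nat (lookup f 0) else 0 :: 'k)"
    by (simp add: add0 lookup_add)
qed

lemma coeff_sum_binomial:
  fixes \<phi> :: "'e \<Rightarrow> 'k::comm_ring_1"
  shows "coeff_sum \<phi> (single e 1 - single f 1) = \<phi> e - \<phi> f"
proof -
  have "single e (1::'k) - single f 1 = single e 1 + single f (- 1)"
    by (simp add: single_uminus)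
  then show ?thesis by (simp only: coeff_sum_add coeff_sum_single) simp
qed

lemma card_\<Gamma>_le:
  fixes K :: "'k::field itself"
  assumes G: "finite G" "generated_ideal_in (poly_ring K A) G = toric_ideal K A"
  shows "finite \<Gamma> \<and> card \<Gamma> + (if 0 \<in> A then 1 else 0) \<le> card G"
proof -
  have GI: "G \<subseteq> toric_ideal K A" using generated_ideal_in_base[OF G(1), of _ K A] G(2) by blast
  \<comment> \<open>Finiteness of \<Gamma> is part of the conclusion, so the bound is first proved
    for finite subsets.\<close>
  have bound: "card \<Gamma>0 + (if 0 \<in> A then 1 else 0) \<le> card G" if fin: "finite \<Gamma>0" and sub: "\<Gamma>0 \<subseteq> \<Gamma>" for \<Gamma>0
  proof -
    \<comment> \<open>\<open>None\<close> stands for the binomial of the variable of 0 and the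
      constant 1, available if 0 is in \<open>A\<close>.\<close>
    define J where "J = Some ` \<Gamma>0 \<union> (if 0 \<in> A then {None} else {})"
    define \<phi> :: "'n expo set option \<Rightarrow> 'n expo \<Rightarrow> 'k" where
      "\<phi> j = (case j of Some \<gamma> \<Rightarrow> (\<lambda>e. if drop0 e \<in> \<gamma> then 1 else 0)
        | None \<Rightarrow> (\<lambda>e. if drop0 e = 0 then of_nat (lookup e 0) else 0))" for j
    define ex where "ex j = (case j of Some \<gamma> \<Rightarrow> pe \<gamma> | None \<Rightarrow> single 0 1)" for j
    define fx where "fx j = (case j of Some \<gamma> \<Rightarrow> pf \<gamma> | None \<Rightarrow> 0)" for j
    have finJ: "finite J" using fin by (simp add: J_def)
    have "card J = card \<Gamma>0 + (if 0 \<in> A then 1 else 0)"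
      using fin by (auto simp: J_def card_image card_insert_if)
    moreover have "card J \<le> card G"
    proof (rule generators_lower_bound[OF G(1) finJ, where R = "poly_ring K A" and \<phi> = \<phi> and \<eta> = "coeff_sum \<delta>0"
          and b = "\<lambda>j. single (ex j) 1 - single (fx j) 1"])
      fix j h g assume "j \<in> J" and h: "h \<in> poly_ring K A" and "g \<in> G"
      have "derivation_like (\<phi> j)"
      proof (cases j)
        case None
        then show ?thesis using derivation_like_zero by (simp add: \<phi>_def)
      next
        case (Some \<gamma>)
        then have "\<gamma> \<in> \<Gamma>" using \<open>j \<in> J\<close> sub by (auto simp: J_def split: if_splits)
        then show ?thesis using Some derivation_like_class by (simp add: \<phi>_def)
      qed
      then show "coeff_sum (\<phi> j) (h * g) = coeff_sum \<delta>0 h * coeff_sum (\<phi> j) g"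
        using derivation_like_mult[of "\<phi> j" h K g] h GI \<open>g \<in> G\<close> by blast
    next
      fix j assume "j \<in> J"
      have "keys (ex j) \<subseteq> A \<and> keys (fx j) \<subseteq> A \<and> lat_deg (ex j) = lat_deg (fx j)"
      proof (cases j)
        case None
        then show ?thesis using \<open>j \<in> J\<close> by (auto simp: J_def ex_def fx_def lat_deg_single split: if_splits)
      next
        case (Some \<gamma>)
        then have "\<gamma> \<in> \<Gamma>" using \<open>j \<in> J\<close> sub by (auto simp: J_def split: if_splits)
        then show ?thesis using Some pe(1,4,5)[of \<gamma>] X_keys[of "pe \<gamma>"] X_keys[of "pf \<gamma>"] by (simp add: ex_def fx_def)
      qed
      then show "single (ex j) 1 - single (fx j) 1 \<in> generated_ideal_in (poly_ring K A) G"
        unfolding G(2) by (intro binomial_in_toric_ideal) auto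
    next
      fix j k assume jk: "j \<in> J" "k \<in> J"
      have drop_ex: "drop0 (single 0 1) = (0 :: 'n expo)" "drop0 0 = 0"
        by (auto intro!: poly_mapping_eqI simp: lookup_drop0 lookup_single when_def)
      have "\<phi> j (ex k) - \<phi> j (fx k) = (if j = k then 1 else 0)"
      proof (cases k)
        case None
        show ?thesis
        proof (cases j)
          case None
          then show ?thesis using \<open>k = None\<close> drop_ex by (simp add: \<phi>_def ex_def fx_def)
        next
          case (Some \<gamma>)
          then show ?thesis using \<open>k = None\<close> drop_ex by (simp add: \<phi>_def ex_def fx_def)
        qed
      next
        case (Some \<gamma>)
        then have \<gamma>: "\<gamma> \<in> \<Gamma>" using jk sub by (auto simp: J_def split: if_splits)
        note p = pe[OF \<gamma>]
        have id: "drop0 (pe \<gamma>) = pe \<gamma>" "drop0 (pf \<gamma>) = pf \<gamma>" using drop0_id p by auto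
        show ?thesis
        proof (cases j)
          case None
          then show ?thesis using Some pe_pf_nonzero[OF \<gamma>] by (simp add: \<phi>_def ex_def fx_def id)
        next
          case (Some \<beta>)
          then have \<beta>: "\<beta> \<in> \<Gamma>" using jk sub by (auto simp: J_def split: if_splits)
          have 1: "pe \<gamma> \<in> \<beta> \<longleftrightarrow> \<beta> = \<gamma>"
          proof
            assume "pe \<gamma> \<in> \<beta>"
            then have l: "linked (pe \<beta>) (pe \<gamma>)" using pe(2)[OF \<beta>] by blast
            have "linked (pe \<beta>) x \<longleftrightarrow> linked (pe \<gamma>) x" for x
              using l linked_sym[OF l] by (meson rtranclp_trans)
            then have "Collect (linked (pe \<beta>)) = Collect (linked (pe \<gamma>))" by (rule Collect_cong)
            then show "\<beta> = \<gamma>" by (rule trans[OF pe(2)[OF \<beta>] trans[OF _ p(2)[symmetric]]])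
          next
            assume "\<beta> = \<gamma>"
            then show "pe \<gamma> \<in> \<beta>" using p(2) by blast
          qed
          \<comment> \<open>No class in \<Gamma> contains the representative of its degree, so the
            second monomial contributes 0 to the dual pairing.\<close>
          have 2: "pf \<gamma> \<notin> \<beta>"
          proof
            assume "pf \<gamma> \<in> \<beta>"
            then have l: "linked (pe \<beta>) (pf \<gamma>)" using pe(2)[OF \<beta>] by blast
            then have "lat_deg (pf \<gamma>) = lat_deg (pe \<beta>)" using linked_props[OF l pe(1)[OF \<beta>]] by simp
            then have "pf \<gamma> = pf \<beta>" using p(5) by (simp add: pf_def)
            then show False using l pe(3)[OF \<beta>] by simp
          qed
          show ?thesis using Some \<open>k = Some \<gamma>\<close> 1 2 by (simp add: \<phi>_def ex_def fx_def id)
        qed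
      qed
      then show "coeff_sum (\<phi> j) (single (ex k) 1 - single (fx k) 1) = (if j = k then 1 else 0)"
        by (simp only: coeff_sum_binomial)
    qed
    ultimately show ?thesis by simp
  qed
  have "finite \<Gamma>"
  proof (rule ccontr)
    assume "infinite \<Gamma>"
    then obtain \<Gamma>0 where "\<Gamma>0 \<subseteq> \<Gamma>" "finite \<Gamma>0" "card \<Gamma>0 = card G + 1"
      using infinite_arbitrarily_large by blast
    then show False using bound[of \<Gamma>0] by (auto split: if_splits)
  qed
  then show ?thesis using bound[of \<Gamma>] by blast
qed

section \<open>Faces, dimension count and domination for the binomial generators\<close>

abbreviation "PP \<gamma> \<equiv> keys (pe \<gamma>)"
abbreviation "NN \<gamma> \<equiv> keys (pf \<gamma>)"

text \<open>Both claims survive multiplication by a variable, so \<open>generation\<close> extends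
  them from the generators to all relations. With \<open>l = 0\<close> this says that
  \<open>E\<close> behaves like a face; a nonzero \<open>l\<close> serves the dimension
  count.\<close>

lemma generation_face:
  fixes l :: "int ^ 'n \<Rightarrow> rat"
  assumes E: "E \<subseteq> A'" and face: "\<And>\<gamma>. \<gamma> \<in> \<Gamma> \<Longrightarrow> PP \<gamma> \<subseteq> E \<longleftrightarrow> NN \<gamma> \<subseteq> E"
    and l: "\<And>\<gamma>. \<gamma> \<in> \<Gamma> \<Longrightarrow> PP \<gamma> \<subseteq> E \<Longrightarrow>
      (\<Sum>a\<in>E. l a * of_nat (lookup (pe \<gamma>) a)) = (\<Sum>a\<in>E. l a * of_nat (lookup (pf \<gamma>) a))"
    and ef: "e \<in> X" "f \<in> X" "lat_deg e = lat_deg f"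
  shows "(keys e \<subseteq> E \<longleftrightarrow> keys f \<subseteq> E) \<and> (keys e \<subseteq> E \<longrightarrow>
    (\<Sum>a\<in>E. l a * of_nat (lookup e a)) = (\<Sum>a\<in>E. l a * of_nat (lookup f a)))"
    (is "?Q e f")
proof (rule generation[of ?Q, OF _ _ _ _ _ ef])
  fix e f :: "'n expo" and a assume Q: "?Q e f"
  have "keys (x + single a 1) = insert a (keys x)" for x :: "'n expo"
    by (auto simp: in_keys_iff lookup_add lookup_single when_def split: if_splits)
  then show "?Q (e + single a 1) (f + single a 1)"
    using Q by (simp add: lookup_add distrib_left sum.distrib)
next
  show "?Q (pe \<gamma>) (pf \<gamma>)" if "\<gamma> \<in> \<Gamma>" for \<gamma> using face[OF that] l[OF that] by simp
qed auto

text \<open>Otherwise a nonzero weight \<open>l\<close> on \<open>E\<close> vanishes on a basis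
  \<open>B\<close> and balances every generator inside \<open>E\<close>, hence every relation inside
  \<open>E\<close>. A relation between a multiple of \<open>a\<close> and the basis then forces
  \<open>l a = 0\<close>.\<close>

lemma face_dim:
  assumes \<Gamma>: "finite \<Gamma>" and E: "E \<subseteq> A'" and face: "\<And>\<gamma>. \<gamma> \<in> \<Gamma> \<Longrightarrow> PP \<gamma> \<subseteq> E \<longleftrightarrow> NN \<gamma> \<subseteq> E"
  shows "card E \<le> vec.dim (rat_of_lat ` E) + card {\<gamma>\<in>\<Gamma>. PP \<gamma> \<subseteq> E}"
proof (rule ccontr)
  let ?I = "{\<gamma>\<in>\<Gamma>. PP \<gamma> \<subseteq> E}"
  assume "\<not> card E \<le> vec.dim (rat_of_lat ` E) + card ?I"
  then have lt: "vec.dim (rat_of_lat ` E) + card ?I < card E" by simp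
  have finE: "finite E" using E finite_A' finite_subset by blast
  obtain B' where B': "B' \<subseteq> rat_of_lat ` E" "vec.independent B'" "rat_of_lat ` E \<subseteq> vec.span B'" "card B' = vec.dim (rat_of_lat ` E)"
    using vec.basis_exists[of "rat_of_lat ` E"] by metis
  define B where "B = {a\<in>E. rat_of_lat a \<in> B'}"
  have B: "rat_of_lat ` B = B'" "B \<subseteq> E" "finite B" using B' finE by (auto simp: B_def)
  have cardB: "card B = vec.dim (rat_of_lat ` E)" using card_image[OF inj_rat_of_lat, of B] B B' by simp
  let ?T = "Inl ` B \<union> Inr ` ?I"
  have "card ?T \<le> card B + card ?I"
    by (intro order_trans[OF card_Un_le] add_mono card_image_le) (use B \<Gamma> in auto)
  then have cardT: "card ?T < card E" using lt cardB by simp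
  have finT: "finite ?T" using B \<Gamma> by auto
  define m :: "int ^ 'n \<Rightarrow> (int ^ 'n) + 'n expo set \<Rightarrow> rat" where
    "m a t = (case t of Inl b \<Rightarrow> if a = b then 1 else 0
      | Inr \<gamma> \<Rightarrow> of_nat (lookup (pe \<gamma>) a) - of_nat (lookup (pf \<gamma>) a))" for a t
  obtain l where l: "\<exists>a\<in>E. l a \<noteq> 0" "\<forall>t\<in>?T. (\<Sum>a\<in>E. l a * m a t) = 0"
    using homogeneous_system[OF finT finE cardT, of m] by blast
  have lB: "l b = 0" if "b \<in> B" for b
  proof -
    have "(\<Sum>a\<in>E. l a * m a (Inl b)) = (\<Sum>a\<in>E. if a = b then l a else 0)"
      by (intro sum.cong) (auto simp: m_def)
    then have "(\<Sum>a\<in>E. l a * m a (Inl b)) = l b" using that B finE by auto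
    then show ?thesis using l(2) that by auto
  qed
  have lI: "(\<Sum>a\<in>E. l a * of_nat (lookup (pe \<gamma>) a)) = (\<Sum>a\<in>E. l a * of_nat (lookup (pf \<gamma>) a))"
    if "\<gamma> \<in> \<Gamma>" "PP \<gamma> \<subseteq> E" for \<gamma>
  proof -
    have "(\<Sum>a\<in>E. l a * m a (Inr \<gamma>)) = 0" using l(2) that by auto
    then show ?thesis by (simp add: m_def right_diff_distrib sum_subtractf)
  qed
  have "l a = 0" if a: "a \<in> E" for a
  proof -
    have aB: "rat_of_lat a \<in> vec.span (rat_of_lat ` B)" using B'(3) a B(1) by blast
    obtain N e f where N: "N > 0" "keys e \<subseteq> B" "keys f \<subseteq> B"
      "lat_deg (single a N + e) = lat_deg f" by (rule lattice_relation[OF B(3) aB])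
    have keys: "keys (single a N + e) \<subseteq> E" "keys f \<subseteq> E"
      using keys_add[of "single a N" e] N a B(2) by (auto split: if_splits)
    have X: "single a N + e \<in> X" "f \<in> X"
      using order_trans[OF keys(1) E] order_trans[OF keys(2) E] unfolding X_def by simp_all
    have "(\<Sum>x\<in>E. l x * of_nat (lookup (single a N + e) x)) =
        (\<Sum>x\<in>E. l x * of_nat (lookup f x))"
      using generation_face[OF E face lI X N(4)] keys(1) by simp
    moreover have zero: "(\<Sum>x\<in>E. l x * of_nat (lookup g x)) = 0" if "keys g \<subseteq> B" for g
    proof (intro sum.neutral ballI)
      fix x
      show "l x * of_nat (lookup g x) = 0"
      proof (cases "x \<in> B")
        case False
        then have "x \<notin> keys g" using that by blast
        then show ?thesis by (simp add: in_keys_iff)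
      qed (simp add: lB)
    qed
    moreover have "(\<Sum>x\<in>E. l x * of_nat (lookup (single a N) x)) = l a * of_nat N"
    proof -
      have "(\<Sum>x\<in>E. l x * of_nat (lookup (single a N) x)) =
          (\<Sum>x\<in>E. if x = a then l x * of_nat N else 0)"
        by (intro sum.cong) (auto simp: lookup_single when_def)
      then show ?thesis using a finE by simp
    qed
    ultimately have "l a * of_nat N = 0" using zero[OF N(2)] zero[OF N(3)]
      by (simp add: lookup_add distrib_left sum.distrib)
    then show ?thesis using N(1) by simp
  qed
  then show False using l(1) by blast
qed

text \<open>A maximal violating set \<open>D\<close> meets both sides or neither side of every generator, so its complement is
  the trace of a face; counting the generators inside this face shows that it has full dimension.\<close>

lemma dominating_\<Gamma>:
  assumes \<Gamma>: "finite \<Gamma>" and card: "card \<Gamma> + vec.dim (rat_of_lat ` A') \<le> card A'"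
  shows "dominating A' \<Gamma> PP NN"
proof
  fix C assume C: "C \<subseteq> A'" "C \<noteq> {}"
  let ?S = "straddling \<Gamma> PP NN"
  have finS: "finite (?S D)" for D using \<Gamma> by (auto simp: straddling_def)
  show "card (?S C) < card C"
  proof (rule ccontr)
    assume "\<not> card (?S C) < card C"
    define \<C> where "\<C> = {D. C \<subseteq> D \<and> D \<subseteq> A' \<and> card D \<le> card (?S D)}"
    have "\<C> \<subseteq> Pow A'" by (auto simp: \<C>_def)
    then have "finite \<C>" using finite_A' finite_subset by blast
    moreover have "C \<in> \<C>" using C \<open>\<not> card (?S C) < card C\<close> by (auto simp: \<C>_def)
    ultimately obtain D where D: "D \<in> \<C>" "\<And>D'. D' \<in> \<C> \<Longrightarrow> D \<subseteq> D' \<Longrightarrow> D = D'"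
      using finite_has_maximal[of \<C>] by blast
    have DA: "C \<subseteq> D" "D \<subseteq> A'" "card D \<le> card (?S D)" using D(1) by (auto simp: \<C>_def)
    have finD: "finite D" using DA finite_A' finite_subset by blast
    \<comment> \<open>Adding \<open>x\<close> raises \<open>card D\<close> by one and the number of
      straddling rows by at least one, so the larger set would still violate domination.\<close>
    have grow: False if \<gamma>: "\<gamma> \<in> \<Gamma>" "\<gamma> \<notin> ?S D" and x: "x \<in> A'" "x \<notin> D" "\<gamma> \<in> ?S (insert x D)" for \<gamma> x
    proof -
      have "insert \<gamma> (?S D) \<subseteq> ?S (insert x D)" using x(3) by (auto simp: straddling_def)
      then have "card (insert \<gamma> (?S D)) \<le> card (?S (insert x D))" using finS by (intro card_mono)
      then have "card (insert x D) \<le> card (?S (insert x D))" using \<gamma> x finD DA(3) finS by simp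
      then have "insert x D \<in> \<C>" using DA x by (auto simp: \<C>_def)
      then show False using D(2)[of "insert x D"] x(2) by blast
    qed
    define E where "E = A' - D"
    have sides: "PP \<gamma> \<subseteq> A'" "NN \<gamma> \<subseteq> A'" "PP \<gamma> \<noteq> {}" "NN \<gamma> \<noteq> {}" if "\<gamma> \<in> \<Gamma>" for \<gamma>
      using pe[OF that] pe_pf_nonzero[OF that] by (auto simp: X_def)
    have face: "PP \<gamma> \<subseteq> E \<longleftrightarrow> NN \<gamma> \<subseteq> E" if \<gamma>: "\<gamma> \<in> \<Gamma>" for \<gamma>
    proof
      assume P: "PP \<gamma> \<subseteq> E"
      obtain x where x: "x \<in> PP \<gamma>" using sides(3)[OF \<gamma>] by blast
      show "NN \<gamma> \<subseteq> E"
      proof (rule ccontr)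
        assume "\<not> NN \<gamma> \<subseteq> E"
        then have "NN \<gamma> \<inter> D \<noteq> {}" using sides(2)[OF \<gamma>] by (auto simp: E_def)
        then show False using grow[OF \<gamma>, of x] P x \<gamma> by (auto simp: E_def straddling_def)
      qed
    next
      assume N: "NN \<gamma> \<subseteq> E"
      obtain x where x: "x \<in> NN \<gamma>" using sides(4)[OF \<gamma>] by blast
      show "PP \<gamma> \<subseteq> E"
      proof (rule ccontr)
        assume "\<not> PP \<gamma> \<subseteq> E"
        then have "PP \<gamma> \<inter> D \<noteq> {}" using sides(1)[OF \<gamma>] by (auto simp: E_def)
        then show False using grow[OF \<gamma>, of x] N x \<gamma> by (auto simp: E_def straddling_def)
      qed
    qed
    have EA: "E \<subseteq> A'" by (auto simp: E_def)
    have hitD: "\<not> Y \<subseteq> E \<longleftrightarrow> Y \<inter> D \<noteq> {}" if "Y \<subseteq> A'" for Y using that by (auto simp: E_def)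
    have "?S D = \<Gamma> - {\<gamma>\<in>\<Gamma>. PP \<gamma> \<subseteq> E}"
    proof -
      have "\<gamma> \<in> ?S D \<longleftrightarrow> \<gamma> \<in> \<Gamma> - {\<gamma>\<in>\<Gamma>. PP \<gamma> \<subseteq> E}" for \<gamma>
        using face[of \<gamma>] hitD[OF sides(1), of \<gamma>] hitD[OF sides(2), of \<gamma>] by (auto simp: straddling_def)
      then show ?thesis by blast
    qed
    then have "card (?S D) + card {\<gamma>\<in>\<Gamma>. PP \<gamma> \<subseteq> E} = card \<Gamma>"
      using \<Gamma> card_Diff_subset[of "{\<gamma>\<in>\<Gamma>. PP \<gamma> \<subseteq> E}" \<Gamma>] card_mono[of \<Gamma> "{\<gamma>\<in>\<Gamma>. PP \<gamma> \<subseteq> E}"] by auto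
    moreover have "card E + card D = card A'" using card_Diff_subset[OF finD DA(2)] card_mono[OF finite_A' DA(2)] by (simp add: E_def)
    moreover have "card E \<le> vec.dim (rat_of_lat ` E) + card {\<gamma>\<in>\<Gamma>. PP \<gamma> \<subseteq> E}" by (rule face_dim[OF \<Gamma> EA face])
    \<comment> \<open>At least \<open>card E - dim E\<close> generators lie inside \<open>E\<close>
      and at least \<open>card D\<close> outside, while all of them number at most
      \<open>card A' - dim A'\<close>.\<close>
    ultimately have "vec.dim (rat_of_lat ` A') \<le> vec.dim (rat_of_lat ` E)" using card DA(3) by linarith
    then have span: "vec.span (rat_of_lat ` E) = vec.span (rat_of_lat ` A')"
      using EA by (intro vec.dim_eq_span) auto
    obtain c where c: "c \<in> D" using C DA(1) by blast
    then have cE: "rat_of_lat c \<in> vec.span (rat_of_lat ` E)" unfolding span using DA(2) by (intro vec.span_base) auto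
    have finE: "finite E" using finite_A' by (simp add: E_def)
    \<comment> \<open>The point \<open>c\<close> off the face lies in the span of the face, which
      yields a relation with one side inside \<open>E\<close> and the other involving
      \<open>c\<close>; a face excludes this.\<close>
    obtain N e f where N: "N > 0" "keys e \<subseteq> E" "keys f \<subseteq> E"
      "lat_deg (single c N + e) = lat_deg f" by (rule lattice_relation[OF finE cE])
    have keys: "keys (single c N + e) \<subseteq> A'"
    proof -
      have "keys (single c N) \<subseteq> {c}" by simp
      moreover have "c \<in> A'" using c DA(2) by (rule subsetD[rotated])
      moreover have "keys e \<subseteq> A'" using N(2) EA by (rule order_trans)
      ultimately show ?thesis using keys_add[of "single c N" e] by (meson Un_least empty_subsetI insert_subset order_trans)
    qed
    have X: "single c N + e \<in> X" "f \<in> X"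
      using keys order_trans[OF N(3) EA] unfolding X_def by simp_all
    have "keys (single c N + e) \<subseteq> E"
      using generation_face[OF EA face _ X N(4), of "\<lambda>_. 0"] N(3) by simp
    moreover have "c \<in> keys (single c N + e)" using N(1) by (simp add: in_keys_iff lookup_add)
    ultimately show False using c by (auto simp: E_def)
  qed
qed (use \<Gamma> finite_A pe pe_pf_nonzero in \<open>auto simp: X_def\<close>)

text \<open>The injection \<open>rat_of_lat\<close> transports domination. The coefficients are the
  exponents of the two monomials, which can be added into one function because the supports are
  disjoint.\<close>

lemma relation_system_\<Gamma>:
  assumes \<Gamma>: "finite \<Gamma>" and card: "card \<Gamma> + vec.dim (rat_of_lat ` A') \<le> card A'"
  shows "relation_system (rat_of_lat ` A') \<Gamma> (\<lambda>\<gamma>. rat_of_lat ` PP \<gamma>) (\<lambda>\<gamma>. rat_of_lat ` NN \<gamma>)"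
proof -
  interpret d: dominating A' \<Gamma> PP NN by (rule dominating_\<Gamma>[OF assms])
  show ?thesis
  proof
    fix C assume C: "C \<subseteq> rat_of_lat ` A'" "C \<noteq> {}"
    define D where "D = {a\<in>A'. rat_of_lat a \<in> C}"
    have DC: "rat_of_lat ` D = C" using C by (auto simp: D_def)
    have "straddling \<Gamma> (\<lambda>\<gamma>. rat_of_lat ` PP \<gamma>) (\<lambda>\<gamma>. rat_of_lat ` NN \<gamma>) C = straddling \<Gamma> PP NN D"
      unfolding DC[symmetric] by (auto simp: straddling_def rat_of_lat_inj)
    moreover have "card C = card D" using card_image[OF inj_rat_of_lat, of D] DC by simp
    moreover have "card (straddling \<Gamma> PP NN D) < card D" using C DC by (intro d.dom) (auto simp: D_def)
    ultimately show "card (straddling \<Gamma> (\<lambda>\<gamma>. rat_of_lat ` PP \<gamma>) (\<lambda>\<gamma>. rat_of_lat ` NN \<gamma>) C) < card C" by simp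
  next
    obtain w where w: "\<And>a. a \<in> A' \<Longrightarrow> qdot w (rat_of_lat a) > 0" by (rule weight_exists) (rule that)
    show "strongly_convex (pos_cone (rat_of_lat ` A'))"
      by (rule strongly_convex_pos_cone[of _ w]) (use w finite_A in auto)
  next
    fix \<gamma> assume \<gamma>: "\<gamma> \<in> \<Gamma>"
    define u :: "rat ^ 'n \<Rightarrow> rat" where
      "u x = of_nat (lookup (pe \<gamma>) (inv rat_of_lat x) + lookup (pf \<gamma>) (inv rat_of_lat x))" for x
    have u: "u (rat_of_lat a) = of_nat (lookup (pe \<gamma>) a + lookup (pf \<gamma>) a)" for a
      using inv_f_f[OF inj_rat_of_lat, of a] by (simp add: u_def)
    have deg: "(\<Sum>x\<in>rat_of_lat ` keys e. u x *s x) = rat_of_lat (lat_deg e)"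
      if "\<And>a. a \<in> keys e \<Longrightarrow> lookup (pe \<gamma>) a + lookup (pf \<gamma>) a = lookup e a" for e
      using that by (simp add: sum.reindex[OF inj_rat_of_lat] u lat_deg_def rat_of_lat_sum rat_of_lat_simps)
    have "lookup (pf \<gamma>) a = 0" if "a \<in> PP \<gamma>" for a using pe_pf_disjoint[OF \<gamma>] that by (auto simp: in_keys_iff)
    moreover have "lookup (pe \<gamma>) a = 0" if "a \<in> NN \<gamma>" for a using pe_pf_disjoint[OF \<gamma>] that by (auto simp: in_keys_iff)
    ultimately have "(\<Sum>x\<in>rat_of_lat ` PP \<gamma>. u x *s x) = (\<Sum>x\<in>rat_of_lat ` NN \<gamma>. u x *s x)"
      using deg[of "pe \<gamma>"] deg[of "pf \<gamma>"] pe(5)[OF \<gamma>] by simp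
    moreover have "u x > 0" if "x \<in> rat_of_lat ` PP \<gamma> \<union> rat_of_lat ` NN \<gamma>" for x
      using that by (auto simp: u in_keys_iff)
    ultimately show "\<exists>u. (\<forall>x\<in>rat_of_lat ` PP \<gamma> \<union> rat_of_lat ` NN \<gamma>. 0 < u x) \<and>
        (\<Sum>x\<in>rat_of_lat ` PP \<gamma>. u x *s x) = (\<Sum>x\<in>rat_of_lat ` NN \<gamma>. u x *s x)"
      by (intro exI[of _ u]) simp
  next
    show "0 \<notin> rat_of_lat ` A'"
    proof
      assume "0 \<in> rat_of_lat ` A'"
      then obtain a where a: "a \<in> A'" "rat_of_lat a = rat_of_lat 0" unfolding rat_of_lat_simps(4) by force
      then show False by (simp add: rat_of_lat_inj)
    qed
  next
    fix \<gamma> assume \<gamma>: "\<gamma> \<in> \<Gamma>"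
    show "rat_of_lat ` PP \<gamma> \<subseteq> rat_of_lat ` A'" by (rule image_mono[OF d.P_sub[OF \<gamma>]])
    show "rat_of_lat ` NN \<gamma> \<subseteq> rat_of_lat ` A'" by (rule image_mono[OF d.N_sub[OF \<gamma>]])
    show "rat_of_lat ` PP \<gamma> \<noteq> {}" "rat_of_lat ` NN \<gamma> \<noteq> {}" using d.P_ne[OF \<gamma>] d.N_ne[OF \<gamma>] by auto
  qed (use finite_A \<Gamma> in auto)
qed

end

theorem theorem3p5:
  fixes K :: "'k::field itself" and \<sigma> :: "(rat ^ 'n) set"
  assumes "ci_cone K \<sigma>" and "cone_dim \<sigma> > 1"
  shows "card (extreme_rays \<sigma>) \<le> 2 * cone_dim \<sigma> - 2
     \<and> (card (extreme_rays \<sigma>) = 2 * cone_dim \<sigma> - 2 \<longleftrightarrow> \<sigma> \<in> general_bipyramidal)"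
proof -
  obtain A where A: "finite A" "nat_monoid A \<inter> uminus ` nat_monoid A = {0}" "\<sigma> = pos_cone (rat_of_lat ` A)"
    "complete_intersection_ideal (poly_ring K A) (toric_ideal K A)"
    using assms(1) unfolding ci_cone_def by blast
  interpret toric_config A using A(1,2) by unfold_locales
  obtain G where G: "finite G" "generated_ideal_in (poly_ring K A) G = toric_ideal K A"
    "card G + vec.dim (rat_of_lat ` A) \<le> card A"
    by (rule complete_intersection_generators[OF A(1,4)]) (rule that)
  \<comment> \<open>Discarding the point 0 changes neither the dimension nor the cone.\<close>
  have insert0: "rat_of_lat ` A \<subseteq> insert 0 (rat_of_lat ` A')" by (auto simp: rat_of_lat_simps)
  have "vec.dim (rat_of_lat ` A) \<le> vec.dim (insert 0 (rat_of_lat ` A'))" using insert0 by (rule vec.dim_subset)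
  then have dim: "vec.dim (rat_of_lat ` A) = vec.dim (rat_of_lat ` A')"
    using vec.dim_subset[OF image_mono[OF Diff_subset], of rat_of_lat A "{0}"] by (simp add: vec.dim_insert vec.span_zero)
  have \<sigma>: "\<sigma> = pos_cone (rat_of_lat ` A')"
    unfolding A(3)
  proof
    show "pos_cone (rat_of_lat ` A) \<subseteq> pos_cone (rat_of_lat ` A')"
    proof (rule pos_cone_minimal[OF pos_cone_closed])
      have "insert 0 (rat_of_lat ` A') \<subseteq> pos_cone (rat_of_lat ` A')"
        using pos_cone_base[of "rat_of_lat ` A'"] pos_cone_0[of "rat_of_lat ` A'"] by simp
      then show "rat_of_lat ` A \<subseteq> pos_cone (rat_of_lat ` A')" using insert0 by (rule order_trans[rotated])
    qed
    show "pos_cone (rat_of_lat ` A') \<subseteq> pos_cone (rat_of_lat ` A)" by (intro pos_cone_mono) auto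
  qed
  have \<Gamma>: "finite \<Gamma>" "card \<Gamma> + (if 0 \<in> A then 1 else 0) \<le> card G" using card_\<Gamma>_le[OF G(1,2)] by auto
  \<comment> \<open>The point 0, if present, is balanced by the additional generator counted in
    \<open>\<Gamma>(2)\<close>.\<close>
  have "card A = card A' + (if 0 \<in> A then 1 else 0)"
  proof (cases "0 \<in> A")
    case True
    show ?thesis unfolding if_P[OF True] using card_Suc_Diff1[OF finite_A True] by linarith
  qed simp
  then have card: "card \<Gamma> + vec.dim (rat_of_lat ` A') \<le> card A'" using \<Gamma>(2) G(3) dim by (auto split: if_splits)
  have sys: "relation_system (rat_of_lat ` A') \<Gamma> (\<lambda>\<gamma>. rat_of_lat ` PP \<gamma>) (\<lambda>\<gamma>. rat_of_lat ` NN \<gamma>)"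
    by (rule relation_system_\<Gamma>[OF \<Gamma>(1) card])
  \<comment> \<open>Taking all of \<open>A'\<close> as the face gives the reverse inequality, so the
    count of generators is exact.\<close>
  have "card A' \<le> vec.dim (rat_of_lat ` A') + card {\<gamma>\<in>\<Gamma>. PP \<gamma> \<subseteq> A'}"
    using pe by (intro face_dim[OF \<Gamma>(1)]) (auto simp: X_def)
  also have "card {\<gamma>\<in>\<Gamma>. PP \<gamma> \<subseteq> A'} \<le> card \<Gamma>" using \<Gamma>(1) by (intro card_mono) auto
  finally have eq: "vec.dim (rat_of_lat ` A') + card \<Gamma> = card (rat_of_lat ` A')"
    using card card_image[OF inj_rat_of_lat, of A'] by simp
  have d: "cone_dim \<sigma> = vec.dim (rat_of_lat ` A')" unfolding \<sigma> by (rule cone_dim_pos_cone)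
  then have "vec.dim (rat_of_lat ` A') \<ge> 2" using assms(2) by simp
  then show ?thesis
    using relation_system_extreme_rays[OF sys eq] general_bipyramidal_extreme_rays[of \<sigma>] unfolding d \<sigma>[symmetric] by blast
qed

end
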